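(* Assume the standing setting in the context, including (H.1)–(H.2) and the bound (F). Let $w^\epsilon$ be the solution of $(\mathcal P_\epsilon)$ and $\hat w^\epsilon$ the solution of $(\hat{\mathcal P}_\epsilon)$, with $\hat w^\epsilon$ regarded as a function on $R^\epsilon$ that is constant in $y$. Then $$|||w^\epsilon-\hat w^\epsilon|||_{H^1(R^\epsilon)}\to0\quad\text{as }\epsilon\to0.$$
   Context: Let $I=(a,b)\subset\mathbb R$ be a bounded interval and fix $\gamma>0$. For $\epsilon\in(0,1)$ and $i=1,2$, let $k^i_\epsilon:\bar I\to(0,\infty)$ satisfy: - (H.1) $k^i_\epsilon\in C^1(\bar I)$ and $\sup_{x\in I}\epsilon|\tfrac{d}{dx}k^i_\epsilon(x)|\to0$ as $\epsilon\to0$; - (H.2) there are constants $0<C^i_1\le C^i_2$, independent of $\epsilon$, with $C^i_1\le k^i_\epsilon\le C^i_2$. Write $K_\epsilon=k^1_\epsilon+k^2_\epsilon$. Define $R^\epsilon=\{(x,y): x\in I,\ -\epsilon k^1_\epsilon(x)<y<\epsilon k^2_\epsilon(x)\}$. Let $H_\epsilon:\bar I\to\mathbb R$ be $C^1$ with constants $0\le H_0\le H_1$, independent of $\epsilon$, such that $H_0\le H_\epsilon\le H_1$. Define $\theta^\epsilon=\{(x,y): x\in I,\ \epsilon[k^2_\epsilon(x)-\epsilon^\gamma H_\epsilon(x)]<y<\epsilon k^2_\epsilon(x)\}$, with characteristic function $\chi_{\theta^\epsilon}$. Rescaled norms: $|||\varphi|||_{L^2(\mathcal O)}=\epsilon^{-1/2}\|\varphi\|_{L^2(\mathcal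 O)}$ and $|||\varphi|||_{H^1(\mathcal O)}=\epsilon^{-1/2}\|\varphi\|_{H^1(\mathcal O)}$. Let $f^\epsilon\in L^2(R^\epsilon)$ satisfy (F): $\epsilon^{-\gamma}|||f^\epsilon|||^2_{L^2(\theta^\epsilon)}\le c$, with $c$ independent of $\epsilon$. Problem $(\mathcal P_\epsilon)$: $w^\epsilon\in H^1(R^\epsilon)$ satisfies $$\int_{R^\epsilon}(\nabla w^\epsilon\cdot\nabla\varphi+w^\epsilon\varphi)=\epsilon^{-\gamma}\int_{\theta^\epsilon}f^\epsilon\varphi\quad\text{for all }\varphi\in H^1(R^\epsilon).$$ This is the Neumann problem $-\Delta w+w=\epsilon^{-\gamma}\chi_{\theta^\epsilon}f^\epsilon$. Reduced problem $(\hat{\mathcal P}_\epsilon)$: set $$\hat f^\epsilon(x)=\frac{1}{\epsilon K_\epsilon(x)}\int_{-\epsilon k^1_\epsilon(x)}^{\epsilon k^2_\epsilon(x)}\chi_{\theta^\epsilon}f^\epsilon\,dy,$$ and let $\hat w^\epsilon\in H^1(I)$ solve $$\int_I\{K_\epsilon\hat w^\epsilon_x\phi_x+K_\epsilon\hat w^\epsilon\phi\}\,dx=\epsilon^{-\gamma}\int_IK_\epsilon\hat f^\epsilon\phi\,dx\quad\text{for all }\phi\in H^1(I).$$ *)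

theory Defs
  imports "HOL-Analysis.Analysis"
begin

definition L2_on :: "('a::euclidean_space) set \<Rightarrow> ('a \<Rightarrow> real) \<Rightarrow> bool" where
  "L2_on S u \<longleftrightarrow> set_borel_measurable lborel S u \<and> set_integrable lborel S (\<lambda>z. (u z)\<^sup>2)"

definition test_fun1 :: "real set \<Rightarrow> (real \<Rightarrow> real) \<Rightarrow> (real \<Rightarrow> real) \<Rightarrow> bool" where
  "test_fun1 S \<phi> \<phi>' \<longleftrightarrow> continuous_on UNIV \<phi>' \<and> (\<forall>x. (\<phi> has_real_derivative \<phi>' x) (at x))
     \<and> compact (closure {x. \<phi> x \<noteq> 0}) \<and> closure {x. \<phi> x \<noteq> 0} \<subseteq> S"

definition test_fun2 :: "(real \<times> real) set \<Rightarrow> (real \<times> real \<Rightarrow> real)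
    \<Rightarrow> (real \<times> real \<Rightarrow> real) \<Rightarrow> (real \<times> real \<Rightarrow> real) \<Rightarrow> bool" where
  "test_fun2 S \<phi> \<phi>x \<phi>y \<longleftrightarrow> continuous_on UNIV \<phi>x \<and> continuous_on UNIV \<phi>y
     \<and> (\<forall>z. (\<phi> has_derivative (\<lambda>h. \<phi>x z * fst h + \<phi>y z * snd h)) (at z))
     \<and> compact (closure {z. \<phi> z \<noteq> 0}) \<and> closure {z. \<phi> z \<noteq> 0} \<subseteq> S"

definition H1_1 :: "real set \<Rightarrow> (real \<Rightarrow> real) \<Rightarrow> (real \<Rightarrow> real) \<Rightarrow> bool" where
  "H1_1 S u u' \<longleftrightarrow> L2_on S u \<and> L2_on S u' \<and>
     (\<forall>\<phi> \<phi>'. test_fun1 S \<phi> \<phi>' \<longrightarrow>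
        (\<integral>x\<in>S. u x * \<phi>' x \<partial>lborel) = - (\<integral>x\<in>S. u' x * \<phi> x \<partial>lborel))"

definition H1_2 :: "(real \<times> real) set \<Rightarrow> (real \<times> real \<Rightarrow> real)
    \<Rightarrow> (real \<times> real \<Rightarrow> real) \<Rightarrow> (real \<times> real \<Rightarrow> real) \<Rightarrow> bool" where
  "H1_2 S u g1 g2 \<longleftrightarrow> L2_on S u \<and> L2_on S g1 \<and> L2_on S g2 \<and>
     (\<forall>\<phi> \<phi>x \<phi>y. test_fun2 S \<phi> \<phi>x \<phi>y \<longrightarrow>
        (\<integral>z\<in>S. u z * \<phi>x z \<partial>lborel) = - (\<integral>z\<in>S. g1 z * \<phi> z \<partial>lborel) \<and>
        (\<integral>z\<in>S. u z * \<phi>y z \<partial>lborel) = - (\<integral>z\<in>S. g2 z * \<phi> z \<partial>lborel))"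

definition rL2 :: "real \<Rightarrow> (real \<times> real) set \<Rightarrow> (real \<times> real \<Rightarrow> real) \<Rightarrow> real" where
  "rL2 \<epsilon> S u = \<epsilon> powr (-1/2) * sqrt (\<integral>z\<in>S. (u z)\<^sup>2 \<partial>lborel)"

text \<open>Rescaled H^1 norm of a function u with (weak) gradient (g1,g2).\<close>
definition rH1 :: "real \<Rightarrow> (real \<times> real) set \<Rightarrow> (real \<times> real \<Rightarrow> real)
    \<Rightarrow> (real \<times> real \<Rightarrow> real) \<Rightarrow> (real \<times> real \<Rightarrow> real) \<Rightarrow> real" where
  "rH1 \<epsilon> S u g1 g2 = \<epsilon> powr (-1/2) * sqrt (\<integral>z\<in>S. (u z)\<^sup>2 + (g1 z)\<^sup>2 + (g2 z)\<^sup>2 \<partial>lborel)"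

text \<open>Here k1, k2, H are the functions for a fixed epsilon.\<close>
definition Rdom :: "real \<Rightarrow> real \<Rightarrow> (real \<Rightarrow> real) \<Rightarrow> (real \<Rightarrow> real) \<Rightarrow> real \<Rightarrow> (real \<times> real) set" where
  "Rdom a b k1 k2 \<epsilon> = {(x, y). a < x \<and> x < b \<and> - \<epsilon> * k1 x < y \<and> y < \<epsilon> * k2 x}"

definition Theta :: "real \<Rightarrow> real \<Rightarrow> (real \<Rightarrow> real) \<Rightarrow> (real \<Rightarrow> real) \<Rightarrow> real \<Rightarrow> real \<Rightarrow> (real \<times> real) set" where
  "Theta a b k2 H \<gamma> \<epsilon> = {(x, y). a < x \<and> x < b \<and> \<epsilon> * (k2 x - \<epsilon> powr \<gamma> * H x) < y \<and> y < \<epsilon> * k2 x}"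

definition solves_P :: "(real \<times> real) set \<Rightarrow> (real \<times> real) set \<Rightarrow> real \<Rightarrow> real
    \<Rightarrow> (real \<times> real \<Rightarrow> real) \<Rightarrow> (real \<times> real \<Rightarrow> real) \<Rightarrow> (real \<times> real \<Rightarrow> real)
    \<Rightarrow> (real \<times> real \<Rightarrow> real) \<Rightarrow> bool" where
  "solves_P R \<theta> \<gamma> \<epsilon> f w gw1 gw2 \<longleftrightarrow> H1_2 R w gw1 gw2 \<and>
     (\<forall>\<phi> g1 g2. H1_2 R \<phi> g1 g2 \<longrightarrow>
        (\<integral>z\<in>R. gw1 z * g1 z + gw2 z * g2 z + w z * \<phi> z \<partial>lborel)
          = \<epsilon> powr (-\<gamma>) * (\<integral>z\<in>\<theta>. f z * \<phi> z \<partial>lborel))"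

definition fhat :: "(real \<Rightarrow> real) \<Rightarrow> (real \<Rightarrow> real) \<Rightarrow> (real \<times> real) set
    \<Rightarrow> (real \<times> real \<Rightarrow> real) \<Rightarrow> real \<Rightarrow> real \<Rightarrow> real" where
  "fhat k1 k2 \<theta> f \<epsilon> x = (1 / (\<epsilon> * (k1 x + k2 x))) *
     (\<integral>y\<in>{- \<epsilon> * k1 x<..<\<epsilon> * k2 x}. indicator \<theta> (x, y) * f (x, y) \<partial>lborel)"

text \<open>(hat P_eps): wh with weak derivative wh' is the weak solution; K = k1 + k2.\<close>
definition solves_Phat :: "real \<Rightarrow> real \<Rightarrow> (real \<Rightarrow> real) \<Rightarrow> real \<Rightarrow> real
    \<Rightarrow> (real \<Rightarrow> real) \<Rightarrow> (real \<Rightarrow> real) \<Rightarrow> (real \<Rightarrow> real) \<Rightarrow> bool" where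
  "solves_Phat a b K \<gamma> \<epsilon> fh wh wh' \<longleftrightarrow> H1_1 {a<..<b} wh wh' \<and>
     (\<forall>\<phi> \<phi>'. H1_1 {a<..<b} \<phi> \<phi>' \<longrightarrow>
        (\<integral>x\<in>{a<..<b}. K x * wh' x * \<phi>' x + K x * wh x * \<phi> x \<partial>lborel)
          = \<epsilon> powr (-\<gamma>) * (\<integral>x\<in>{a<..<b}. K x * fh x * \<phi> x \<partial>lborel))"

end

theory Submission
  imports Defs
begin

text \<open>
  Let \<open>\<phi> = w - wh\<close> and let \<open>avg \<phi>\<close> be its mean over the vertical slices. Differentiating along the curves on
  which the relative height \<open>s\<close> of a point in its slice is constant, one gets
  \<open>(avg \<phi>)' = avg (\<phi>\<^sub>x + m \<phi>\<^sub>y)\<close>, where the slope \<open>m\<close> of these curves is a convex combination of the slopes of the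
  lower and upper boundary, hence small by (H.1). Testing the thin-domain problem with \<open>\<phi>\<close> and the reduced one with
  \<open>avg \<phi>\<close> and subtracting gives
  \<open>\<parallel>\<phi>\<parallel>\<^sup>2 = \<epsilon>\<^bsup>-\<gamma>\<^esup> \<integral>\<^sub>\<theta> f (\<phi> - avg \<phi>) + \<integral>\<^sub>R wh' m \<phi>\<^sub>y\<close>. The first term is small since
  \<open>\<bar>\<phi> - avg \<phi>\<bar>\<close> is at most the integral of \<open>\<bar>\<phi>\<^sub>y\<bar>\<close> over the slice, the second since \<open>m\<close> is small and
  \<open>wh\<close> is bounded in energy.
\<close>

section \<open>Square integrable functions\<close>

text \<open>The estimate is a balance of scales. Slices of R have length of order \<epsilon>, slices
  of \<theta> at most H1 \<epsilon>^(1+\<gamma>), and (F) makes the integral of f^2 over \<theta> at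
  most c \<epsilon>^(1+\<gamma>). One square root comes from the source and one from the thinness of
  \<theta>; together they turn the prefactor \<epsilon>^(-\<gamma>) into \<epsilon>. In the
  deviation term the slice length gives a further factor sqrt \<epsilon>, in the slope term the a
  priori bound for wh divides by it. The two terms are thus of order \<epsilon> * sqrt \<epsilon>
  and \<eta> * sqrt \<epsilon>, where \<eta> bounds the boundary slopes, and the rescaled norm
  removes sqrt \<epsilon>. The obstacle is that membership in H^1 is known only through identities
  with C^1 test functions. The deviation from the mean and the derivative of the mean are therefore
  both extracted from test functions of product form \<alpha>(x) B(s), followed by a passage to
  almost every slice.\<close>

definition sq_integrable :: "'a measure \<Rightarrow> ('a \<Rightarrow> real) \<Rightarrow> bool" where
  "sq_integrable M f \<longleftrightarrow> f \<in> borel_measurable M \<and> integrable M (\<lambda>x. (f x)\<^sup>2)"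

lemma sq_integrable_measurable: "sq_integrable M f \<Longrightarrow> f \<in> borel_measurable M"
  by (simp add: sq_integrable_def)

lemma L2_on_iff_sq_integrable:
  "L2_on S u \<longleftrightarrow> sq_integrable lborel (\<lambda>z. indicator S z * u z)"
proof -
  have "(\<lambda>z. (indicator S z * u z)\<^sup>2) = (\<lambda>z. indicator S z * (u z)\<^sup>2)"
    by (auto simp: fun_eq_iff indicator_def)
  then show ?thesis
    by (simp add: L2_on_def sq_integrable_def set_borel_measurable_def set_integrable_def)
qed

lemma sq_integrable_mult:
  assumes "sq_integrable M f" "sq_integrable M g"
  shows "integrable M (\<lambda>x. f x * g x)"
proof (rule Bochner_Integration.integrable_bound)
  show "integrable M (\<lambda>x. (f x)\<^sup>2 + (g x)\<^sup>2)"
    using assms by (auto simp: sq_integrable_def)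
  show "(\<lambda>x. f x * g x) \<in> borel_measurable M"
    using assms by (auto simp: sq_integrable_def)
  have "\<bar>f x * g x\<bar> \<le> (f x)\<^sup>2 + (g x)\<^sup>2" for x
    using sum_squares_bound[of "\<bar>f x\<bar>" "\<bar>g x\<bar>"] mult_nonneg_nonneg[of "\<bar>f x\<bar>" "\<bar>g x\<bar>"]
    by (simp add: abs_mult del: mult_nonneg_nonneg zero_le_mult_iff)
  then show "AE x in M. norm (f x * g x) \<le> norm ((f x)\<^sup>2 + (g x)\<^sup>2)" by simp
qed

lemma sq_integrable_add:
  assumes "sq_integrable M f" "sq_integrable M g"
  shows "sq_integrable M (\<lambda>x. f x + g x)"
proof -
  have "integrable M (\<lambda>x. (f x)\<^sup>2 + (g x)\<^sup>2 + 2 * (f x * g x))"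
    using assms sq_integrable_mult[OF assms] unfolding sq_integrable_def
    by (intro Bochner_Integration.integrable_add integrable_mult_right) auto
  moreover have "(\<lambda>x. (f x + g x)\<^sup>2) = (\<lambda>x. (f x)\<^sup>2 + (g x)\<^sup>2 + 2 * (f x * g x))"
    by (simp add: fun_eq_iff power2_sum)
  ultimately show ?thesis using assms unfolding sq_integrable_def by auto
qed

lemma sq_integrable_bounded_mult:
  assumes f: "sq_integrable M f" and g: "g \<in> borel_measurable M"
    and bound: "\<And>x. x \<in> space M \<Longrightarrow> \<bar>g x\<bar> \<le> C * \<bar>f x\<bar>"
  shows "sq_integrable M g"
proof -
  have "integrable M (\<lambda>x. (g x)\<^sup>2)"
  proof (rule Bochner_Integration.integrable_bound)
    show "integrable M (\<lambda>x. C\<^sup>2 * (f x)\<^sup>2)" using f by (simp add: sq_integrable_def)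
    show "(\<lambda>x. (g x)\<^sup>2) \<in> borel_measurable M" using g by simp
    have "(g x)\<^sup>2 \<le> C\<^sup>2 * (f x)\<^sup>2" if "x \<in> space M" for x
      using power_mono[OF bound[OF that], of 2] by (simp add: power_mult_distrib)
    then show "AE x in M. norm ((g x)\<^sup>2) \<le> norm (C\<^sup>2 * (f x)\<^sup>2)" by (auto intro!: AE_I2)
  qed
  with g show ?thesis by (simp add: sq_integrable_def)
qed

lemma sq_integrable_minus: "sq_integrable M f \<Longrightarrow> sq_integrable M (\<lambda>x. - f x)"
  by (simp add: sq_integrable_def)

lemma sq_integrable_diff:
  assumes "sq_integrable M f" "sq_integrable M g"
  shows "sq_integrable M (\<lambda>x. f x - g x)"
  using sq_integrable_add[OF assms(1) sq_integrable_minus[OF assms(2)]] by simp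

lemma sq_integrable_Cauchy_Schwarz:
  assumes "sq_integrable M f" "sq_integrable M g"
  shows "(\<integral>x. f x * g x \<partial>M)\<^sup>2 \<le> (\<integral>x. (f x)\<^sup>2 \<partial>M) * (\<integral>x. (g x)\<^sup>2 \<partial>M)"
proof -
  define A B P where "A = (\<integral>x. (f x)\<^sup>2 \<partial>M)" and "B = (\<integral>x. (g x)\<^sup>2 \<partial>M)"
    and "P = (\<integral>x. f x * g x \<partial>M)"
  have i: "integrable M (\<lambda>x. (f x)\<^sup>2)" "integrable M (\<lambda>x. (g x)\<^sup>2)" "integrable M (\<lambda>x. f x * g x)"
    using assms sq_integrable_mult by (auto simp: sq_integrable_def)
  have q: "0 \<le> s\<^sup>2 * A + t\<^sup>2 * B + 2 * s * t * P" for s t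
  proof -
    have "0 \<le> (\<integral>x. (s * f x + t * g x)\<^sup>2 \<partial>M)" by simp
    also have "\<dots> = (\<integral>x. s\<^sup>2 * (f x)\<^sup>2 + t\<^sup>2 * (g x)\<^sup>2 + 2 * s * t * (f x * g x) \<partial>M)"
      by (simp add: power2_sum power_mult_distrib algebra_simps)
    also have "\<dots> = s\<^sup>2 * A + t\<^sup>2 * B + 2 * s * t * P"
      unfolding A_def B_def P_def using i by simp
    finally show ?thesis .
  qed
  have "A \<ge> 0" "B \<ge> 0" by (auto simp: A_def B_def)
  show ?thesis
  proof (cases "B = 0")
    case False
    with \<open>B \<ge> 0\<close> have "B > 0" by simp
    \<comment> \<open>The choice (s, t) = (B, -P) minimises the quadratic form up to scaling and
      makes B a common factor.\<close>
    have "0 \<le> B\<^sup>2 * A + P\<^sup>2 * B - 2 * B * P * P" using q[of B "-P"] by simp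
    also have "\<dots> = B * (A * B - P\<^sup>2)" by (simp add: power2_eq_square algebra_simps)
    finally show ?thesis using \<open>B > 0\<close> by (simp add: zero_le_mult_iff A_def B_def P_def)
  next
    case True
    have "P = 0"
    proof (rule ccontr)
      assume "P \<noteq> 0"
      \<comment> \<open>With B = 0 the form is affine in t, and this t gives it the value A - (A +
        1) = -1.\<close>
      then show False using q[of 1 "- (A + 1) / (2 * P)"] True \<open>A \<ge> 0\<close> by (simp add: field_simps)
    qed
    then show ?thesis using True unfolding A_def B_def P_def by simp
  qed
qed

text \<open>Pairing with the indicator of a set of finite measure: L^2 is contained in L^1
  there.\<close>

lemma sq_integrable_imp_integrable:
  assumes "sq_integrable M f" and S: "S \<in> sets M" "emeasure M S < \<infinity>"
    and "\<And>x. x \<in> space M \<Longrightarrow> x \<notin> S \<Longrightarrow> f x = 0"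
  shows "integrable M f"
proof -
  have "sq_integrable M (indicator S)"
    using S unfolding sq_integrable_def by (auto simp: power2_eq_square integrable_indicator_iff simp flip: indicator_inter_arith)
  from sq_integrable_mult[OF assms(1) this] have "integrable M (\<lambda>x. f x * indicator S x)" .
  moreover have "f x * indicator S x = f x" if "x \<in> space M" for x
    using assms(4)[OF that] by (cases "x \<in> S") auto
  ultimately show ?thesis
    using Bochner_Integration.integrable_cong[of M M "\<lambda>x. f x * indicator S x" f] by simp
qed

lemma integrable_mult_bounded:
  assumes "integrable M f" "g \<in> borel_measurable M" "\<And>x. x \<in> space M \<Longrightarrow> \<bar>g x\<bar> \<le> C"
  shows "integrable M (\<lambda>x. f x * g x :: real)"
proof (rule Bochner_Integration.integrable_bound)
  show "integrable M (\<lambda>x. C * f x)" using assms by simp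
  show "(\<lambda>x. f x * g x) \<in> borel_measurable M" using assms by auto
  have "\<bar>f x * g x\<bar> \<le> \<bar>C * f x\<bar>" if "x \<in> space M" for x
    using mult_right_mono[OF order_trans[OF assms(3)[OF that] abs_ge_self], of "\<bar>f x\<bar>"] by (simp add: abs_mult mult.commute)
  then show "AE x in M. norm (f x * g x) \<le> norm (C * f x)" by (auto intro!: AE_I2)
qed

section \<open>Weak derivatives on an interval\<close>

text \<open>With g the positive part of (x - r)(t - x) this is n g^2 / (1 + n g^2). The square makes
  the positive part C^1, and for growing n the value increases to 1 wherever g > 0. One explicit
  formula thus serves as C^1 cutoff and as approximation of the indicator of (r, t). Its derivative
  is \<open>bump'\<close>.\<close>

definition bump :: "real \<Rightarrow> real \<Rightarrow> nat \<Rightarrow> real \<Rightarrow> real" where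
  "bump r t n x = (if r < x \<and> x < t
     then real n * ((x - r) * (t - x))\<^sup>2 / (1 + real n * ((x - r) * (t - x))\<^sup>2) else 0)"

definition bump' :: "real \<Rightarrow> real \<Rightarrow> nat \<Rightarrow> real \<Rightarrow> real" where
  "bump' r t n x = (if r < x \<and> x < t
     then 2 * real n * ((x - r) * (t - x)) * (r + t - 2 * x) / (1 + real n * ((x - r) * (t - x))\<^sup>2)\<^sup>2 else 0)"

lemma bump_bounds: "0 \<le> bump r t n x" "bump r t n x \<le> 1"
  by (auto simp: bump_def divide_simps add_pos_nonneg)

lemma abs_bump_le: "\<bar>bump r t n x\<bar> \<le> 1"
  using bump_bounds[of r t n x] by simp

lemma bump_eq_0: "x \<le> r \<or> t \<le> x \<Longrightarrow> bump r t n x = 0"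
  by (auto simp: bump_def)

lemma bump_pos: "r < x \<Longrightarrow> x < t \<Longrightarrow> n > 0 \<Longrightarrow> 0 < bump r t n x"
  by (auto simp: bump_def add_pos_nonneg intro!: divide_pos_pos mult_pos_pos)

text \<open>For r < t the product (x - r)(t - x) is positive exactly on (r, t), so
  \<open>max 0\<close> absorbs the case distinction. Regularity at the endpoints then follows by
  composition instead of gluing.\<close>

lemma bump_max:
  assumes "r < t"
  shows "bump r t n x = real n * (max 0 ((x - r) * (t - x)))\<^sup>2 / (1 + real n * (max 0 ((x - r) * (t - x)))\<^sup>2)"
    and "bump' r t n x = 2 * real n * max 0 ((x - r) * (t - x)) * (r + t - 2 * x)
            / (1 + real n * (max 0 ((x - r) * (t - x)))\<^sup>2)\<^sup>2"
proof -
  have "(r < x \<and> x < t) \<longleftrightarrow> (x - r) * (t - x) > 0"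
    using assms by (auto simp: zero_less_mult_iff)
  then show "bump r t n x = real n * (max 0 ((x - r) * (t - x)))\<^sup>2 / (1 + real n * (max 0 ((x - r) * (t - x)))\<^sup>2)"
    "bump' r t n x = 2 * real n * max 0 ((x - r) * (t - x)) * (r + t - 2 * x)
            / (1 + real n * (max 0 ((x - r) * (t - x)))\<^sup>2)\<^sup>2"
    by (auto simp: bump_def bump'_def max_def)
qed

lemma one_plus_nonneg_neq_0: "1 + real n * z\<^sup>2 \<noteq> 0"
  by (smt (verit) mult_nonneg_nonneg of_nat_0_le_iff zero_le_power2)

lemma continuous_on_bump: "r < t \<Longrightarrow> continuous_on S (bump r t n)"
  by (subst continuous_on_cong[OF refl bump_max(1)]) (auto intro!: continuous_intros simp: one_plus_nonneg_neq_0)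

lemma continuous_on_bump': "r < t \<Longrightarrow> continuous_on S (bump' r t n)"
  by (subst continuous_on_cong[OF refl bump_max(2)]) (auto intro!: continuous_intros simp: one_plus_nonneg_neq_0)

lemma max_0_square_derivative: "((\<lambda>z. (max 0 z)\<^sup>2) has_real_derivative 2 * max 0 z) (at z)" for z :: real
proof -
  consider "z > 0" | "z < 0" | "z = 0" by linarith
  then show ?thesis
  proof cases
    case 1
    have "((\<lambda>z. z\<^sup>2) has_real_derivative 2 * max 0 z) (at z)"
      using 1 by (auto intro!: derivative_eq_intros)
    then show ?thesis
      by (rule has_field_derivative_transform_within_open[of _ _ _ "{0<..}"]) (use 1 in auto)
  next
    case 2
    have "((\<lambda>z. 0) has_real_derivative 2 * max 0 z) (at z)"
      using 2 by (auto intro!: derivative_eq_intros)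
    then show ?thesis
      by (rule has_field_derivative_transform_within_open[of _ _ _ "{..<0}"]) (use 2 in auto)
  next
    case 3
    \<comment> \<open>At the kink the difference quotient is at most |y| in absolute value.\<close>
    have "((\<lambda>y::real. (max 0 y)\<^sup>2 / y) \<longlongrightarrow> 0) (at 0)"
    proof (rule Lim_null_comparison)
      show "\<forall>\<^sub>F y::real in at 0. norm ((max 0 y)\<^sup>2 / y) \<le> \<bar>y\<bar>"
        by (intro always_eventually) (auto simp: max_def power2_eq_square)
      show "((\<lambda>y::real. \<bar>y\<bar>) \<longlongrightarrow> 0) (at 0)" by (rule tendsto_rabs_zero) simp
    qed
    then show ?thesis using 3 by (simp add: has_field_derivative_iff)
  qed
qed

lemma bump_has_derivative:
  assumes "r < t" shows "(bump r t n has_real_derivative bump' r t n x) (at x)"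
proof -
  define m where "m x = (max 0 ((x - r) * (t - x)))\<^sup>2" for x
  have m: "(m has_real_derivative (2 * max 0 ((x - r) * (t - x))) * (r + t - 2 * x)) (at x)"
    unfolding m_def
    by (rule DERIV_chain2[OF max_0_square_derivative]) (auto intro!: derivative_eq_intros)
  define d where "d = (2 * max 0 ((x - r) * (t - x))) * (r + t - 2 * x)"
  have nz: "1 + real n * m x \<noteq> 0" unfolding m_def by (rule one_plus_nonneg_neq_0)
  have "bump r t n = (\<lambda>x. real n * m x / (1 + real n * m x))"
    using bump_max(1)[OF assms] by (auto simp: m_def)
  moreover have "((\<lambda>x. real n * m x / (1 + real n * m x)) has_real_derivative
      (real n * d * (1 + real n * m x) - real n * m x * (0 + real n * d)) / ((1 + real n * m x) * (1 + real n * m x))) (at x)"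
    unfolding d_def by (intro DERIV_divide DERIV_add DERIV_const DERIV_cmult m nz)
  moreover have "real n * d * (1 + real n * m x) - real n * m x * (0 + real n * d) = real n * d"
    by (simp add: algebra_simps)
  moreover have "real n * d / ((1 + real n * m x) * (1 + real n * m x)) = bump' r t n x"
    unfolding bump_max(2)[OF assms] m_def d_def by (simp add: power2_eq_square)
  ultimately show ?thesis by simp
qed

lemma test_fun1_bump:
  assumes "r < t" "{r..t} \<subseteq> S" shows "test_fun1 S (bump r t n) (bump' r t n)"
proof -
  have "{x. bump r t n x \<noteq> 0} \<subseteq> {r..t}" by (auto simp: bump_def)
  then have c: "closure {x. bump r t n x \<noteq> 0} \<subseteq> {r..t}" by (simp add: closure_minimal)
  then have "compact (closure {x. bump r t n x \<noteq> 0})"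
    by (meson bounded_closed_interval bounded_subset closed_closure compact_eq_bounded_closed)
  with c assms show ?thesis
    unfolding test_fun1_def using continuous_on_bump' bump_has_derivative by blast
qed

text \<open>The endpoints approach r and t from inside, which keeps the supports compactly within
  (r, t). The same n drives endpoints and steepness: at an inner point g tends to a positive limit,
  so n g^2 tends to infinity and the bump to 1.\<close>

lemma bump_exhaustion:
  assumes "r < t"
  obtains rn tn :: "nat \<Rightarrow> real" where "\<And>n. rn n \<in> \<rat>" "\<And>n. tn n \<in> \<rat>"
    "\<And>n. r < rn n" "\<And>n. rn n < tn n" "\<And>n. tn n < t"
    "\<And>x. (\<lambda>n. bump (rn n) (tn n) n x) \<longlonglongrightarrow> indicator {r<..<t} x"
proof -
  \<comment> \<open>At most half the length of the interval, so the midpoint of r and t always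
    separates \<open>rn n\<close> from \<open>tn n\<close>.\<close>
  define h where "h n = (t - r) / (2 * (real n + 1))" for n
  have h0: "0 < h n" for n using assms by (simp add: h_def)
  have h1: "h n \<le> (t - r) / 2" for n
    unfolding h_def using assms by (intro divide_left_mono) auto
  have hl: "h \<longlonglongrightarrow> 0"
    using tendsto_mult[OF tendsto_const[of "(t - r) / 2"] LIMSEQ_inverse_real_of_nat]
    by (simp add: h_def[abs_def] field_simps)
  have "\<exists>x\<in>\<rat>. r < x \<and> x < r + h n" for n using Rats_dense_in_real[of r "r + h n"] h0 by simp
  then obtain rn where rn: "\<And>n. rn n \<in> \<rat>" "\<And>n. r < rn n" "\<And>n. rn n < r + h n" by metis
  have "\<exists>x\<in>\<rat>. t - h n < x \<and> x < t" for n using Rats_dense_in_real[of "t - h n" t] h0 by simp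
  then obtain tn where tn: "\<And>n. tn n \<in> \<rat>" "\<And>n. t - h n < tn n" "\<And>n. tn n < t" by metis
  have rl: "rn \<longlonglongrightarrow> r"
    by (rule tendsto_sandwich[of "\<lambda>_. r" _ _ "\<lambda>n. r + h n"])
      (use rn hl in \<open>auto intro!: always_eventually less_imp_le tendsto_eq_intros\<close>)
  have tl: "tn \<longlonglongrightarrow> t"
    by (rule tendsto_sandwich[of "\<lambda>n. t - h n" _ _ "\<lambda>_. t"])
      (use tn hl in \<open>auto intro!: always_eventually less_imp_le tendsto_eq_intros\<close>)
  have less: "rn n < tn n" for n using rn(3)[of n] tn(2)[of n] h1[of n] by (simp add: field_simps)
  have "(\<lambda>n. bump (rn n) (tn n) n x) \<longlonglongrightarrow> indicator {r<..<t} x" for x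
  proof (cases "r < x \<and> x < t")
    case False
    then have "x \<le> rn n \<or> tn n \<le> x" for n using rn(2)[of n] tn(3)[of n] by linarith
    then have "bump (rn n) (tn n) n x = 0" for n by (rule bump_eq_0)
    moreover have "x \<notin> {r<..<t}" using False by simp
    ultimately show ?thesis by simp
  next
    case True
    let ?p = "\<lambda>n. (max 0 ((x - rn n) * (tn n - x)))\<^sup>2"
    have "?p \<longlonglongrightarrow> (max 0 ((x - r) * (t - x)))\<^sup>2"
      by (intro tendsto_intros rl tl)
    moreover have "(max 0 ((x - r) * (t - x)))\<^sup>2 > 0" using True by simp
    ultimately have "filterlim (\<lambda>n. ?p n * real n) at_top sequentially"
      by (rule filterlim_tendsto_pos_mult_at_top) (rule filterlim_real_sequentially)
    then have f: "filterlim (\<lambda>n. 1 + real n * ?p n) at_top sequentially"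
      by (simp add: mult.commute filterlim_tendsto_add_at_top[OF tendsto_const])
    have "(\<lambda>n. 1 - 1 / (1 + real n * ?p n)) \<longlonglongrightarrow> 1 - 0"
      by (intro tendsto_intros tendsto_divide_0[OF tendsto_const] filterlim_at_top_imp_at_infinity f)
    moreover have "1 - 1 / (1 + real n * ?p n) = bump (rn n) (tn n) n x" for n
      using one_plus_nonneg_neq_0[of n "max 0 ((x - rn n) * (tn n - x))"]
      by (simp add: bump_max(1)[OF less] field_simps)
    ultimately show ?thesis using True by simp
  qed
  then show ?thesis using that rn tn less by blast
qed

lemma bump_measurable [measurable]: "bump r t n \<in> borel_measurable borel"
  unfolding bump_def by measurable

text \<open>
  Only countably many test functions occur, so that identities holding for almost every slice
  separately for each test function hold simultaneously on almost every slice.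
\<close>

lemma fundamental_lemma_bump:
  assumes "a < b" and u: "integrable lborel u"
    and zero: "\<And>r t n. r \<in> \<rat> \<Longrightarrow> t \<in> \<rat> \<Longrightarrow> a < r \<Longrightarrow> r < t \<Longrightarrow> t < b \<Longrightarrow> (\<integral>x. u x * bump r t n x \<partial>lborel) = 0"
  shows "AE x in lborel. a < x \<and> x < b \<longrightarrow> u x = 0"
proof -
  have [measurable]: "u \<in> borel_measurable borel" using u by auto
  have int0: "(\<integral>x. u x * indicator {r<..<t} x \<partial>lborel) = 0" if "a \<le> r" "r < t" "t \<le> b" for r t
  proof -
    obtain rn tn where s: "\<And>n. rn n \<in> \<rat>" "\<And>n. tn n \<in> \<rat>"
      "\<And>n. r < rn n" "\<And>n. rn n < tn n" "\<And>n. tn n < t"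
      "\<And>x. (\<lambda>n. bump (rn n) (tn n) n x) \<longlonglongrightarrow> indicator {r<..<t} x"
      using bump_exhaustion[OF \<open>r < t\<close>] by blast
    have "(\<lambda>n. \<integral>x. u x * bump (rn n) (tn n) n x \<partial>lborel) \<longlonglongrightarrow> (\<integral>x. u x * indicator {r<..<t} x \<partial>lborel)"
    proof (rule integral_dominated_convergence[where w="\<lambda>x. \<bar>u x\<bar>"])
      show "AE x in lborel. (\<lambda>n. u x * bump (rn n) (tn n) n x) \<longlonglongrightarrow> u x * indicator {r<..<t} x"
        by (intro AE_I2 tendsto_intros s)
      show "AE x in lborel. norm (u x * bump (rn n) (tn n) n x) \<le> \<bar>u x\<bar>" for n
        by (auto simp: abs_mult intro!: AE_I2 mult_left_le abs_bump_le)
      show "(\<lambda>x. u x * indicator {r<..<t} x) \<in> borel_measurable lborel" by measurable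
      show "(\<lambda>x. u x * bump (rn n) (tn n) n x) \<in> borel_measurable lborel" for n by measurable
    qed (use u in auto)
    moreover have "(\<integral>x. u x * bump (rn n) (tn n) n x \<partial>lborel) = 0" for n
      by (intro zero s) (use s(3)[of n] s(5)[of n] that in auto)
    ultimately show ?thesis by (simp add: LIMSEQ_const_iff)
  qed
  define v where "v x = u x * indicator {a<..<b} x" for x
  have vi: "integrable lborel v"
    unfolding v_def by (rule integrable_mult_bounded[OF u, of _ 1]) (auto simp: indicator_def)
  then have [measurable]: "v \<in> borel_measurable borel" by auto
  have vset: "set_integrable lborel A v" if "A \<in> sets borel" for A
    unfolding set_integrable_def using integrable_mult_indicator[of A lborel v] vi that by simp
  have vtot: "(\<integral>x. v x \<partial>lborel) = 0" unfolding v_def using int0[of a b] \<open>a < b\<close> by simp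
  \<comment> \<open>Half-lines generate the Borel sets and are stable under intersection, so the
    vanishing of the integrals extends from them to all Borel sets; complements use that the total
    integral of \<open>v\<close> is zero.\<close>
  have vA: "(\<integral>x\<in>A. v x \<partial>lborel) = 0" if "A \<in> sets borel" for A
  proof -
    have A: "A \<in> sigma_sets UNIV (range (\<lambda>c::real. {..<c}))"
      using that by (subst (asm) borel_eq_lessThan) (simp add: eucl_less_def lessThan_def)
    have I: "Int_stable (range (\<lambda>c::real. {..<c}))"
    proof -
      have "{..<c} \<inter> {..<d} = {..<min c d}" for c d :: real by auto
      then show ?thesis unfolding Int_stable_def by blast
    qed
    have P: "range (\<lambda>c::real. {..<c}) \<subseteq> Pow UNIV" by simp
    from I P A show ?thesis
    proof (induction rule: sigma_sets_induct_disjoint)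
      case (basic A)
      then obtain c where A: "A = {..<c}" by auto
      consider "c \<le> a" | "a < c" "c \<le> b" | "b < c" by linarith
      then show ?case
      proof cases
        case 1
        then have "(\<lambda>x. indicator A x *\<^sub>R v x) = (\<lambda>x. 0)" by (auto simp: v_def A indicator_def)
        then show ?thesis by (simp add: set_lebesgue_integral_def)
      next
        case 2
        then have "(\<lambda>x. indicator A x *\<^sub>R v x) = (\<lambda>x. u x * indicator {a<..<c} x)"
          by (auto simp: v_def A indicator_def)
        then show ?thesis using int0[of a c] 2 by (simp add: set_lebesgue_integral_def)
      next
        case 3
        then have "(\<lambda>x. indicator A x *\<^sub>R v x) = v" by (auto simp: v_def A indicator_def)
        then show ?thesis using vtot by (simp add: set_lebesgue_integral_def)
      qed
    next
      case empty then show ?case by (simp add: set_lebesgue_integral_def)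
    next
      case (compl A)
      then have [measurable]: "A \<in> sets borel"
        by (subst borel_eq_lessThan) (simp add: eucl_less_def lessThan_def)
      have "(\<integral>x. v x \<partial>lborel) = (\<integral>x\<in>A. v x \<partial>lborel) + (\<integral>x\<in>UNIV - A. v x \<partial>lborel)"
        using compl set_integral_Un[of A "UNIV - A" lborel v] vset[of A] vset[of "UNIV - A"]
        by (simp add: set_lebesgue_integral_def)
      with compl vtot show ?case by simp
    next
      case (union A)
      then have [measurable]: "A i \<in> sets borel" for i
        by (subst borel_eq_lessThan) (auto simp: eucl_less_def lessThan_def)
      have "(\<integral>x\<in>(\<Union>i. A i). v x \<partial>lborel) = (\<Sum>i. \<integral>x\<in>A i. v x \<partial>lborel)"
        using union(1) by (intro lebesgue_integral_countable_add vset) (auto simp: disjoint_family_on_def)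
      with union show ?case by simp
    qed
  qed
  have "AE x in lborel. v x = 0"
    by (rule density_unique_real[OF vi]) (use vA in \<open>auto simp: set_lebesgue_integral_def\<close>)
  then show ?thesis by eventually_elim (auto simp: v_def)
qed

section \<open>Zero-mean test functions and the mean deviation on the unit interval\<close>

definition primitive :: "(real \<Rightarrow> real) \<Rightarrow> real \<Rightarrow> real" where
  "primitive h y = (\<integral>t. h t * indicator {..y} t \<partial>lborel)"

lemma continuous_compact_support_integrable:
  fixes h :: "real \<Rightarrow> real"
  assumes h: "continuous_on UNIV h" and supp: "\<And>x. x \<notin> {r..t} \<Longrightarrow> h x = 0"
  shows "integrable lborel h"
proof -
  have "integrable lborel (\<lambda>x. indicator {r..t} x *\<^sub>R h x)"
    using borel_integrable_atLeastAtMost'[OF continuous_on_subset[OF h subset_UNIV], of r t]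
    by (simp add: set_integrable_def)
  moreover have "indicator {r..t} x *\<^sub>R h x = h x" for x
    using supp[of x] by (cases "x \<in> {r..t}") auto
  ultimately show ?thesis by (simp only:)
qed

text \<open>To the left of r the primitive vanishes because h does, to the right of t because the
  total integral of h is zero; this is what makes its support compact.\<close>

lemma test_fun1_primitive:
  assumes "r < t" "{r..t} \<subseteq> S" and h: "continuous_on UNIV h"
    and supp: "\<And>x. x \<notin> {r..t} \<Longrightarrow> h x = 0" and mean: "(\<integral>x. h x \<partial>lborel) = 0"
  shows "test_fun1 S (primitive h) h"
proof -
  have "\<exists>F. \<forall>x. - \<infinity> < ereal x \<longrightarrow> ereal x < \<infinity> \<longrightarrow> (F has_vector_derivative h x) (at x)"
    by (rule einterval_antiderivative) (use h in \<open>auto simp: continuous_on_eq_continuous_at\<close>)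
  then obtain F where F: "\<And>x. (F has_real_derivative h x) (at x)"
    by (auto simp: has_real_derivative_iff_has_vector_derivative)
  \<comment> \<open>Any base point c below the support may replace the lower limit of integration,
    which turns \<open>primitive h\<close> into a difference of values of a classical
    antiderivative.\<close>
  have prim: "primitive h y = F y - F c" if "c < r" "c < y" for c y
  proof -
    have "primitive h y = (\<integral>t. indicator {c..y} t *\<^sub>R h t \<partial>lborel)"
      unfolding primitive_def
      by (intro Bochner_Integration.integral_cong) (use that supp in \<open>auto simp: indicator_def\<close>)
    also have "\<dots> = F y - F c"
      using that F h by (intro integral_FTC_atLeastAtMost)
        (auto intro: has_field_derivative_at_within continuous_on_subset
          simp flip: has_real_derivative_iff_has_vector_derivative)
    finally show ?thesis .
  qed
  have D: "(primitive h has_real_derivative h x) (at x)" for x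
  proof -
    define c where "c = min r x - 1"
    have "((\<lambda>y. F y - F c) has_real_derivative h x) (at x)"
      using F by (auto intro!: derivative_eq_intros)
    then show ?thesis
      by (rule has_field_derivative_transform_within_open[of _ _ _ "{c<..}"])
        (auto simp: c_def intro!: prim[symmetric])
  qed
  have z1: "primitive h y = 0" if "y < r" for y
  proof -
    have "(\<lambda>t. h t * indicator {..y} t) = (\<lambda>t. 0)"
      using supp that by (auto simp: indicator_def fun_eq_iff)
    then show ?thesis by (simp add: primitive_def)
  qed
  have z2: "primitive h y = 0" if "t < y" for y
  proof -
    have "(\<lambda>t. h t * indicator {..y} t) = h"
      using supp that by (auto simp: indicator_def fun_eq_iff)
    then show ?thesis using mean by (simp add: primitive_def)
  qed
  have "{x. primitive h x \<noteq> 0} \<subseteq> {r..t}"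
    using z1 z2 by (force simp: not_less[symmetric])
  then have c: "closure {x. primitive h x \<noteq> 0} \<subseteq> {r..t}" by (simp add: closure_minimal)
  then have "compact (closure {x. primitive h x \<noteq> 0})"
    by (meson bounded_closed_interval bounded_subset closed_closure compact_eq_bounded_closed)
  with c assms(2) show ?thesis unfolding test_fun1_def using h D by blast
qed

lemma integrable_bump: "r < t \<Longrightarrow> integrable lborel (bump r t n)"
  by (rule continuous_compact_support_integrable[of _ r t]) (auto simp: continuous_on_bump bump_eq_0)

lemma integral_bump_pos:
  assumes "r < t" "n > 0" shows "0 < (\<integral>x. bump r t n x \<partial>lborel)"
proof -
  have "(\<integral>x. bump r t n x \<partial>lborel) \<noteq> 0"
  proof
    assume "(\<integral>x. bump r t n x \<partial>lborel) = 0"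
    then have "AE x in lborel. bump r t n x = 0"
      using integral_nonneg_eq_0_iff_AE[OF integrable_bump[OF assms(1)]] bump_bounds by auto
    then have "AE x in lborel. x \<notin> {r<..<t}"
      by eventually_elim (use bump_pos[of r _ t n] assms in force)
    then have "{r<..<t} \<in> null_sets lborel"
      by (subst AE_iff_null_sets) auto
    then have "emeasure lborel {r<..<t} = 0" by (rule null_setsD1)
    then show False using assms by simp
  qed
  moreover have "0 \<le> (\<integral>x. bump r t n x \<partial>lborel)" using bump_bounds by (simp add: integral_nonneg_AE)
  ultimately show ?thesis by simp
qed

text \<open>A primitive is compactly supported only for a function of mean zero, so the mean is
  removed with a multiple of one fixed reference bump on (1/4, 3/4). Its index is 1 because a bump
  with n = 0 vanishes identically and could not be divided by.\<close>

definition balanced_bump :: "real \<Rightarrow> real \<Rightarrow> nat \<Rightarrow> real \<Rightarrow> real" where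
  "balanced_bump r t n x = bump r t n x
     - (\<integral>x. bump r t n x \<partial>lborel) / (\<integral>x. bump (1/4) (3/4) 1 x \<partial>lborel) * bump (1/4) (3/4) 1 x"

lemma continuous_on_balanced_bump: "r < t \<Longrightarrow> continuous_on S (balanced_bump r t n)"
  unfolding balanced_bump_def by (intro continuous_intros continuous_on_bump) auto

lemma balanced_bump_eq_0: "x \<notin> {min r (1/4)..max t (3/4)} \<Longrightarrow> balanced_bump r t n x = 0"
  by (auto simp: balanced_bump_def bump_def min_def max_def split: if_splits)

lemma integrable_balanced_bump: "r < t \<Longrightarrow> integrable lborel (balanced_bump r t n)"
  by (rule continuous_compact_support_integrable[OF continuous_on_balanced_bump balanced_bump_eq_0])

lemma test_fun1_primitive_balanced_bump:
  assumes "0 < r" "r < t" "t < 1"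
  shows "test_fun1 {0<..<1} (primitive (balanced_bump r t n)) (balanced_bump r t n)"
proof (rule test_fun1_primitive[OF _ _ continuous_on_balanced_bump[OF assms(2)] balanced_bump_eq_0])
  show "(\<integral>x. balanced_bump r t n x \<partial>lborel) = 0"
    unfolding balanced_bump_def using assms integrable_bump integral_bump_pos[of "1/4" "3/4" 1] by simp
qed (use assms in auto)

lemma abs_balanced_bump_le:
  obtains C where "\<And>x. \<bar>balanced_bump r t n x\<bar> \<le> C"
proof
  fix x
  let ?J = "(\<integral>x. bump r t n x \<partial>lborel) / (\<integral>x. bump (1/4) (3/4) 1 x \<partial>lborel)"
  have "\<bar>?J * bump (1/4) (3/4) 1 x\<bar> \<le> \<bar>?J\<bar>"
    unfolding abs_mult by (intro mult_left_le abs_bump_le) simp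
  then show "\<bar>balanced_bump r t n x\<bar> \<le> 1 + \<bar>?J\<bar>"
    unfolding balanced_bump_def using abs_bump_le[of r t n x] by linarith
qed

text \<open>Fubini on the half-plane t \<le> y. It plays the role of integration by parts for a
  merely integrable d.\<close>

lemma integral_mult_primitive:
  assumes d: "integrable lborel d" and h: "integrable lborel h"
  shows "(\<integral>y. d y * primitive h y \<partial>lborel) = (\<integral>t. h t * (\<integral>y. d y * indicator {t..} y \<partial>lborel) \<partial>lborel)"
proof -
  have [measurable]: "d \<in> borel_measurable borel" "h \<in> borel_measurable borel" using d h by auto
  have ind: "indicator {..y} t = indicator {z::real\<times>real. fst z \<le> snd z} (t, y)" for t y :: real
    by (simp add: indicator_def)
  have ind2: "indicator {t..} y = indicator {z::real\<times>real. fst z \<le> snd z} (t, y)" for t y :: real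
    by (simp add: indicator_def)
  have 1: "integrable (lborel \<Otimes>\<^sub>M lborel) (\<lambda>z. h (fst z) * d (snd z))"
  proof (rule lborel_pair.Fubini_integrable)
    show "integrable lborel (\<lambda>x. \<integral>y. norm (h (fst (x, y)) * d (snd (x, y))) \<partial>lborel)"
      using d h by (simp add: abs_mult)
  qed (use d in auto)
  have "integrable (lborel \<Otimes>\<^sub>M lborel) (\<lambda>z. (h (fst z) * d (snd z)) * indicator {z::real\<times>real. fst z \<le> snd z} z)"
    by (rule integrable_mult_bounded[OF 1, of _ 1]) (auto simp: indicator_def)
  from lborel_pair.Fubini_integral[of "\<lambda>t y. (h t * d y) * indicator {z::real\<times>real. fst z \<le> snd z} (t, y)"] this
  have "(\<integral>y. (\<integral>t. (h t * d y) * indicator {..y} t \<partial>lborel) \<partial>lborel)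
      = (\<integral>t. (\<integral>y. (h t * d y) * indicator {t..} y \<partial>lborel) \<partial>lborel)"
    unfolding ind ind2 by (simp add: case_prod_beta')
  moreover have "(\<integral>t. (h t * d y) * indicator {..y} t \<partial>lborel) = d y * primitive h y" for y
    unfolding primitive_def by (subst integral_mult_right_zero[symmetric]) (simp add: ac_simps)
  moreover have "(\<integral>y. (h t * d y) * indicator {t..} y \<partial>lborel) = h t * (\<integral>y. d y * indicator {t..} y \<partial>lborel)" for t
    by (subst integral_mult_right_zero[symmetric]) (simp add: ac_simps)
  ultimately show ?thesis by simp
qed

lemma tail_integral_measurable [measurable]:
  fixes d :: "real \<Rightarrow> real"
  assumes [measurable]: "d \<in> borel_measurable borel"
  shows "(\<lambda>t. \<integral>y. d y * indicator {t..} y \<partial>lborel) \<in> borel_measurable borel"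
proof -
  have "(\<lambda>t. \<integral>y. d y * indicator {z::real\<times>real. fst z \<le> snd z} (t, y) \<partial>lborel) \<in> borel_measurable borel"
    by measurable
  then show ?thesis by (simp add: indicator_def)
qed

lemma abs_tail_integral_le:
  fixes d :: "real \<Rightarrow> real"
  assumes d: "integrable lborel d"
  shows "\<bar>\<integral>y. d y * indicator {t..} y \<partial>lborel\<bar> \<le> (\<integral>y. \<bar>d y\<bar> \<partial>lborel)"
    "\<bar>(\<integral>y. d y * indicator {t..} y \<partial>lborel) - (\<integral>y. d y * indicator {s..} y \<partial>lborel)\<bar> \<le> (\<integral>y. \<bar>d y\<bar> \<partial>lborel)"
proof -
  have i: "integrable lborel (\<lambda>y. d y * indicator {t..} y)" for t :: real
    by (rule integrable_mult_bounded[OF d, of _ 1]) (auto simp: indicator_def)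
  show "\<bar>\<integral>y. d y * indicator {t..} y \<partial>lborel\<bar> \<le> (\<integral>y. \<bar>d y\<bar> \<partial>lborel)"
    by (rule integral_abs_bound[THEN order_trans], rule integral_mono) (use d i in \<open>auto simp: indicator_def\<close>)
  show "\<bar>(\<integral>y. d y * indicator {t..} y \<partial>lborel) - (\<integral>y. d y * indicator {s..} y \<partial>lborel)\<bar> \<le> (\<integral>y. \<bar>d y\<bar> \<partial>lborel)"
    unfolding Bochner_Integration.integral_diff[OF i i, symmetric]
    by (rule integral_abs_bound[THEN order_trans], rule integral_mono) (use d i in \<open>auto simp: indicator_def\<close>)
qed

text \<open>The du Bois-Reymond argument. Let D x be the integral of d over [x, \<infinity>).
  Exchanging integrals turns the hypothesis into orthogonality of v + D to all balanced bumps;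
  undoing the balancing, v + D - C is orthogonal to every bump in the unit interval and vanishes
  there.\<close>

lemma weak_derivative_representation:
  assumes v: "integrable lborel v" and d: "integrable lborel d"
    and weak: "\<And>r t n. r \<in> \<rat> \<Longrightarrow> t \<in> \<rat> \<Longrightarrow> 0 < r \<Longrightarrow> r < t \<Longrightarrow> t < 1 \<Longrightarrow>
      (\<integral>y. v y * balanced_bump r t n y \<partial>lborel) = - (\<integral>y. d y * primitive (balanced_bump r t n) y \<partial>lborel)"
  obtains C where "AE x in lborel. 0 < x \<and> x < 1 \<longrightarrow> v x = C - (\<integral>y. d y * indicator {x..} y \<partial>lborel)"
proof -
  have [measurable]: "v \<in> borel_measurable borel" "d \<in> borel_measurable borel" using v d by auto
  define D where "D x = (\<integral>y. d y * indicator {x..} y \<partial>lborel)" for x :: real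
  have [measurable]: "D \<in> borel_measurable borel" unfolding D_def by measurable
  have Db: "\<bar>D x\<bar> \<le> (\<integral>y. \<bar>d y\<bar> \<partial>lborel)" for x unfolding D_def by (rule abs_tail_integral_le[OF d])
  define I where "I = (\<integral>x. bump (1/4) (3/4) 1 x \<partial>lborel)"
  have I: "I > 0" unfolding I_def by (rule integral_bump_pos) auto
  \<comment> \<open>D is bounded but tends to the full integral of d at minus infinity, so v + D has
    to be restricted to become integrable.\<close>
  define e where "e x = (v x + D x) * indicator {0<..<1} x" for x
  have i01: "integrable lborel (indicator {0<..<1::real} :: real \<Rightarrow> real)" by simp
  have "integrable lborel (\<lambda>x. v x * indicator {0<..<1} x + indicator {0<..<1} x * D x)"
    by (intro Bochner_Integration.integrable_add integrable_mult_bounded[OF v, of _ 1]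
        integrable_mult_bounded[OF i01 _ Db]) (auto simp: indicator_def)
  then have e: "integrable lborel e" by (simp add: e_def[abs_def] algebra_simps)
  then have [measurable]: "e \<in> borel_measurable borel" by auto
  have eb: "integrable lborel (\<lambda>x. e x * bump r t n x)" for r t n
    by (rule integrable_mult_bounded[OF e, of _ 1]) (auto intro: abs_bump_le)
  \<comment> \<open>The mean of \<open>e\<close> weighted by the reference bump: the only value that
    a constant \<open>e\<close> could have.\<close>
  define C where "C = (\<integral>x. e x * bump (1/4) (3/4) 1 x \<partial>lborel) / I"
  have key: "(\<integral>x. (e x - C * indicator {0<..<1} x) * bump r t n x \<partial>lborel) = 0"
    if rt: "r \<in> \<rat>" "t \<in> \<rat>" "0 < r" "r < t" "t < 1" for r t n
  proof -
    let ?h = "balanced_bump r t n"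
    have h: "integrable lborel ?h" using integrable_balanced_bump rt by simp
    have [measurable]: "?h \<in> borel_measurable borel" using h by auto
    obtain B where B: "\<And>x. \<bar>?h x\<bar> \<le> B" using abs_balanced_bump_le by blast
    have vh: "integrable lborel (\<lambda>x. v x * ?h x)" by (rule integrable_mult_bounded[OF v _ B]) auto
    have Dh: "integrable lborel (\<lambda>x. ?h x * D x)" by (rule integrable_mult_bounded[OF h _ Db]) auto
    have "(\<integral>x. e x * ?h x \<partial>lborel) = (\<integral>x. v x * ?h x + ?h x * D x \<partial>lborel)"
    proof (rule Bochner_Integration.integral_cong[OF refl])
      fix x
      have "?h x = 0" if "x \<notin> {0<..<1}"
        by (rule balanced_bump_eq_0) (use that rt in auto)
      then show "e x * ?h x = v x * ?h x + ?h x * D x"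
        by (cases "x \<in> {0<..<1}") (auto simp: e_def algebra_simps)
    qed
    also have "\<dots> = (\<integral>x. v x * ?h x \<partial>lborel) + (\<integral>x. ?h x * D x \<partial>lborel)"
      using vh Dh by simp
    also have "\<dots> = 0"
      using weak[OF rt, of n] integral_mult_primitive[OF d h] by (simp add: D_def)
    finally have "0 = (\<integral>x. e x * bump r t n x - (\<integral>x. bump r t n x \<partial>lborel) / I * (e x * bump (1/4) (3/4) 1 x) \<partial>lborel)"
      by (simp add: balanced_bump_def I_def algebra_simps)
    also have "\<dots> = (\<integral>x. e x * bump r t n x \<partial>lborel) - (\<integral>x. bump r t n x \<partial>lborel) * C"
      using eb by (simp add: C_def)
    finally have "(\<integral>x. e x * bump r t n x \<partial>lborel) = (\<integral>x. bump r t n x \<partial>lborel) * C" by simp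
    moreover have "(\<lambda>x. (e x - C * indicator {0<..<1} x) * bump r t n x) = (\<lambda>x. e x * bump r t n x - C * bump r t n x)"
    proof
      fix x
      have "bump r t n x = 0" if "x \<notin> {0<..<1}" using that rt by (intro bump_eq_0) auto
      then show "(e x - C * indicator {0<..<1} x) * bump r t n x = e x * bump r t n x - C * bump r t n x"
        by (cases "x \<in> {0<..<1}") (auto simp: algebra_simps)
    qed
    ultimately show ?thesis using eb integrable_bump[OF rt(4)] by simp
  qed
  have "AE x in lborel. 0 < x \<and> x < 1 \<longrightarrow> e x - C * indicator {0<..<1} x = 0"
    by (rule fundamental_lemma_bump[OF _ _ key]) (use e in auto)
  then have "AE x in lborel. 0 < x \<and> x < 1 \<longrightarrow> v x = C - D x"
    by eventually_elim (auto simp: e_def)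
  then show ?thesis using that unfolding D_def by blast
qed

text \<open>In a difference of two values of v the constant of the representation cancels and an
  integral of d between the two points remains. On an interval of length one the integral of v is
  its mean, so averaging over one of the points gives the bound.\<close>

lemma weak_derivative_mean_deviation:
  assumes v: "integrable lborel v" and d: "integrable lborel d"
    and v0: "\<And>y. y \<notin> {0<..<1} \<Longrightarrow> v y = 0"
    and weak: "\<And>r t n. r \<in> \<rat> \<Longrightarrow> t \<in> \<rat> \<Longrightarrow> 0 < r \<Longrightarrow> r < t \<Longrightarrow> t < 1 \<Longrightarrow>
      (\<integral>y. v y * balanced_bump r t n y \<partial>lborel) = - (\<integral>y. d y * primitive (balanced_bump r t n) y \<partial>lborel)"
  shows "AE x in lborel. 0 < x \<and> x < 1 \<longrightarrow> \<bar>v x - (\<integral>y. v y \<partial>lborel)\<bar> \<le> (\<integral>y. \<bar>d y\<bar> \<partial>lborel)"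
proof -
  have [measurable]: "v \<in> borel_measurable borel" "d \<in> borel_measurable borel" using v d by auto
  define D where "D x = (\<integral>y. d y * indicator {x..} y \<partial>lborel)" for x :: real
  have [measurable]: "D \<in> borel_measurable borel" unfolding D_def by measurable
  have Db: "\<bar>D x\<bar> \<le> (\<integral>y. \<bar>d y\<bar> \<partial>lborel)" for x unfolding D_def by (rule abs_tail_integral_le[OF d])
  obtain C where C: "AE x in lborel. 0 < x \<and> x < 1 \<longrightarrow> v x = C - D x"
    using weak_derivative_representation[OF v d weak] unfolding D_def by blast
  have i01: "integrable lborel (indicator {0<..<1::real} :: real \<Rightarrow> real)" by simp
  from C have vae: "AE x in lborel. v x = indicator {0<..<1} x * (C - D x)"
    by eventually_elim (use v0 in \<open>auto simp: indicator_def\<close>)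
  from C show ?thesis
  proof eventually_elim
    case (elim x)
    show ?case
    proof
      assume x: "0 < x \<and> x < 1"
      have "v x - (\<integral>y. v y \<partial>lborel) = (\<integral>y. indicator {0<..<1::real} y * v x \<partial>lborel) - (\<integral>y. v y \<partial>lborel)"
        by (subst integral_mult_left_zero) simp
      also have "\<dots> = (\<integral>y. indicator {0<..<1} y * v x - v y \<partial>lborel)"
        using v by simp
      also have "\<dots> = (\<integral>y. indicator {0<..<1} y * (D y - D x) \<partial>lborel)"
        by (rule integral_cong_AE) (use vae elim x in \<open>auto simp: algebra_simps\<close>)
      finally have eq: "v x - (\<integral>y. v y \<partial>lborel) = (\<integral>y. indicator {0<..<1} y * (D y - D x) \<partial>lborel)" .
      have DD: "\<bar>D y - D x\<bar> \<le> (\<integral>y. \<bar>d y\<bar> \<partial>lborel)" for y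
        unfolding D_def by (rule abs_tail_integral_le[OF d])
      have "\<bar>\<integral>y. indicator {0<..<1} y * (D y - D x) \<partial>lborel\<bar> \<le> (\<integral>y. indicator {0<..<1::real} y * (\<integral>y. \<bar>d y\<bar> \<partial>lborel) \<partial>lborel)"
      proof (rule integral_abs_bound[THEN order_trans], rule integral_mono)
        have "integrable lborel (\<lambda>y. indicator {0<..<1} y * (D y - D x))"
          by (rule integrable_mult_bounded[OF i01 _ DD]) auto
        then show "integrable lborel (\<lambda>y. \<bar>indicator {0<..<1} y * (D y - D x)\<bar>)" by simp
        show "integrable lborel (\<lambda>y. indicator {0<..<1::real} y * (\<integral>y. \<bar>d y\<bar> \<partial>lborel))"
          by (intro integrable_mult_left i01)
        show "\<bar>indicator {0<..<1} y * (D y - D x)\<bar> \<le> indicator {0<..<1} y * (\<integral>y. \<bar>d y\<bar> \<partial>lborel)" for y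
          unfolding abs_mult using DD[of y] by (simp add: mult_left_mono)
      qed
      also have "\<dots> = (\<integral>y. \<bar>d y\<bar> \<partial>lborel)"
        by (subst integral_mult_left_zero) simp
      finally show "\<bar>v x - (\<integral>y. v y \<partial>lborel)\<bar> \<le> (\<integral>y. \<bar>d y\<bar> \<partial>lborel)"
        unfolding eq .
    qed
  qed
qed

lemma test_fun1_eq_0:
  assumes "test_fun1 S \<phi> \<phi>'" "x \<notin> closure {x. \<phi> x \<noteq> 0}"
  shows "\<phi> x = 0" "\<phi>' x = 0"
proof -
  define U where "U = - closure {x. \<phi> x \<noteq> 0}"
  have U: "open U" "x \<in> U" unfolding U_def using assms(2) by auto
  have z: "\<phi> y = 0" if "y \<in> U" for y
    using that closure_subset[of "{x. \<phi> x \<noteq> 0}"] unfolding U_def by blast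
  show "\<phi> x = 0" by (rule z) (rule U)
  have "(\<phi> has_real_derivative \<phi>' x) (at x)" using assms(1) by (auto simp: test_fun1_def)
  then have "((\<lambda>y. 0) has_real_derivative \<phi>' x) (at x)"
    by (rule has_field_derivative_transform_within_open[OF _ U]) (rule z)
  then show "\<phi>' x = 0" by (rule DERIV_unique) (rule DERIV_const)
qed

lemma test_fun1_continuous:
  assumes "test_fun1 S \<phi> \<phi>'" shows "continuous_on A \<phi>" "continuous_on A \<phi>'"
proof -
  show "continuous_on A \<phi>"
    by (rule DERIV_continuous_on[of _ _ \<phi>'])
      (use assms in \<open>auto simp: test_fun1_def intro: has_field_derivative_at_within\<close>)
  show "continuous_on A \<phi>'"
    using assms continuous_on_subset by (auto simp: test_fun1_def)
qed

lemma test_fun1_bounded: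
  assumes "test_fun1 S \<phi> \<phi>'"
  obtains C where "\<And>x. \<bar>\<phi> x\<bar> \<le> C" "\<And>x. \<bar>\<phi>' x\<bar> \<le> C"
proof -
  let ?K = "closure {x. \<phi> x \<noteq> 0}"
  have K: "compact ?K" using assms by (auto simp: test_fun1_def)
  have "bounded (\<phi> ` ?K)" "bounded (\<phi>' ` ?K)"
    using K test_fun1_continuous[OF assms] by (auto intro!: compact_imp_bounded compact_continuous_image)
  then obtain C1 C2 where C: "\<And>x. x \<in> ?K \<Longrightarrow> \<bar>\<phi> x\<bar> \<le> C1" "\<And>x. x \<in> ?K \<Longrightarrow> \<bar>\<phi>' x\<bar> \<le> C2"
    by (auto simp: bounded_real)
  have "\<bar>\<phi> x\<bar> \<le> max 0 (max C1 C2) \<and> \<bar>\<phi>' x\<bar> \<le> max 0 (max C1 C2)" for x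
    using C[of x] test_fun1_eq_0[OF assms, of x] by (cases "x \<in> ?K") auto
  then show ?thesis using that by blast
qed

lemma borel_measurable_fst_comp:
  assumes "f \<in> borel_measurable (borel :: real measure)"
  shows "(\<lambda>z::real \<times> real. f (fst z)) \<in> borel_measurable borel"
  by (rule measurable_compose[OF _ assms]) (simp add: borel_measurable_continuous_onI continuous_on_fst)

section \<open>Thin domains\<close>

text \<open>Here p and q stand for -\<epsilon> k1 and \<epsilon> k2. With \<epsilon> absorbed into
  the boundary functions, everything up to the energy estimate concerns one fixed domain.\<close>

locale thin_domain =
  fixes a b :: real and p q p' q' :: "real \<Rightarrow> real"
  assumes ab: "a < b"
    and p_deriv: "\<And>x. x \<in> {a..b} \<Longrightarrow> (p has_real_derivative p' x) (at x within {a..b})"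
    and q_deriv: "\<And>x. x \<in> {a..b} \<Longrightarrow> (q has_real_derivative q' x) (at x within {a..b})"
    and p'_cont: "continuous_on {a..b} p'" and q'_cont: "continuous_on {a..b} q'"
    and p_less_q: "\<And>x. x \<in> {a..b} \<Longrightarrow> p x < q x"
begin

definition R where "R = {(x, y). a < x \<and> x < b \<and> p x < y \<and> y < q x}"
definition L where "L x = q x - p x"
definition L' where "L' x = q' x - p' x"
text \<open>
  The coordinate \<open>s\<close> flattens the domain, and \<open>(1, m)\<close> is tangent to its level curves. The functions \<open>p\<close>, \<open>q\<close>
  are arbitrary outside \<open>[a, b]\<close>, so these are meaningful only over that interval.
\<close>

definition s where "s z = (snd z - p (fst z)) / L (fst z)"
definition m where "m z = p' (fst z) + s z * L' (fst z)"
definition ext :: "(real \<times> real \<Rightarrow> real) \<Rightarrow> real \<times> real \<Rightarrow> real" where "ext u z = indicator R z * u z"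

lemma p_cont: "continuous_on {a..b} p" and q_cont: "continuous_on {a..b} q"
  by (rule DERIV_continuous_on, erule p_deriv) (rule DERIV_continuous_on, erule q_deriv)

lemma L_cont: "continuous_on {a..b} L" and L'_cont: "continuous_on {a..b} L'"
  unfolding L_def L'_def by (intro continuous_intros p_cont q_cont p'_cont q'_cont)+

lemma L_pos: "x \<in> {a..b} \<Longrightarrow> 0 < L x"
  using p_less_q[of x] by (simp add: L_def)

lemma L_deriv: "a < x \<Longrightarrow> x < b \<Longrightarrow> (L has_real_derivative L' x) (at x)"
  and p_deriv_at: "a < x \<Longrightarrow> x < b \<Longrightarrow> (p has_real_derivative p' x) (at x)"
  unfolding L_def[abs_def] L'_def
  using p_deriv[of x] q_deriv[of x] by (auto simp: at_within_Icc_at intro!: derivative_intros)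

lemma L_bounds:
  "\<exists>l u. 0 < l \<and> (\<forall>x\<in>{a..b}. l \<le> L x \<and> L x \<le> u)"
proof -
  obtain x1 where x1: "x1 \<in> {a..b}" "\<And>x. x \<in> {a..b} \<Longrightarrow> L x1 \<le> L x"
    using continuous_attains_inf[OF _ _ L_cont] ab by auto
  obtain x2 where "x2 \<in> {a..b}" "\<And>x. x \<in> {a..b} \<Longrightarrow> L x \<le> L x2"
    using continuous_attains_sup[OF _ _ L_cont] ab by auto
  then show ?thesis using L_pos[OF x1(1)] x1 by blast
qed

lemma fst_cont:
  assumes "continuous_on {a..b} F" shows "continuous_on ({a<..<b} \<times> UNIV) (\<lambda>z. F (fst z))"
  by (rule continuous_on_compose2[OF assms]) (auto intro: continuous_intros)

lemma L_nonzero: "z \<in> {a<..<b} \<times> UNIV \<Longrightarrow> L (fst z) \<noteq> 0"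
  using L_pos[of "fst z"] by auto

lemma s_cont: "continuous_on ({a<..<b} \<times> UNIV) s"
  unfolding s_def by (intro continuous_intros fst_cont p_cont L_cont ballI L_nonzero)

lemma m_cont: "continuous_on ({a<..<b} \<times> UNIV) m"
  unfolding m_def by (intro continuous_intros fst_cont s_cont p'_cont L'_cont)

lemma R_sub: "R \<subseteq> {a<..<b} \<times> UNIV"
  by (auto simp: R_def)

lemma R_iff: "(x, y) \<in> R \<longleftrightarrow> a < x \<and> x < b \<and> p x < y \<and> y < q x"
  by (simp add: R_def)

lemma R_iff_s: "z \<in> R \<longleftrightarrow> a < fst z \<and> fst z < b \<and> s z \<in> {0<..<1}"
proof (cases "a < fst z \<and> fst z < b")
  case True
  then have L: "0 < L (fst z)" using L_pos by simp
  have "s z \<in> {0<..<1} \<longleftrightarrow> p (fst z) < snd z \<and> snd z < q (fst z)"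
    using L by (simp add: s_def divide_less_eq zero_less_divide_iff) (auto simp: L_def)
  then show ?thesis using True by (auto simp: R_def split: prod.splits)
qed (auto simp: R_def)

lemma open_R: "open R"
proof -
  have "R = s -` {0<..<1} \<inter> ({a<..<b} \<times> UNIV)"
    by (auto simp: R_iff_s)
  then show ?thesis
    using continuous_on_open_vimage[of "{a<..<b} \<times> UNIV" s] s_cont by (simp add: open_Times)
qed

lemma R_measurable [measurable]: "R \<in> sets borel"
  using open_R by simp

lemma emeasure_R: "emeasure lborel R < \<infinity>"
proof -
  have "bounded (p ` {a..b})" "bounded (q ` {a..b})"
    using p_cont q_cont by (auto intro!: compact_imp_bounded compact_continuous_image)
  then obtain P Q where PQ: "\<And>x. x \<in> {a..b} \<Longrightarrow> \<bar>p x\<bar> \<le> P" "\<And>x. x \<in> {a..b} \<Longrightarrow> \<bar>q x\<bar> \<le> Q"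
    unfolding bounded_real by (metis imageI)
  have "R \<subseteq> cbox (a, - P) (b, Q)"
  proof
    fix z assume "z \<in> R"
    then show "z \<in> cbox (a, - P) (b, Q)"
      using PQ[of "fst z"] by (cases z) (auto simp: R_def)
  qed
  then have "emeasure lborel R \<le> emeasure lborel (cbox (a, - P) (b, Q))"
    by (intro emeasure_mono) auto
  then show ?thesis using emeasure_lborel_cbox_finite[of "(a, -P)" "(b, Q)"] by (simp add: order_le_less_trans)
qed

section \<open>Test functions adapted to the flattened coordinate\<close>

lemma s_deriv:
  assumes "a < fst z" "fst z < b"
  shows "(s has_derivative (\<lambda>h. - (m z / L (fst z)) * fst h + snd h / L (fst z))) (at z)"
proof -
  have L0: "L (fst z) \<noteq> 0" using L_pos[of "fst z"] assms by auto
  have fz: "(fst has_derivative fst) (at z)" by (rule has_derivative_fst[OF has_derivative_ident])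
  have p: "((\<lambda>z. p (fst z)) has_derivative (\<lambda>h. p' (fst z) * fst h)) (at z)"
    by (rule has_derivative_compose[OF fz, of p]) (use p_deriv_at assms in \<open>auto simp: has_field_derivative_def\<close>)
  have L: "((\<lambda>z. L (fst z)) has_derivative (\<lambda>h. L' (fst z) * fst h)) (at z)"
    by (rule has_derivative_compose[OF fz, of L]) (use L_deriv assms in \<open>auto simp: has_field_derivative_def\<close>)
  have "(s has_derivative (\<lambda>h. ((snd h - p' (fst z) * fst h) * L (fst z)
      - (snd z - p (fst z)) * (L' (fst z) * fst h)) / (L (fst z) * L (fst z)))) (at z)"
    unfolding s_def[abs_def]
    by (intro has_derivative_divide' has_derivative_diff has_derivative_snd has_derivative_ident p L L0)
  moreover have "((snd h - p' (fst z) * fst h) * L (fst z)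
      - (snd z - p (fst z)) * (L' (fst z) * fst h)) / (L (fst z) * L (fst z))
     = - (m z / L (fst z)) * fst h + snd h / L (fst z)" for h
    unfolding m_def s_def using L0 by (simp add: field_simps)
  ultimately show ?thesis by simp
qed

text \<open>The gradient of s is (-m / L, 1 / L), so m enters only the x-derivative of the product.
  The factor \<alpha> vanishes wherever p, q and hence s are uncontrolled, which makes the product
  C^1 on the whole plane.\<close>

lemma product_test_fun2:
  assumes \<alpha>: "test_fun1 {a<..<b} \<alpha> \<alpha>'" and B: "test_fun1 {0<..<1} B B'"
  shows "test_fun2 R (\<lambda>z. \<alpha> (fst z) * B (s z))
    (\<lambda>z. \<alpha>' (fst z) * B (s z) - \<alpha> (fst z) * (B' (s z) * (m z / L (fst z))))
    (\<lambda>z. \<alpha> (fst z) * (B' (s z) / L (fst z)))"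
proof -
  let ?I = "{a<..<b} \<times> (UNIV :: real set)"
  let ?K = "closure {x. \<alpha> x \<noteq> 0}"
  let ?J = "(- ?K) \<times> (UNIV :: real set)"
  have KI: "?K \<subseteq> {a<..<b}" using \<alpha> by (simp add: test_fun1_def)
  \<comment> \<open>Two open sets: the strip, on which s is C^1, and the set where x avoids the
    support of \<alpha>, on which everything is zero. Regularity is checked on each and
    glued.\<close>
  have cover: "?I \<union> ?J = UNIV" using KI by auto
  have op: "open ?I" "open ?J" by (auto intro!: open_Times)
  have z: "\<alpha> (fst w) = 0" "\<alpha>' (fst w) = 0" if "w \<in> ?J" for w
  proof -
    have "fst w \<notin> ?K" using that by (cases w) simp
    then show "\<alpha> (fst w) = 0" "\<alpha>' (fst w) = 0" by (rule test_fun1_eq_0[OF \<alpha>])+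
  qed
  note c = test_fun1_continuous(1)[OF B] test_fun1_continuous(2)[OF B]
    test_fun1_continuous(1)[OF \<alpha>] test_fun1_continuous(2)[OF \<alpha>]
  have cB: "continuous_on ?I (\<lambda>z. B (s z))" "continuous_on ?I (\<lambda>z. B' (s z))"
    by (rule continuous_on_compose2[OF c(1)[of UNIV] s_cont], simp)
       (rule continuous_on_compose2[OF c(2)[of UNIV] s_cont], simp)
  have ca: "continuous_on ?I (\<lambda>z. \<alpha> (fst z))" "continuous_on ?I (\<lambda>z. \<alpha>' (fst z))"
    by (intro fst_cont c)+
  have "continuous_on (?I \<union> ?J) (\<lambda>z. \<alpha>' (fst z) * B (s z) - \<alpha> (fst z) * (B' (s z) * (m z / L (fst z))))"
  proof (rule continuous_on_open_Un[OF op])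
    show "continuous_on ?I (\<lambda>z. \<alpha>' (fst z) * B (s z) - \<alpha> (fst z) * (B' (s z) * (m z / L (fst z))))"
      by (intro continuous_intros cB ca m_cont fst_cont L_cont ballI L_nonzero)
    show "continuous_on ?J (\<lambda>z. \<alpha>' (fst z) * B (s z) - \<alpha> (fst z) * (B' (s z) * (m z / L (fst z))))"
      by (subst continuous_on_cong[where g="\<lambda>_. 0", OF refl]) (use z in \<open>auto intro: continuous_intros\<close>)
  qed
  moreover have "continuous_on (?I \<union> ?J) (\<lambda>z. \<alpha> (fst z) * (B' (s z) / L (fst z)))"
  proof (rule continuous_on_open_Un[OF op])
    show "continuous_on ?I (\<lambda>z. \<alpha> (fst z) * (B' (s z) / L (fst z)))"
      by (intro continuous_intros cB ca m_cont fst_cont L_cont ballI L_nonzero)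
    show "continuous_on ?J (\<lambda>z. \<alpha> (fst z) * (B' (s z) / L (fst z)))"
      by (subst continuous_on_cong[where g="\<lambda>_. 0", OF refl]) (use z in \<open>auto intro: continuous_intros\<close>)
  qed
  moreover have "((\<lambda>z. \<alpha> (fst z) * B (s z)) has_derivative
      (\<lambda>h. (\<alpha>' (fst z) * B (s z) - \<alpha> (fst z) * (B' (s z) * (m z / L (fst z)))) * fst h
        + \<alpha> (fst z) * (B' (s z) / L (fst z)) * snd h)) (at z)" for z
  proof (cases "z \<in> ?I")
    case True
    have fz: "(fst has_derivative fst) (at z)" by (rule has_derivative_fst[OF has_derivative_ident])
    have 1: "((\<lambda>z. \<alpha> (fst z)) has_derivative (\<lambda>h. \<alpha>' (fst z) * fst h)) (at z)"
      by (rule has_derivative_compose[OF fz, of \<alpha>]) (use \<alpha> in \<open>auto simp: has_field_derivative_def test_fun1_def\<close>)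
    have 2: "((\<lambda>z. B (s z)) has_derivative (\<lambda>h. B' (s z) * (- (m z / L (fst z)) * fst h + snd h / L (fst z)))) (at z)"
      by (rule has_derivative_compose[OF s_deriv, of z B]) (use B True in \<open>auto simp: has_field_derivative_def test_fun1_def\<close>)
    show ?thesis
      by (rule has_derivative_eq_rhs[OF has_derivative_mult[OF 1 2]]) (simp add: fun_eq_iff algebra_simps)
  next
    case False
    then have zJ: "z \<in> ?J" using cover by blast
    have "((\<lambda>z. \<alpha> (fst z) * B (s z)) has_derivative (\<lambda>h. 0)) (at z)"
      by (rule has_derivative_transform_within_open[OF has_derivative_const[of 0] op(2) zJ]) (use z in auto)
    then show ?thesis using z[OF zJ] by simp
  qed
  moreover have "compact (closure {z. \<alpha> (fst z) * B (s z) \<noteq> 0}) \<and> closure {z. \<alpha> (fst z) * B (s z) \<noteq> 0} \<subseteq> R"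
  proof -
    let ?KB = "closure {x. B x \<noteq> 0}"
    \<comment> \<open>The inverse of the chart (x, y) \<mapsto> (x, s). It carries the compact
      product of the two supports to a compact subset of R that contains the support of the
      product.\<close>
    let ?\<Psi> = "\<lambda>w. (fst w, p (fst w) + snd w * L (fst w))"
    have KB: "compact ?K" "compact ?KB" "?KB \<subseteq> {0<..<1}" using \<alpha> B by (auto simp: test_fun1_def)
    have "continuous_on (?K \<times> ?KB) ?\<Psi>"
      by (rule continuous_on_subset[of ?I]) (use KI in \<open>auto intro!: continuous_intros fst_cont p_cont L_cont\<close>)
    then have com: "compact (?\<Psi> ` (?K \<times> ?KB))"
      by (intro compact_continuous_image compact_Times KB)
    have "{z. \<alpha> (fst z) * B (s z) \<noteq> 0} \<subseteq> ?\<Psi> ` (?K \<times> ?KB)"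
    proof
      fix z assume "z \<in> {z. \<alpha> (fst z) * B (s z) \<noteq> 0}"
      then have zz: "fst z \<in> ?K" "s z \<in> ?KB"
        using closure_subset[of "{x. \<alpha> x \<noteq> 0}"] closure_subset[of "{x. B x \<noteq> 0}"] by auto
      then have "L (fst z) \<noteq> 0" using L_nonzero[of z] KI by (cases z) auto
      then have "z = ?\<Psi> (fst z, s z)" by (simp add: s_def prod_eq_iff)
      then show "z \<in> ?\<Psi> ` (?K \<times> ?KB)" using zz by blast
    qed
    then have sub: "closure {z. \<alpha> (fst z) * B (s z) \<noteq> 0} \<subseteq> ?\<Psi> ` (?K \<times> ?KB)"
      using com by (intro closure_minimal compact_imp_closed)
    have s\<Psi>: "s (?\<Psi> w) = snd w" if "fst w \<in> ?K" for w
      using L_nonzero[of w] that KI by (cases w) (auto simp: s_def)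
    have "?\<Psi> ` (?K \<times> ?KB) \<subseteq> R"
      using KI KB(3) s\<Psi> by (force simp: R_iff_s)
    with sub have "closure {z. \<alpha> (fst z) * B (s z) \<noteq> 0} \<subseteq> R" by blast
    moreover have "compact (closure {z. \<alpha> (fst z) * B (s z) \<noteq> 0})"
      using bounded_subset[OF compact_imp_bounded[OF com] sub] by (simp add: compact_eq_bounded_closed)
    ultimately show ?thesis by blast
  qed
  ultimately show ?thesis
    unfolding test_fun2_def cover by blast
qed

lemma ext_eq_0: "z \<notin> R \<Longrightarrow> ext u z = 0"
  by (simp add: ext_def)

lemma L2_on_ext: "L2_on R u \<longleftrightarrow> sq_integrable lborel (ext u)"
  by (simp add: L2_on_iff_sq_integrable ext_def[abs_def])

lemma ext_integrable: "L2_on R u \<Longrightarrow> integrable lborel (ext u)"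
  by (rule sq_integrable_imp_integrable[of _ _ R]) (use emeasure_R in \<open>auto simp: L2_on_ext ext_eq_0\<close>)

lemma set_integral_ext: "(\<integral>z\<in>R. u z * F z \<partial>lborel) = (\<integral>z. ext u z * F z \<partial>lborel)"
  by (simp add: set_lebesgue_integral_def ext_def mult.assoc)

lemma ext_mult_integrable:
  assumes u: "integrable lborel (ext u)" and F: "continuous_on R F" "\<And>z. z \<in> R \<Longrightarrow> \<bar>F z\<bar> \<le> C"
  shows "integrable lborel (\<lambda>z. ext u z * F z)"
proof -
  have "integrable lborel (\<lambda>z. ext u z * (indicator R z *\<^sub>R F z))"
  proof (rule integrable_mult_bounded[OF u, of _ "max 0 C"])
    show "(\<lambda>z. indicator R z *\<^sub>R F z) \<in> borel_measurable lborel"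
      using borel_measurable_continuous_on_indicator[OF R_measurable F(1)] by simp
    show "\<bar>indicator R z *\<^sub>R F z\<bar> \<le> max 0 C" for z
      using F(2)[of z] by (cases "z \<in> R") auto
  qed
  moreover have "ext u z * (indicator R z *\<^sub>R F z) = ext u z * F z" for z
    by (simp add: ext_def indicator_def)
  ultimately show ?thesis by (simp only:)
qed

text \<open>
  The boundary is only \<open>C\<^sup>1\<close>, hence \<open>m\<close> is merely continuous and cannot enter a test function. The weak
  \<open>y\<close>-derivative is therefore first restricted to almost every slice, where coefficients depending on \<open>x\<close>
  need no regularity.
\<close>

lemma slice_weak_derivative:
  assumes u: "H1_2 R u g1 g2" and B: "test_fun1 {0<..<1} B B'"
  shows "AE x in lborel. a < x \<and> x < b \<longrightarrow>
    integrable lborel (\<lambda>y. ext u (x, y) * (B' (s (x, y)) / L x)) \<and>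
    integrable lborel (\<lambda>y. ext g2 (x, y) * B (s (x, y))) \<and>
    (\<integral>y. ext u (x, y) * (B' (s (x, y)) / L x) \<partial>lborel) = - (\<integral>y. ext g2 (x, y) * B (s (x, y)) \<partial>lborel)"
proof -
  let ?I = "{a<..<b} \<times> (UNIV :: real set)"
  define F where "F z = B' (s z) / L (fst z)" for z
  define G where "G z = B (s z)" for z
  note c = test_fun1_continuous(1)[OF B, of UNIV] test_fun1_continuous(2)[OF B, of UNIV]
  have FG: "continuous_on R F" "continuous_on R G"
    unfolding F_def G_def
    by (rule continuous_on_subset[OF _ R_sub], intro continuous_intros continuous_on_compose2[OF c(2) s_cont] fst_cont L_cont ballI L_nonzero; simp)
      (rule continuous_on_subset[OF _ R_sub], intro continuous_on_compose2[OF c(1) s_cont], simp)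
  obtain C where C: "\<And>x. \<bar>B x\<bar> \<le> C" "\<And>x. \<bar>B' x\<bar> \<le> C" using test_fun1_bounded[OF B] by blast
  obtain l l' where l: "0 < l" "\<And>x. x \<in> {a..b} \<Longrightarrow> l \<le> L x \<and> L x \<le> l'"
    using L_bounds by blast
  have Fb: "\<bar>F z\<bar> \<le> C / l" if "z \<in> R" for z
  proof -
    have "l \<le> L (fst z)" using that l(2)[of "fst z"] by (auto simp: R_iff_s)
    then show ?thesis unfolding F_def abs_divide
      using C(2)[of "s z"] l(1) by (intro frac_le) auto
  qed
  have L2: "L2_on R u" "L2_on R g2" using u by (auto simp: H1_2_def)
  note iu = ext_integrable[OF L2(1)] and ig = ext_integrable[OF L2(2)]
  have iF: "integrable lborel (\<lambda>z. ext u z * F z)" by (rule ext_mult_integrable[OF iu FG(1) Fb])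
  have iG: "integrable lborel (\<lambda>z. ext g2 z * G z)"
    by (rule ext_mult_integrable[OF ig FG(2), of C]) (simp add: G_def C)
  \<comment> \<open>A test function bump(x) B(s) pairs the bump with the slice integral of
    \<open>k\<close>, so the fundamental lemma makes that slice integral vanish for almost every x.
    The exceptional set may depend on B.\<close>
  define k where "k z = ext u z * F z + ext g2 z * G z" for z
  have k: "integrable (lborel \<Otimes>\<^sub>M lborel) k" unfolding k_def lborel_prod using iF iG by simp
  have zero: "(\<integral>x. (\<integral>y. k (x, y) \<partial>lborel) * bump r t n x \<partial>lborel) = 0"
    if "a < r" "r < t" "t < b" for r t n
  proof -
    have \<alpha>: "test_fun1 {a<..<b} (bump r t n) (bump' r t n)"
      using that by (intro test_fun1_bump) auto
    note T = product_test_fun2[OF \<alpha> B]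
    have "(\<integral>z\<in>R. u z * (bump r t n (fst z) * (B' (s z) / L (fst z))) \<partial>lborel)
        = - (\<integral>z\<in>R. g2 z * (bump r t n (fst z) * B (s z)) \<partial>lborel)"
      using u T unfolding H1_2_def by blast
    then have eq: "(\<integral>z. (ext u z * F z) * bump r t n (fst z) \<partial>lborel) + (\<integral>z. (ext g2 z * G z) * bump r t n (fst z) \<partial>lborel) = 0"
      unfolding set_integral_ext F_def G_def by (simp add: ac_simps)
    have [measurable]: "(\<lambda>z::real\<times>real. bump r t n (fst z)) \<in> borel_measurable lborel"
      using borel_measurable_fst_comp[OF bump_measurable] by simp
    have ik: "integrable lborel (\<lambda>z. k z * bump r t n (fst z))"
      by (rule integrable_mult_bounded[of _ _ _ 1]) (use k in \<open>auto simp: lborel_prod abs_bump_le\<close>)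
    have "(\<integral>z. k z * bump r t n (fst z) \<partial>lborel)
       = (\<integral>z. (ext u z * F z) * bump r t n (fst z) + (ext g2 z * G z) * bump r t n (fst z) \<partial>lborel)"
      by (simp add: k_def algebra_simps)
    also have "\<dots> = 0"
      unfolding eq[symmetric]
      by (intro Bochner_Integration.integral_add integrable_mult_bounded[OF iF, of _ 1] integrable_mult_bounded[OF iG, of _ 1])
        (auto simp: abs_bump_le)
    finally have "(\<integral>z. k z * bump r t n (fst z) \<partial>(lborel \<Otimes>\<^sub>M lborel)) = 0" by (simp add: lborel_prod)
    moreover have "(\<integral>x. (\<integral>y. k (x, y) * bump r t n (fst (x, y)) \<partial>lborel) \<partial>lborel) = (\<integral>z. k z * bump r t n (fst z) \<partial>(lborel \<Otimes>\<^sub>M lborel))"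
      by (rule lborel_pair.integral_fst') (use ik in \<open>simp add: lborel_prod\<close>)
    ultimately show ?thesis by simp
  qed
  have "AE x in lborel. a < x \<and> x < b \<longrightarrow> (\<integral>y. k (x, y) \<partial>lborel) = 0"
    by (rule fundamental_lemma_bump[OF ab lborel_pair.integrable_fst'[OF k] zero])
  moreover have "AE x in lborel. integrable lborel (\<lambda>y. ext u (x, y) * F (x, y))"
    using lborel_pair.AE_integrable_fst'[of "\<lambda>z. ext u z * F z"] iF by (simp add: lborel_prod)
  moreover have "AE x in lborel. integrable lborel (\<lambda>y. ext g2 (x, y) * G (x, y))"
    using lborel_pair.AE_integrable_fst'[of "\<lambda>z. ext g2 z * G z"] iG by (simp add: lborel_prod)
  ultimately show ?thesis
    by eventually_elim (auto simp: k_def F_def G_def)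
qed

section \<open>Slice averages\<close>

definition avg :: "(real \<times> real \<Rightarrow> real) \<Rightarrow> real \<Rightarrow> real" where
  "avg u x = (\<integral>y. ext u (x, y) \<partial>lborel) / L x"

lemma slice_param: "a < x \<Longrightarrow> x < b \<Longrightarrow> s (x, p x + L x * t) = t"
  using L_pos[of x] by (simp add: s_def)

lemma slice_param_in_R: "a < x \<Longrightarrow> x < b \<Longrightarrow> (x, p x + L x * t) \<in> R \<longleftrightarrow> 0 < t \<and> t < 1"
  by (simp add: R_iff_s slice_param)

lemma slice_integral_affine:
  assumes "a < x" "x < b"
  shows "(\<integral>y. F y \<partial>lborel) = L x * (\<integral>t. F (p x + L x * t) \<partial>lborel :: real)"
  using lborel_integral_real_affine[of "L x" F "p x"] L_pos[of x] assms by simp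

lemma indicator_R_slice: "indicator R (x, y) = (indicator {a<..<b} x * indicator {p x<..<q x} y :: real)"
  by (simp add: indicator_def R_iff)

lemma slice_indicator:
  assumes "a < x" "x < b"
  shows "integrable lborel (\<lambda>y. indicator R (x, y) :: real)" "(\<integral>y. indicator R (x, y) \<partial>lborel) = L x"
    "sq_integrable lborel (\<lambda>y. indicator R (x, y))"
  using assms p_less_q[of x]
  by (simp_all add: indicator_R_slice L_def sq_integrable_def power2_eq_square flip: indicator_inter_arith)

lemma slice_sq_integrable:
  assumes "L2_on R u" shows "AE x in lborel. sq_integrable lborel (\<lambda>y. ext u (x, y))"
proof -
  have e: "ext u \<in> borel_measurable (lborel \<Otimes>\<^sub>M lborel)" "integrable (lborel \<Otimes>\<^sub>M lborel) (\<lambda>z. (ext u z)\<^sup>2)"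
    using assms unfolding L2_on_ext sq_integrable_def lborel_prod by auto
  have "AE x in lborel. integrable lborel (\<lambda>y. (ext u (x, y))\<^sup>2)"
    using lborel_pair.AE_integrable_fst'[OF e(2)] by simp
  moreover have "(\<lambda>y. ext u (x, y)) \<in> borel_measurable lborel" for x
    using measurable_compose[OF measurable_Pair1' e(1)] by simp
  ultimately show ?thesis by (auto simp: sq_integrable_def)
qed

text \<open>Cauchy-Schwarz against the indicator of the slice, whose square integrates to L
  x.\<close>

lemma slice_Cauchy_Schwarz:
  assumes "L2_on R u"
  shows "AE x in lborel. a < x \<and> x < b \<longrightarrow>
    (\<integral>y. \<bar>ext u (x, y)\<bar> \<partial>lborel)\<^sup>2 \<le> L x * (\<integral>y. (ext u (x, y))\<^sup>2 \<partial>lborel) \<and>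
    (\<integral>y. ext u (x, y) \<partial>lborel)\<^sup>2 \<le> L x * (\<integral>y. (ext u (x, y))\<^sup>2 \<partial>lborel)"
  using slice_sq_integrable[OF assms]
proof eventually_elim
  case (elim x)
  show ?case
  proof
    assume x: "a < x \<and> x < b"
    then have i: "sq_integrable lborel (\<lambda>y. indicator R (x, y))" "(\<integral>y. (indicator R (x, y))\<^sup>2 \<partial>lborel) = L x"
      using slice_indicator[of x] by (auto simp: power2_eq_square simp flip: indicator_inter_arith)
    have abs: "sq_integrable lborel (\<lambda>y. \<bar>ext u (x, y)\<bar>)" using elim by (auto simp: sq_integrable_def)
    have "indicator R (x, y) * \<bar>ext u (x, y)\<bar> = \<bar>ext u (x, y)\<bar>" "indicator R (x, y) * ext u (x, y) = ext u (x, y)" for y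
      by (auto simp: ext_def indicator_def)
    then show "(\<integral>y. \<bar>ext u (x, y)\<bar> \<partial>lborel)\<^sup>2 \<le> L x * (\<integral>y. (ext u (x, y))\<^sup>2 \<partial>lborel) \<and>
       (\<integral>y. ext u (x, y) \<partial>lborel)\<^sup>2 \<le> L x * (\<integral>y. (ext u (x, y))\<^sup>2 \<partial>lborel)"
      using sq_integrable_Cauchy_Schwarz[OF i(1) abs] sq_integrable_Cauchy_Schwarz[OF i(1) elim] i(2)
      by (simp only: power2_abs)
  qed
qed

text \<open>Almost every slice is stretched affinely to the unit interval, where the one-dimensional
  deviation bound applies; \<open>avg u x\<close> becomes the plain integral of the stretched
  function.\<close>

lemma slice_mean_deviation:
  assumes u: "H1_2 R u g1 g2"
  shows "AE x in lborel. a < x \<and> x < b \<longrightarrow> (AE t in lborel. 0 < t \<and> t < 1 \<longrightarrow>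
     \<bar>ext u (x, p x + L x * t) - avg u x\<bar> \<le> (\<integral>y. \<bar>ext g2 (x, y)\<bar> \<partial>lborel))"
proof -
  \<comment> \<open>The index set over which the exceptional sets of
    \<open>slice_weak_derivative\<close> are united; its countability keeps the union null.\<close>
  define X where "X = {(r, t, n :: nat). r \<in> \<rat> \<and> t \<in> \<rat> \<and> 0 < r \<and> r < t \<and> t < (1::real)}"
  have "countable (\<rat> \<times> \<rat> \<times> (UNIV :: nat set) :: (real \<times> real \<times> nat) set)"
    by (intro countable_SIGMA countable_rat) auto
  then have X: "countable X" by (rule countable_subset[rotated]) (auto simp: X_def)
  have L2: "L2_on R u" "L2_on R g2" using u by (auto simp: H1_2_def)
  have 1: "AE x in lborel. \<forall>(r, t, n)\<in>X. a < x \<and> x < b \<longrightarrow>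
    (\<integral>y. ext u (x, y) * (balanced_bump r t n (s (x, y)) / L x) \<partial>lborel)
      = - (\<integral>y. ext g2 (x, y) * primitive (balanced_bump r t n) (s (x, y)) \<partial>lborel)"
  proof (subst AE_ball_countable[OF X], clarify)
    fix r t n assume "(r, t, n) \<in> X"
    then have "test_fun1 {0<..<1} (primitive (balanced_bump r t n)) (balanced_bump r t n)"
      by (intro test_fun1_primitive_balanced_bump) (auto simp: X_def)
    from slice_weak_derivative[OF u this]
    show "AE x in lborel. a < x \<and> x < b \<longrightarrow>
      (\<integral>y. ext u (x, y) * (balanced_bump r t n (s (x, y)) / L x) \<partial>lborel)
      = - (\<integral>y. ext g2 (x, y) * primitive (balanced_bump r t n) (s (x, y)) \<partial>lborel)"
      by eventually_elim blast
  qed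
  have 2: "AE x in lborel. integrable lborel (\<lambda>y. ext u (x, y))" "AE x in lborel. integrable lborel (\<lambda>y. ext g2 (x, y))"
    using lborel_pair.AE_integrable_fst'[of "ext u"] lborel_pair.AE_integrable_fst'[of "ext g2"]
      ext_integrable[OF L2(1)] ext_integrable[OF L2(2)] by (simp_all add: lborel_prod)
  from 1 2 show ?thesis
  proof eventually_elim
    case (elim x)
    show ?case
    proof
      assume x: "a < x \<and> x < b"
      then have Lx: "0 < L x" using L_pos[of x] by simp
      define v where "v t = ext u (x, p x + L x * t)" for t
      \<comment> \<open>The factor L x is the chain rule for the stretching. It is compensated by
        the change of variables in the integral of |d|, so the final bound carries no power of
        L.\<close>
      define d where "d t = L x * ext g2 (x, p x + L x * t)" for t
      have v: "integrable lborel v" unfolding v_def[abs_def]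
        using lborel_integrable_real_affine[OF elim(2), of "L x" "p x"] Lx by simp
      have d: "integrable lborel d" unfolding d_def[abs_def]
        using lborel_integrable_real_affine[OF elim(3), of "L x" "p x"] Lx by simp
      have v0: "v t = 0" if "t \<notin> {0<..<1}" for t
        unfolding v_def by (rule ext_eq_0) (use that x in \<open>simp add: slice_param_in_R\<close>)
      have weak: "(\<integral>y. v y * balanced_bump r t n y \<partial>lborel) = - (\<integral>y. d y * primitive (balanced_bump r t n) y \<partial>lborel)"
        if "r \<in> \<rat>" "t \<in> \<rat>" "0 < r" "r < t" "t < 1" for r t n
      proof -
        have "(r, t, n) \<in> X" using that by (simp add: X_def)
        with elim(1) x have "(\<integral>y. ext u (x, y) * (balanced_bump r t n (s (x, y)) / L x) \<partial>lborel)
          = - (\<integral>y. ext g2 (x, y) * primitive (balanced_bump r t n) (s (x, y)) \<partial>lborel)" by blast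
        moreover have "(\<integral>y. ext u (x, y) * (balanced_bump r t n (s (x, y)) / L x) \<partial>lborel)
            = L x * (\<integral>t'. v t' * (balanced_bump r t n t' / L x) \<partial>lborel)"
          by (subst slice_integral_affine[of x]) (use x in \<open>simp_all add: slice_param v_def\<close>)
        moreover have "(\<integral>y. ext g2 (x, y) * primitive (balanced_bump r t n) (s (x, y)) \<partial>lborel)
            = L x * (\<integral>t'. ext g2 (x, p x + L x * t') * primitive (balanced_bump r t n) t' \<partial>lborel)"
          by (subst slice_integral_affine[of x]) (use x in \<open>simp_all add: slice_param\<close>)
        ultimately have "L x * (\<integral>t'. v t' * (balanced_bump r t n t' / L x) \<partial>lborel)
          = - (L x * (\<integral>t'. ext g2 (x, p x + L x * t') * primitive (balanced_bump r t n) t' \<partial>lborel))"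
          by simp
        moreover have "(\<integral>t'. v t' * (balanced_bump r t n t' / L x) \<partial>lborel) = (\<integral>t'. v t' * balanced_bump r t n t' \<partial>lborel) / L x"
          by (simp flip: integral_divide_zero)
        moreover have "(\<integral>t'. d t' * primitive (balanced_bump r t n) t' \<partial>lborel)
           = L x * (\<integral>t'. ext g2 (x, p x + L x * t') * primitive (balanced_bump r t n) t' \<partial>lborel)"
          unfolding d_def by (simp add: mult.assoc flip: integral_mult_right_zero)
        ultimately show ?thesis using Lx by simp
      qed
      have "(\<integral>t. v t \<partial>lborel) = avg u x"
        unfolding avg_def by (subst slice_integral_affine[of x "\<lambda>y. ext u (x, y)"]) (use x Lx in \<open>simp_all add: v_def[abs_def]\<close>)
      moreover have "(\<integral>t. \<bar>d t\<bar> \<partial>lborel) = (\<integral>y. \<bar>ext g2 (x, y)\<bar> \<partial>lborel)"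
        by (subst slice_integral_affine[of x "\<lambda>y. \<bar>ext g2 (x, y)\<bar>"]) (use x Lx in \<open>simp_all add: d_def abs_mult\<close>)
      ultimately show "AE t in lborel. 0 < t \<and> t < 1 \<longrightarrow>
         \<bar>ext u (x, p x + L x * t) - avg u x\<bar> \<le> (\<integral>y. \<bar>ext g2 (x, y)\<bar> \<partial>lborel)"
        using weak_derivative_mean_deviation[OF v d v0 weak] by (simp add: v_def)
    qed
  qed
qed

text \<open>The deviation is bounded by a single constant D on the whole slice, so integrating its
  square over \<theta> costs only the length \<tau> of the slice of \<theta>. Cauchy-Schwarz then
  bounds D^2 by L times the vertical energy. Here the thinness of \<theta> pays off.\<close>

lemma slice_deviation_integral:
  assumes u: "H1_2 R u g1 g2" and \<theta>: "\<theta> \<in> sets borel" "\<theta> \<subseteq> R"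
    and \<tau>: "\<And>x. a < x \<Longrightarrow> x < b \<Longrightarrow> (\<integral>y. indicator \<theta> (x, y) \<partial>lborel) \<le> \<tau>"
  shows "AE x in lborel. a < x \<and> x < b \<longrightarrow>
    (\<integral>y. indicator \<theta> (x, y) * (ext u (x, y) - avg u x)\<^sup>2 \<partial>lborel) \<le> \<tau> * (L x * (\<integral>y. (ext g2 (x, y))\<^sup>2 \<partial>lborel))"
proof -
  have L2: "L2_on R g2" using u by (auto simp: H1_2_def)
  from slice_mean_deviation[OF u] slice_Cauchy_Schwarz[OF L2] show ?thesis
  proof eventually_elim
    case (elim x)
    show ?case
    proof
      assume x: "a < x \<and> x < b"
      then have Lx: "0 < L x" using L_pos[of x] by simp
      define D where "D = (\<integral>y. \<bar>ext g2 (x, y)\<bar> \<partial>lborel)"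
      have "(\<lambda>y. indicator \<theta> (x, y) :: real) \<in> borel_measurable borel"
        using \<theta>(1) by (intro measurable_compose[OF _ borel_measurable_indicator[of \<theta> borel]]
          borel_measurable_continuous_onI continuous_intros)
      then have i\<theta>: "integrable lborel (\<lambda>y. indicator \<theta> (x, y) :: real)"
        using slice_indicator(1)[of x] x \<theta>(2)
        by (intro Bochner_Integration.integrable_bound[OF slice_indicator(1)[of x]]) (auto simp: indicator_def)
      have i: "integrable lborel (\<lambda>t. indicator \<theta> (x, p x + L x * t) * D\<^sup>2)"
        using lborel_integrable_real_affine[OF i\<theta>, of "L x" "p x"] Lx by simp
      have "(\<integral>y. indicator \<theta> (x, y) * (ext u (x, y) - avg u x)\<^sup>2 \<partial>lborel)
         = L x * (\<integral>t. indicator \<theta> (x, p x + L x * t) * (ext u (x, p x + L x * t) - avg u x)\<^sup>2 \<partial>lborel)"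
        by (subst slice_integral_affine[of x]) (use x in simp_all)
      also have "\<dots> \<le> L x * (\<integral>t. indicator \<theta> (x, p x + L x * t) * D\<^sup>2 \<partial>lborel)"
      proof (intro mult_left_mono integral_mono_AE' i)
        have "AE t in lborel. 0 < t \<and> t < 1 \<longrightarrow> \<bar>ext u (x, p x + L x * t) - avg u x\<bar> \<le> D"
          using elim x by (simp add: D_def)
        then show "AE t in lborel. indicator \<theta> (x, p x + L x * t) * (ext u (x, p x + L x * t) - avg u x)\<^sup>2
            \<le> indicator \<theta> (x, p x + L x * t) * D\<^sup>2"
        proof eventually_elim
          case (elim t)
          show ?case
          proof (cases "(x, p x + L x * t) \<in> \<theta>")
            case True
            then have "0 < t \<and> t < 1" using \<theta>(2) slice_param_in_R[of x t] x by blast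
            then show ?thesis using elim abs_le_square_iff[of "ext u (x, p x + L x * t) - avg u x" D] True
              by (simp add: indicator_def)
          qed simp
        qed
      qed (use Lx in auto)
      also have "\<dots> = (\<integral>y. indicator \<theta> (x, y) * D\<^sup>2 \<partial>lborel)"
        by (subst slice_integral_affine[of x "\<lambda>y. indicator \<theta> (x, y) * D\<^sup>2"]) (use x in simp_all)
      also have "\<dots> = (\<integral>y. indicator \<theta> (x, y) \<partial>lborel) * D\<^sup>2" by simp
      also have "\<dots> \<le> \<tau> * D\<^sup>2" using \<tau> x by (intro mult_right_mono) auto
      also have "\<dots> \<le> \<tau> * (L x * (\<integral>y. (ext g2 (x, y))\<^sup>2 \<partial>lborel))"
      proof (rule mult_left_mono)
        show "D\<^sup>2 \<le> L x * (\<integral>y. (ext g2 (x, y))\<^sup>2 \<partial>lborel)" using elim x by (simp add: D_def)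
        have "0 \<le> (\<integral>y. indicator \<theta> (x, y) \<partial>lborel :: real)" by simp
        then show "0 \<le> \<tau>" using \<tau>[of x] x by linarith
      qed
      finally show "(\<integral>y. indicator \<theta> (x, y) * (ext u (x, y) - avg u x)\<^sup>2 \<partial>lborel)
          \<le> \<tau> * (L x * (\<integral>y. (ext g2 (x, y))\<^sup>2 \<partial>lborel))" .
    qed
  qed
qed

lemma L_indicator_measurable: "(\<lambda>x. indicator {a<..<b} x * L x) \<in> borel_measurable borel"
  and inverse_L_indicator_measurable: "(\<lambda>x. indicator {a<..<b} x * (1 / L x)) \<in> borel_measurable borel"
proof -
  have c: "continuous_on {a<..<b} L" by (rule continuous_on_subset[OF L_cont]) auto
  have "L x \<noteq> 0" if "x \<in> {a<..<b}" for x using L_pos[of x] that by auto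
  then have "continuous_on {a<..<b} (\<lambda>x. 1 / L x)" using c by (intro continuous_intros) auto
  then show "(\<lambda>x. indicator {a<..<b} x * L x) \<in> borel_measurable borel"
    "(\<lambda>x. indicator {a<..<b} x * (1 / L x)) \<in> borel_measurable borel"
    using borel_measurable_continuous_on_indicator[of "{a<..<b}" L] c
      borel_measurable_continuous_on_indicator[of "{a<..<b}" "\<lambda>x. 1 / L x"] by auto
qed

lemma cylinder_integral:
  assumes \<psi>: "integrable lborel (\<lambda>x. indicator {a<..<b} x * \<psi> x)"
  shows "integrable lborel (ext (\<lambda>z. \<psi> (fst z)))"
    "(\<integral>z. ext (\<lambda>z. \<psi> (fst z)) z \<partial>lborel) = (\<integral>x. indicator {a<..<b} x * (L x * \<psi> x) \<partial>lborel)"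
proof -
  \<comment> \<open>\<psi> is controlled only on (a, b); the restriction is measurable on the whole
    line.\<close>
  define \<psi>0 where "\<psi>0 x = indicator {a<..<b} x * \<psi> x" for x
  have e: "ext (\<lambda>z. \<psi> (fst z)) = (\<lambda>z. indicator R z * \<psi>0 (fst z))"
    by (auto simp: ext_def \<psi>0_def fun_eq_iff indicator_def R_iff)
  obtain l l' where l: "0 < l" "\<And>x. x \<in> {a..b} \<Longrightarrow> l \<le> L x \<and> L x \<le> l'" using L_bounds by blast
  have int_y: "(\<integral>y. indicator R (x, y) * c \<partial>lborel) = indicator {a<..<b} x * L x * c" for x c
  proof (cases "x \<in> {a<..<b}")
    case True then show ?thesis using slice_indicator(2)[of x] by simp
  next
    case False then show ?thesis by (simp add: indicator_R_slice)
  qed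
  have \<psi>0m: "\<psi>0 \<in> borel_measurable borel" using \<psi> unfolding \<psi>0_def[abs_def] by auto
  have m: "(\<lambda>z. indicator R z * \<psi>0 (fst z)) \<in> borel_measurable (lborel \<Otimes>\<^sub>M lborel)"
    unfolding lborel_prod using borel_measurable_fst_comp[OF \<psi>0m] by auto
  have "integrable lborel (\<lambda>x. \<bar>\<psi>0 x\<bar> * (indicator {a<..<b} x * L x))"
  proof (rule integrable_mult_bounded[of _ _ _ "\<bar>l'\<bar>"])
    show "integrable lborel (\<lambda>x. \<bar>\<psi>0 x\<bar>)" using \<psi> by (simp add: \<psi>0_def[abs_def])
    show "\<bar>indicator {a<..<b} x * L x\<bar> \<le> \<bar>l'\<bar>" for x
      using l(1) l(2)[of x] by (cases "x \<in> {a<..<b}") auto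
  qed (use L_indicator_measurable in auto)
  moreover have "(\<integral>y. norm (indicator R (x, y) * \<psi>0 (fst (x, y))) \<partial>lborel) = \<bar>\<psi>0 x\<bar> * (indicator {a<..<b} x * L x)" for x
    using int_y[of x "\<bar>\<psi>0 x\<bar>"] by (simp add: abs_mult)
  ultimately have I: "integrable (lborel \<Otimes>\<^sub>M lborel) (\<lambda>z. indicator R z * \<psi>0 (fst z))"
  proof (intro lborel_pair.Fubini_integrable[OF m])
    have "integrable lborel (\<lambda>y. indicator R (x, y) * \<psi>0 x)" for x
      using slice_indicator(1)[of x] by (cases "a < x \<and> x < b") (auto simp: indicator_R_slice)
    then show "AE x in lborel. integrable lborel (\<lambda>y. indicator R (x, y) * \<psi>0 (fst (x, y)))" by simp
  qed simp
  then show "integrable lborel (ext (\<lambda>z. \<psi> (fst z)))" by (simp add: e lborel_prod)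
  have "(\<integral>z. indicator R z * \<psi>0 (fst z) \<partial>(lborel \<Otimes>\<^sub>M lborel)) = (\<integral>x. (\<integral>y. indicator R (x, y) * \<psi>0 x \<partial>lborel) \<partial>lborel)"
    using lborel_pair.integral_fst'[OF I] by simp
  also have "\<dots> = (\<integral>x. indicator {a<..<b} x * (L x * \<psi> x) \<partial>lborel)"
    unfolding int_y by (intro Bochner_Integration.integral_cong) (auto simp: \<psi>0_def indicator_def)
  finally show "(\<integral>z. ext (\<lambda>z. \<psi> (fst z)) z \<partial>lborel) = (\<integral>x. indicator {a<..<b} x * (L x * \<psi> x) \<partial>lborel)"
    by (simp add: e lborel_prod)
qed

lemma cylinder_L2:
  assumes \<psi>: "L2_on {a<..<b} \<psi>"
  shows "L2_on R (\<lambda>z. \<psi> (fst z))"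
    "(\<integral>z. (ext (\<lambda>z. \<psi> (fst z)) z)\<^sup>2 \<partial>lborel) = (\<integral>x. indicator {a<..<b} x * (L x * (\<psi> x)\<^sup>2) \<partial>lborel)"
proof -
  have sq: "(\<lambda>x. indicator {a<..<b} x * (\<psi> x)\<^sup>2) = (\<lambda>x. (indicator {a<..<b} x * \<psi> x)\<^sup>2)"
    "(\<lambda>z. (ext (\<lambda>z. \<psi> (fst z)) z)\<^sup>2) = ext (\<lambda>z. (\<psi> (fst z))\<^sup>2)"
    by (auto simp: fun_eq_iff indicator_def ext_def)
  have 0: "integrable lborel (\<lambda>x. indicator {a<..<b} x * (\<psi> x)\<^sup>2)" "(\<lambda>x. indicator {a<..<b} x * \<psi> x) \<in> borel_measurable borel"
    using \<psi> unfolding L2_on_iff_sq_integrable sq_integrable_def sq by auto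
  have "ext (\<lambda>z. \<psi> (fst z)) = (\<lambda>z. indicator R z * (indicator {a<..<b} (fst z) * \<psi> (fst z)))"
    by (auto simp: ext_def fun_eq_iff indicator_def R_iff)
  then have "ext (\<lambda>z. \<psi> (fst z)) \<in> borel_measurable lborel"
    using borel_measurable_fst_comp[OF 0(2)] by auto
  with cylinder_integral[OF 0(1)] show "L2_on R (\<lambda>z. \<psi> (fst z))"
    "(\<integral>z. (ext (\<lambda>z. \<psi> (fst z)) z)\<^sup>2 \<partial>lborel) = (\<integral>x. indicator {a<..<b} x * (L x * (\<psi> x)\<^sup>2) \<partial>lborel)"
    unfolding L2_on_ext sq_integrable_def sq by auto
qed

text \<open>The square of a mean is at most the mean of the squares on almost every slice, and the
  positive lower bound of L makes the latter integrable in x.\<close>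

lemma avg_L2:
  assumes u: "L2_on R u" shows "L2_on {a<..<b} (avg u)"
proof -
  have e: "integrable (lborel \<Otimes>\<^sub>M lborel) (ext u)" "integrable (lborel \<Otimes>\<^sub>M lborel) (\<lambda>z. (ext u z)\<^sup>2)"
    using u ext_integrable[OF u] unfolding L2_on_ext sq_integrable_def lborel_prod by auto
  have m1: "(\<lambda>x. \<integral>y. ext u (x, y) \<partial>lborel) \<in> borel_measurable borel"
    using lborel_pair.integrable_fst'[OF e(1)] by auto
  have i2: "integrable lborel (\<lambda>x. \<integral>y. (ext u (x, y))\<^sup>2 \<partial>lborel)"
    using lborel_pair.integrable_fst'[OF e(2)] by auto
  have "(\<lambda>x. indicator {a<..<b} x * avg u x) = (\<lambda>x. (indicator {a<..<b} x * (1 / L x)) * (\<integral>y. ext u (x, y) \<partial>lborel))"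
    by (simp add: avg_def)
  then have m: "(\<lambda>x. indicator {a<..<b} x * avg u x) \<in> borel_measurable borel"
    using m1 inverse_L_indicator_measurable by (simp only: borel_measurable_times)
  obtain l l' where l: "0 < l" "\<And>x. x \<in> {a..b} \<Longrightarrow> l \<le> L x \<and> L x \<le> l'" using L_bounds by blast
  have "integrable lborel (\<lambda>x. (indicator {a<..<b} x * avg u x)\<^sup>2)"
  proof (rule Bochner_Integration.integrable_bound)
    show "integrable lborel (\<lambda>x. (\<integral>y. (ext u (x, y))\<^sup>2 \<partial>lborel) / l)" using i2 by simp
    show "(\<lambda>x. (indicator {a<..<b} x * avg u x)\<^sup>2) \<in> borel_measurable lborel" using m by simp
    show "AE x in lborel. norm ((indicator {a<..<b} x * avg u x)\<^sup>2) \<le> norm ((\<integral>y. (ext u (x, y))\<^sup>2 \<partial>lborel) / l)"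
      using slice_Cauchy_Schwarz[OF u]
    proof eventually_elim
      case (elim x)
      show ?case
      proof (cases "a < x \<and> x < b")
        case True
        then have lx: "l \<le> L x" "0 < L x" using l(2)[of x] L_pos[of x] by auto
        have "(avg u x)\<^sup>2 = (\<integral>y. ext u (x, y) \<partial>lborel)\<^sup>2 / (L x)\<^sup>2" by (simp add: avg_def power_divide)
        also have "\<dots> \<le> (L x * (\<integral>y. (ext u (x, y))\<^sup>2 \<partial>lborel)) / (L x)\<^sup>2"
          using elim True by (intro divide_right_mono) auto
        also have "\<dots> = (\<integral>y. (ext u (x, y))\<^sup>2 \<partial>lborel) / L x"
          using lx by (simp add: power2_eq_square)
        also have "\<dots> \<le> (\<integral>y. (ext u (x, y))\<^sup>2 \<partial>lborel) / l"
          using lx l(1) by (intro divide_left_mono) auto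
        finally show ?thesis using True l(1) by simp
      qed simp
    qed
  qed
  with m show ?thesis by (simp add: L2_on_iff_sq_integrable sq_integrable_def)
qed

lemma deviation_bound:
  assumes u: "H1_2 R u g1 g2" and \<theta>: "\<theta> \<in> sets borel" "\<theta> \<subseteq> R"
    and \<tau>: "\<And>x. a < x \<Longrightarrow> x < b \<Longrightarrow> (\<integral>y. indicator \<theta> (x, y) \<partial>lborel) \<le> \<tau>"
    and \<Lambda>: "\<And>x. a < x \<Longrightarrow> x < b \<Longrightarrow> L x \<le> \<Lambda>"
  shows "(\<integral>z. (indicator \<theta> z * (u z - avg u (fst z)))\<^sup>2 \<partial>lborel) \<le> \<tau> * \<Lambda> * (\<integral>z. (ext g2 z)\<^sup>2 \<partial>lborel)"
proof -
  have L2: "L2_on R u" "L2_on R g2" using u by (auto simp: H1_2_def)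
  have sqi: "sq_integrable lborel (\<lambda>z. ext u z - ext (\<lambda>z. avg u (fst z)) z)"
    using L2(1) cylinder_L2(1)[OF avg_L2[OF L2(1)]] unfolding L2_on_ext by (rule sq_integrable_diff)
  then have "sq_integrable lborel (\<lambda>z. indicator \<theta> z * (ext u z - ext (\<lambda>z. avg u (fst z)) z))"
    by (rule sq_integrable_bounded_mult[of _ _ _ 1])
      (use \<theta>(1) sq_integrable_measurable[OF sqi] in \<open>auto simp: indicator_def\<close>)
  moreover have eq: "indicator \<theta> z * (ext u z - ext (\<lambda>z. avg u (fst z)) z) = indicator \<theta> z * (ext u z - avg u (fst z))"
    "indicator \<theta> z * (u z - avg u (fst z)) = indicator \<theta> z * (ext u z - avg u (fst z))" for z
    using \<theta>(2) by (auto simp: ext_def indicator_def)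
  ultimately have I: "integrable (lborel \<Otimes>\<^sub>M lborel) (\<lambda>z. (indicator \<theta> z * (ext u z - avg u (fst z)))\<^sup>2)"
    unfolding lborel_prod sq_integrable_def by simp
  have dev: "AE x in lborel. a < x \<and> x < b \<longrightarrow>
    (\<integral>y. indicator \<theta> (x, y) * (ext u (x, y) - avg u x)\<^sup>2 \<partial>lborel) \<le> \<tau> * (L x * (\<integral>y. (ext g2 (x, y))\<^sup>2 \<partial>lborel))"
    by (rule slice_deviation_integral[OF u \<theta>]) (rule \<tau>)
  have J: "integrable (lborel \<Otimes>\<^sub>M lborel) (\<lambda>z. (ext g2 z)\<^sup>2)"
    using L2(2) unfolding lborel_prod L2_on_ext sq_integrable_def by simp
  have "(\<integral>z. (indicator \<theta> z * (u z - avg u (fst z)))\<^sup>2 \<partial>lborel)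
      = (\<integral>x. (\<integral>y. (indicator \<theta> (x, y) * (ext u (x, y) - avg u x))\<^sup>2 \<partial>lborel) \<partial>lborel)"
    unfolding eq(2) using lborel_pair.integral_fst'[OF I] by (simp add: lborel_prod)
  also have "\<dots> \<le> (\<integral>x. \<tau> * \<Lambda> * (\<integral>y. (ext g2 (x, y))\<^sup>2 \<partial>lborel) \<partial>lborel)"
  proof (rule integral_mono_AE)
    show "integrable lborel (\<lambda>x. \<integral>y. (indicator \<theta> (x, y) * (ext u (x, y) - avg u x))\<^sup>2 \<partial>lborel)"
      using lborel_pair.integrable_fst'[OF I] by simp
    show "integrable lborel (\<lambda>x. \<tau> * \<Lambda> * (\<integral>y. (ext g2 (x, y))\<^sup>2 \<partial>lborel))"
      using lborel_pair.integrable_fst'[OF J] by simp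
    show "AE x in lborel. (\<integral>y. (indicator \<theta> (x, y) * (ext u (x, y) - avg u x))\<^sup>2 \<partial>lborel)
        \<le> \<tau> * \<Lambda> * (\<integral>y. (ext g2 (x, y))\<^sup>2 \<partial>lborel)"
      using dev
    proof eventually_elim
      case (elim x)
      show ?case
      proof (cases "a < x \<and> x < b")
        case True
        have "0 \<le> (\<integral>y. indicator \<theta> (x, y) \<partial>lborel :: real)" by simp
        then have "0 \<le> \<tau>" using \<tau>[of x] True by linarith
        then have "\<tau> * (L x * (\<integral>y. (ext g2 (x, y))\<^sup>2 \<partial>lborel)) \<le> \<tau> * (\<Lambda> * (\<integral>y. (ext g2 (x, y))\<^sup>2 \<partial>lborel))"
          using \<Lambda>[of x] True by (intro mult_left_mono mult_right_mono) auto
        moreover have "(indicator \<theta> (x, y) * (ext u (x, y) - avg u x))\<^sup>2 = indicator \<theta> (x, y) * (ext u (x, y) - avg u x)\<^sup>2" for y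
          by (simp add: indicator_def)
        ultimately show ?thesis using elim True by (simp add: mult.assoc)
      next
        case False
        then have "(x, y) \<notin> \<theta>" "(x, y) \<notin> R" for y using \<theta>(2) by (auto simp: R_iff)
        then show ?thesis by (simp add: ext_eq_0)
      qed
    qed
  qed
  also have "\<dots> = \<tau> * \<Lambda> * (\<integral>z. (ext g2 z)\<^sup>2 \<partial>lborel)"
    using lborel_pair.integral_fst'[OF J] by (simp add: lborel_prod)
  finally show ?thesis .
qed

end

section \<open>The weak derivative of the slice average\<close>

lemma test_fun1_times_id:
  assumes "test_fun1 S B B'" shows "test_fun1 S (\<lambda>t. t * B t) (\<lambda>t. B t + t * B' t)"
proof -
  have sub: "closure {t. t * B t \<noteq> 0} \<subseteq> closure {t. B t \<noteq> 0}" by (rule closure_mono) auto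
  have K: "compact (closure {t. B t \<noteq> 0})" "closure {t. B t \<noteq> 0} \<subseteq> S" using assms by (auto simp: test_fun1_def)
  have "compact (closure {t. t * B t \<noteq> 0})"
    using bounded_subset[OF compact_imp_bounded[OF K(1)] sub] by (simp add: compact_eq_bounded_closed)
  moreover have "((\<lambda>t. t * B t) has_real_derivative B t + t * B' t) (at t)" for t
  proof -
    have "(B has_real_derivative B' t) (at t)" using assms by (simp add: test_fun1_def)
    then show ?thesis by (auto intro!: derivative_eq_intros)
  qed
  moreover have "continuous_on UNIV (\<lambda>t. B t + t * B' t)"
    by (intro continuous_intros test_fun1_continuous[OF assms])
  ultimately show ?thesis unfolding test_fun1_def using sub K(2) by blast
qed

context thin_domain
begin

text \<open>The average carries the factor 1 / L, so testing it with \<psi> amounts to testing u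
  with \<psi> / L. The quotient is C^1 on the line because \<psi> vanishes near a and b and beyond,
  where L is uncontrolled.\<close>

lemma test_fun1_divide_L:
  assumes \<psi>: "test_fun1 {a<..<b} \<psi> \<psi>'"
  shows "test_fun1 {a<..<b} (\<lambda>x. \<psi> x / L x) (\<lambda>x. \<psi>' x / L x - \<psi> x * L' x / (L x)\<^sup>2)"
proof -
  define K where "K = closure {x. \<psi> x \<noteq> 0}"
  let ?d = "\<lambda>x. \<psi>' x / L x - \<psi> x * L' x / (L x)\<^sup>2"
  have K: "compact K" "K \<subseteq> {a<..<b}" "closed K" using \<psi> by (auto simp: test_fun1_def K_def)
  have cover: "{a<..<b} \<union> - K = UNIV" using K by auto
  have z: "\<psi> x = 0" "\<psi>' x = 0" if "x \<in> - K" for x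
  proof -
    have "x \<notin> closure {x. \<psi> x \<noteq> 0}" using that by (simp add: K_def)
    then show "\<psi> x = 0" "\<psi>' x = 0" by (rule test_fun1_eq_0[OF \<psi>])+
  qed
  have L0: "L x \<noteq> 0" if "x \<in> {a<..<b}" for x using L_pos[of x] that by auto
  have c: "continuous_on {a<..<b} L" "continuous_on {a<..<b} L'"
    by (rule continuous_on_subset[OF L_cont], force) (rule continuous_on_subset[OF L'_cont], force)
  have "continuous_on ({a<..<b} \<union> - K) ?d"
  proof (rule continuous_on_open_Un)
    show "continuous_on {a<..<b} ?d"
      by (intro continuous_intros c test_fun1_continuous[OF \<psi>]) (use L0 in auto)
    show "continuous_on (- K) ?d"
      by (subst continuous_on_cong[where g="\<lambda>_. 0", OF refl]) (simp_all add: z)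
  qed (use K in auto)
  moreover have "((\<lambda>x. \<psi> x / L x) has_real_derivative ?d x) (at x)" for x
  proof (cases "x \<in> {a<..<b}")
    case True
    have "(\<psi> has_real_derivative \<psi>' x) (at x)" using \<psi> by (simp add: test_fun1_def)
    from DERIV_divide[OF this L_deriv] True L0[OF True]
    have "((\<lambda>x. \<psi> x / L x) has_real_derivative (\<psi>' x * L x - \<psi> x * L' x) / (L x * L x)) (at x)" by simp
    moreover have "(\<psi>' x * L x - \<psi> x * L' x) / (L x * L x) = ?d x"
      using L0[OF True] by (simp add: power2_eq_square field_simps)
    ultimately show ?thesis by simp
  next
    case False
    then have x: "x \<in> - K" using cover by blast
    have "((\<lambda>x. 0) has_real_derivative 0) (at x)" by simp
    then have "((\<lambda>x. \<psi> x / L x) has_real_derivative 0) (at x)"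
      by (rule has_field_derivative_transform_within_open[of _ _ _ "- K"]) (use x K in \<open>simp_all add: z open_Compl\<close>)
    moreover have "?d x = 0" unfolding z[OF x] by simp
    ultimately show ?thesis by simp
  qed
  moreover have sub: "closure {x. \<psi> x / L x \<noteq> 0} \<subseteq> K" unfolding K_def by (rule closure_mono) auto
  moreover have "compact (closure {x. \<psi> x / L x \<noteq> 0})"
    using bounded_subset[OF compact_imp_bounded[OF K(1)] sub] by (simp add: compact_eq_bounded_closed)
  ultimately show ?thesis unfolding test_fun1_def using K(2) by (simp add: cover)
qed

text \<open>The class of admissible coefficients: it contains continuous functions of x and of s as
  well as m, is closed under products and under division by L, and keeps products with extended L^2
  functions integrable. It looks at R only, since s and m are meaningful only over the base
  interval.\<close>

definition bcont :: "(real \<times> real \<Rightarrow> real) \<Rightarrow> bool" where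
  "bcont F \<longleftrightarrow> continuous_on R F \<and> (\<exists>C. \<forall>z\<in>R. \<bar>F z\<bar> \<le> C)"

lemma bcont_add:
  assumes "bcont F" "bcont G" shows "bcont (\<lambda>z. F z + G z)"
proof -
  obtain C D where F: "\<forall>z\<in>R. \<bar>F z\<bar> \<le> C" and G: "\<forall>z\<in>R. \<bar>G z\<bar> \<le> D"
    using assms unfolding bcont_def by blast
  have "\<bar>F z + G z\<bar> \<le> C + D" if "z \<in> R" for z
    using bspec[OF F that] bspec[OF G that] by linarith
  moreover have "continuous_on R (\<lambda>z. F z + G z)"
    using assms unfolding bcont_def by (intro continuous_intros) auto
  ultimately show ?thesis unfolding bcont_def by blast
qed

lemma bcont_mult:
  assumes "bcont F" "bcont G" shows "bcont (\<lambda>z. F z * G z)"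
proof -
  obtain C D where F: "\<forall>z\<in>R. \<bar>F z\<bar> \<le> C" and G: "\<forall>z\<in>R. \<bar>G z\<bar> \<le> D"
    using assms unfolding bcont_def by blast
  have "\<bar>F z * G z\<bar> \<le> C * D" if "z \<in> R" for z
    unfolding abs_mult using bspec[OF F that] bspec[OF G that] by (intro mult_mono) linarith+
  moreover have "continuous_on R (\<lambda>z. F z * G z)"
    using assms unfolding bcont_def by (intro continuous_intros) auto
  ultimately show ?thesis unfolding bcont_def by blast
qed

lemma bcont_minus: "bcont F \<Longrightarrow> bcont (\<lambda>z. - F z)"
  unfolding bcont_def by (auto intro!: continuous_intros)

lemma bcont_diff: "bcont F \<Longrightarrow> bcont G \<Longrightarrow> bcont (\<lambda>z. F z - G z)"
  using bcont_add[OF _ bcont_minus, of F G] by simp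

lemma bcont_fst:
  assumes "continuous_on {a..b} F" shows "bcont (\<lambda>z. F (fst z))"
proof -
  have "bounded (F ` {a..b})" using assms by (auto intro!: compact_imp_bounded compact_continuous_image)
  then obtain C where "\<And>x. x \<in> {a..b} \<Longrightarrow> \<bar>F x\<bar> \<le> C" unfolding bounded_real by (metis imageI)
  then have "\<forall>z\<in>R. \<bar>F (fst z)\<bar> \<le> C" by (auto simp: R_iff_s)
  moreover have "continuous_on R (\<lambda>z. F (fst z))" by (rule continuous_on_subset[OF fst_cont[OF assms] R_sub])
  ultimately show ?thesis by (auto simp: bcont_def)
qed

lemma bcont_s_comp:
  assumes "continuous_on UNIV F" shows "bcont (\<lambda>z. F (s z))"
proof -
  have "bounded (F ` {0..1})"
    using continuous_on_subset[OF assms] by (auto intro!: compact_imp_bounded compact_continuous_image)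
  then obtain C where "\<And>x. x \<in> {0..1} \<Longrightarrow> \<bar>F x\<bar> \<le> C" unfolding bounded_real by (metis imageI)
  then have "\<forall>z\<in>R. \<bar>F (s z)\<bar> \<le> C" by (auto simp: R_iff_s)
  moreover have "continuous_on R (\<lambda>z. F (s z))"
    by (rule continuous_on_compose2[OF assms continuous_on_subset[OF s_cont R_sub]]) simp
  ultimately show ?thesis by (auto simp: bcont_def)
qed

lemma bcont_m: "bcont m"
  unfolding m_def[abs_def]
  by (intro bcont_add bcont_mult bcont_fst p'_cont L'_cont bcont_s_comp[of "\<lambda>t. t"] continuous_on_id)

lemma bcont_divide_L:
  assumes "bcont F" shows "bcont (\<lambda>z. F z / L (fst z))"
proof -
  have "continuous_on {a..b} (\<lambda>x. inverse (L x))"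
    using L_pos by (intro continuous_intros L_cont) fastforce
  from bcont_mult[OF assms bcont_fst[OF this]] show ?thesis by (simp add: divide_inverse)
qed

lemma ext_bcont_integrable: "integrable lborel (ext u) \<Longrightarrow> bcont F \<Longrightarrow> integrable lborel (\<lambda>z. ext u z * F z)"
  unfolding bcont_def by (auto intro: ext_mult_integrable)

lemma L2_on_bcont_mult:
  assumes u: "L2_on R u" and F: "bcont F" shows "L2_on R (\<lambda>z. F z * u z)"
proof -
  obtain C where C: "\<And>z. z \<in> R \<Longrightarrow> \<bar>F z\<bar> \<le> C" using F by (auto simp: bcont_def)
  have "(\<lambda>z. indicator R z *\<^sub>R F z) \<in> borel_measurable borel"
    using F by (intro borel_measurable_continuous_on_indicator) (auto simp: bcont_def)
  then have "(\<lambda>z. (indicator R z *\<^sub>R F z) * ext u z) \<in> borel_measurable lborel"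
    using u by (auto simp: L2_on_ext sq_integrable_def)
  moreover have "(\<lambda>z. (indicator R z *\<^sub>R F z) * ext u z) = ext (\<lambda>z. F z * u z)"
    by (auto simp: ext_def fun_eq_iff indicator_def)
  ultimately have m: "ext (\<lambda>z. F z * u z) \<in> borel_measurable lborel" by simp
  have bd: "\<bar>ext (\<lambda>z. F z * u z) z\<bar> \<le> C * \<bar>ext u z\<bar>" for z
    using C[of z] by (cases "z \<in> R") (auto simp: ext_def abs_mult mult_right_mono)
  show ?thesis
    using u unfolding L2_on_ext by (rule sq_integrable_bounded_mult[OF _ m bd])
qed

lemma L2_on_add: "L2_on R u \<Longrightarrow> L2_on R v \<Longrightarrow> L2_on R (\<lambda>z. u z + v z)"
  using sq_integrable_add[of lborel "ext u" "ext v"]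
  by (simp add: L2_on_ext ext_def[abs_def] distrib_left)

lemma L2_on_diff: "L2_on R u \<Longrightarrow> L2_on R v \<Longrightarrow> L2_on R (\<lambda>z. u z - v z)"
  using sq_integrable_diff[of lborel "ext u" "ext v"]
  by (simp add: L2_on_ext ext_def[abs_def] right_diff_distrib)

text \<open>
  The field \<open>(1, m)\<close> annihilates \<open>s\<close>, so the cutoff \<open>\<kappa> \<circ> s\<close> away from the boundary produces no error term.
\<close>

lemma transported_weak_derivative_cutoff:
  assumes u: "H1_2 R u g1 g2" and \<psi>: "test_fun1 {a<..<b} \<psi> \<psi>'" and \<kappa>: "test_fun1 {0<..<1} \<kappa> \<kappa>'"
  shows "(\<integral>z. ext u z * (\<kappa> (s z) * (\<psi>' (fst z) / L (fst z))) \<partial>lborel)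
     = - (\<integral>z. ext (\<lambda>z. g1 z + m z * g2 z) z * (\<kappa> (s z) * (\<psi> (fst z) / L (fst z))) \<partial>lborel)"
proof -
  define \<alpha> where "\<alpha> x = \<psi> x / L x" for x
  define \<alpha>' where "\<alpha>' x = \<psi>' x / L x - \<psi> x * L' x / (L x)\<^sup>2" for x
  have \<alpha>: "test_fun1 {a<..<b} \<alpha> \<alpha>'"
    unfolding \<alpha>_def[abs_def] \<alpha>'_def[abs_def] by (rule test_fun1_divide_L[OF \<psi>])
  have L2: "L2_on R u" "L2_on R g1" "L2_on R g2" using u by (auto simp: H1_2_def)
  note i = ext_integrable[OF L2(1)] ext_integrable[OF L2(2)] ext_integrable[OF L2(3)]
  note bc = bcont_s_comp[OF test_fun1_continuous(1)[OF \<kappa>]] bcont_s_comp[OF test_fun1_continuous(2)[OF \<kappa>]]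
    bcont_fst[OF test_fun1_continuous(1)[OF \<alpha>]] bcont_fst[OF test_fun1_continuous(2)[OF \<alpha>]]
    bcont_m bcont_divide_L bcont_mult bcont_diff bcont_fst[OF L'_cont] bcont_fst[OF p'_cont]
  define X where "X z = ext u z * (\<alpha>' (fst z) * \<kappa> (s z) - \<alpha> (fst z) * (\<kappa>' (s z) * (m z / L (fst z))))" for z
  define Y where "Y z = ext g1 z * (\<alpha> (fst z) * \<kappa> (s z))" for z
  \<comment> \<open>The y-derivative of m \<kappa>(s) is m \<kappa>'(s) / L + \<kappa>(s) L' / L, so
    \<open>E\<close> is the integrand of the vertical identity formally tested with m
    \<kappa>(s).\<close>
  define E where "E z = ext u z * (\<kappa>' (s z) * (m z / L (fst z))) + ext g2 z * (m z * \<kappa> (s z))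
      + ext u z * (\<kappa> (s z) * (L' (fst z) / L (fst z)))" for z
  have X: "integrable lborel X" and Y: "integrable lborel Y"
    unfolding X_def Y_def by (intro ext_bcont_integrable i bc)+
  have E: "integrable lborel E"
    unfolding E_def by (intro Bochner_Integration.integrable_add ext_bcont_integrable i bc)
  have E\<alpha>: "integrable lborel (\<lambda>z. E z * \<alpha> (fst z))"
  proof -
    have "integrable lborel (\<lambda>z. ext u z * (\<kappa>' (s z) * (m z / L (fst z)) * \<alpha> (fst z))
        + ext g2 z * (m z * \<kappa> (s z) * \<alpha> (fst z)) + ext u z * (\<kappa> (s z) * (L' (fst z) / L (fst z)) * \<alpha> (fst z)))"
      by (intro Bochner_Integration.integrable_add ext_bcont_integrable i bc)
    then show ?thesis by (simp add: E_def algebra_simps)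
  qed
  have XY: "(\<integral>z. X z \<partial>lborel) = - (\<integral>z. Y z \<partial>lborel)"
    using u product_test_fun2[OF \<alpha> \<kappa>] unfolding H1_2_def set_integral_ext X_def Y_def by blast
  \<comment> \<open>m = p' + s L' is affine in s with coefficients constant on a slice. The formal
    identity is therefore p' x times the one for \<kappa>(t) plus L' x times the one for t
    \<kappa>(t), and both of these have genuine test functions.\<close>
  have E0: "AE x in lborel. (\<integral>y. E (x, y) \<partial>lborel) = 0"
    using slice_weak_derivative[OF u \<kappa>] slice_weak_derivative[OF u test_fun1_times_id[OF \<kappa>]]
  proof eventually_elim
    case (elim x)
    show ?case
    proof (cases "a < x \<and> x < b")
      case True
      define e1 where "e1 y = ext u (x, y) * (\<kappa>' (s (x, y)) / L x)" for y
      define e2 where "e2 y = ext g2 (x, y) * \<kappa> (s (x, y))" for y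
      define f1 where "f1 y = ext u (x, y) * ((\<kappa> (s (x, y)) + s (x, y) * \<kappa>' (s (x, y))) / L x)" for y
      define f2 where "f2 y = ext g2 (x, y) * (s (x, y) * \<kappa> (s (x, y)))" for y
      have ef: "integrable lborel e1" "integrable lborel e2" "(\<integral>y. e1 y \<partial>lborel) = - (\<integral>y. e2 y \<partial>lborel)"
        "integrable lborel f1" "integrable lborel f2" "(\<integral>y. f1 y \<partial>lborel) = - (\<integral>y. f2 y \<partial>lborel)"
        using elim True unfolding e1_def[abs_def] e2_def[abs_def] f1_def[abs_def] f2_def[abs_def] by auto
      have "E (x, y) = p' x * (e1 y + e2 y) + L' x * (f1 y + f2 y)" for y
        unfolding E_def e1_def e2_def f1_def f2_def m_def by (simp add: algebra_simps add_divide_distrib)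
      then show ?thesis using ef by simp
    next
      case False
      then have "(x, y) \<notin> R" for y by (auto simp: R_iff)
      then have "E (x, y) = 0" for y by (simp add: E_def ext_eq_0)
      then show ?thesis by simp
    qed
  qed
  have "(\<integral>z. E z * \<alpha> (fst z) \<partial>lborel) = (\<integral>x. (\<integral>y. E (x, y) * \<alpha> x \<partial>lborel) \<partial>lborel)"
    using lborel_pair.integral_fst'[of "\<lambda>z. E z * \<alpha> (fst z)"] E\<alpha> by (simp add: lborel_prod)
  also have "\<dots> = (\<integral>x. (\<integral>y. E (x, y) \<partial>lborel) * \<alpha> x \<partial>lborel)" by simp
  also have "\<dots> = 0"
    by (rule integral_eq_zero_AE) (use E0 in auto)
  finally have E\<alpha>0: "(\<integral>z. E z * \<alpha> (fst z) \<partial>lborel) = 0" .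
  define P where "P z = ext u z * (\<kappa> (s z) * (\<psi>' (fst z) / L (fst z)))" for z
  define Q where "Q z = ext (\<lambda>z. g1 z + m z * g2 z) z * (\<kappa> (s z) * (\<psi> (fst z) / L (fst z)))" for z
  have P: "integrable lborel P"
    unfolding P_def by (intro ext_bcont_integrable i bc bcont_fst test_fun1_continuous(2)[OF \<psi>])
  have Q: "integrable lborel Q"
    unfolding Q_def by (intro ext_bcont_integrable ext_integrable L2_on_add L2_on_bcont_mult L2 bc
      bcont_fst test_fun1_continuous(1)[OF \<psi>])
  \<comment> \<open>The \<kappa>' terms of \<open>X\<close> and \<open>E\<close> cancel, and the
    summand -\<psi> L' / L^2 of \<alpha>' cancels against the L' term of \<open>E\<close>, leaving
    \<psi>' / L.\<close>
  have PQ: "P z + Q z = (X z + Y z) + E z * \<alpha> (fst z)" for z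
  proof (cases "z \<in> R")
    case True
    then have "L (fst z) \<noteq> 0" using L_nonzero R_sub by blast
    then show ?thesis
      unfolding P_def Q_def X_def Y_def E_def \<alpha>_def \<alpha>'_def using True
      by (simp add: ext_def power2_eq_square field_simps)
  qed (simp add: P_def Q_def X_def Y_def E_def ext_eq_0)
  have "(\<integral>z. P z \<partial>lborel) + (\<integral>z. Q z \<partial>lborel) = (\<integral>z. P z + Q z \<partial>lborel)" using P Q by simp
  also have "\<dots> = (\<integral>z. X z \<partial>lborel) + (\<integral>z. Y z \<partial>lborel) + (\<integral>z. E z * \<alpha> (fst z) \<partial>lborel)"
    unfolding PQ using X Y E\<alpha> by simp
  also have "\<dots> = 0" using XY E\<alpha>0 by simp
  finally show ?thesis unfolding P_def Q_def by simp
qed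

lemma cutoff_limit:
  assumes u: "L2_on R u" and F: "bcont F"
    and lim: "\<And>t. (\<lambda>n. bump (rn n) (tn n) n t) \<longlonglongrightarrow> indicator {0<..<1} t" and less: "\<And>n. rn n < tn n"
  shows "(\<lambda>n. \<integral>z. ext u z * (bump (rn n) (tn n) n (s z) * F z) \<partial>lborel) \<longlonglongrightarrow> (\<integral>z. ext u z * F z \<partial>lborel)"
proof (rule integral_dominated_convergence[where w="\<lambda>z. \<bar>ext u z * F z\<bar>"])
  have i: "integrable lborel (\<lambda>z. ext u z * F z)" by (rule ext_bcont_integrable[OF ext_integrable[OF u] F])
  then show "integrable lborel (\<lambda>z. \<bar>ext u z * F z\<bar>)" by (rule integrable_abs)
  show "(\<lambda>z. ext u z * F z) \<in> borel_measurable lborel" using i by auto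
  show "(\<lambda>z. ext u z * (bump (rn n) (tn n) n (s z) * F z)) \<in> borel_measurable lborel" for n
    using ext_bcont_integrable[OF ext_integrable[OF u] bcont_mult[OF bcont_s_comp[OF continuous_on_bump[OF less]] F]] by auto
  show "AE z in lborel. (\<lambda>n. ext u z * (bump (rn n) (tn n) n (s z) * F z)) \<longlonglongrightarrow> ext u z * F z"
  proof (rule AE_I2)
    fix z
    show "(\<lambda>n. ext u z * (bump (rn n) (tn n) n (s z) * F z)) \<longlonglongrightarrow> ext u z * F z"
    proof (cases "z \<in> R")
      case True
      have "(\<lambda>n. ext u z * (bump (rn n) (tn n) n (s z) * F z)) \<longlonglongrightarrow> ext u z * (indicator {0<..<1} (s z) * F z)"
        by (intro tendsto_intros lim)
      then show ?thesis using True by (simp add: R_iff_s)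
    qed (simp add: ext_eq_0)
  qed
  show "AE z in lborel. norm (ext u z * (bump (rn n) (tn n) n (s z) * F z)) \<le> \<bar>ext u z * F z\<bar>" for n
    by (rule AE_I2) (auto simp: abs_mult intro!: mult_left_mono mult_left_le_one_le abs_bump_le)
qed

text \<open>The identity with cutoff contains \<kappa> but not its derivative. Cutoffs that stay
  between 0 and 1 and converge to 1 on R can thus be removed by dominated convergence, however steep
  they become near the boundary.\<close>

lemma transported_weak_derivative:
  assumes u: "H1_2 R u g1 g2" and \<psi>: "test_fun1 {a<..<b} \<psi> \<psi>'"
  shows "(\<integral>z. ext u z * (\<psi>' (fst z) / L (fst z)) \<partial>lborel)
     = - (\<integral>z. ext (\<lambda>z. g1 z + m z * g2 z) z * (\<psi> (fst z) / L (fst z)) \<partial>lborel)"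
proof -
  obtain rn tn where "\<And>n. rn n \<in> \<rat>" "\<And>n. tn n \<in> \<rat>"
    and rt: "\<And>n. 0 < rn n" "\<And>n. rn n < tn n" "\<And>n. tn n < 1"
    and lim: "\<And>x. (\<lambda>n. bump (rn n) (tn n) n x) \<longlonglongrightarrow> indicator {0<..<1} x"
    using bump_exhaustion[OF zero_less_one] by blast
  have L2: "L2_on R u" "L2_on R g1" "L2_on R g2" using u by (auto simp: H1_2_def)
  have \<kappa>: "test_fun1 {0<..<1} (bump (rn n) (tn n) n) (bump' (rn n) (tn n) n)" for n
    using rt(1)[of n] rt(3)[of n] by (intro test_fun1_bump rt) auto
  have 1: "(\<lambda>n. \<integral>z. ext u z * (bump (rn n) (tn n) n (s z) * (\<psi>' (fst z) / L (fst z))) \<partial>lborel)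
      \<longlonglongrightarrow> (\<integral>z. ext u z * (\<psi>' (fst z) / L (fst z)) \<partial>lborel)"
    by (rule cutoff_limit[OF L2(1) _ lim rt(2)]) (intro bcont_divide_L bcont_fst test_fun1_continuous(2)[OF \<psi>])
  have 2: "(\<lambda>n. \<integral>z. ext (\<lambda>z. g1 z + m z * g2 z) z * (bump (rn n) (tn n) n (s z) * (\<psi> (fst z) / L (fst z))) \<partial>lborel)
      \<longlonglongrightarrow> (\<integral>z. ext (\<lambda>z. g1 z + m z * g2 z) z * (\<psi> (fst z) / L (fst z)) \<partial>lborel)"
    by (rule cutoff_limit[OF _ _ lim rt(2)])
      (intro L2_on_add L2_on_bcont_mult bcont_m L2 bcont_divide_L bcont_fst test_fun1_continuous(1)[OF \<psi>])+
  show ?thesis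
    using LIMSEQ_unique[OF 1 tendsto_minus[OF 2, folded transported_weak_derivative_cutoff[OF u \<psi> \<kappa>]]] .
qed

lemma avg_integral:
  assumes u: "integrable lborel (\<lambda>z. ext u z * (\<psi> (fst z) / L (fst z)))"
  shows "(\<integral>z. ext u z * (\<psi> (fst z) / L (fst z)) \<partial>lborel) = (\<integral>x\<in>{a<..<b}. avg u x * \<psi> x \<partial>lborel)"
proof -
  have "(\<integral>z. ext u z * (\<psi> (fst z) / L (fst z)) \<partial>lborel) = (\<integral>x. (\<integral>y. ext u (x, y) * (\<psi> x / L x) \<partial>lborel) \<partial>lborel)"
    using lborel_pair.integral_fst'[of "\<lambda>z. ext u z * (\<psi> (fst z) / L (fst z))"] u by (simp add: lborel_prod)
  also have "\<dots> = (\<integral>x\<in>{a<..<b}. avg u x * \<psi> x \<partial>lborel)"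
    unfolding set_lebesgue_integral_def
  proof (rule Bochner_Integration.integral_cong[OF refl])
    fix x
    show "(\<integral>y. ext u (x, y) * (\<psi> x / L x) \<partial>lborel) = indicator {a<..<b} x *\<^sub>R (avg u x * \<psi> x)"
    proof (cases "x \<in> {a<..<b}")
      case False
      then have "(x, y) \<notin> R" for y by (auto simp: R_iff)
      then show ?thesis using False by (simp add: ext_eq_0)
    qed (simp add: avg_def)
  qed
  finally show ?thesis .
qed

lemma avg_H1:
  assumes u: "H1_2 R u g1 g2"
  shows "H1_1 {a<..<b} (avg u) (avg (\<lambda>z. g1 z + m z * g2 z))"
  unfolding H1_1_def
proof (intro conjI allI impI)
  have L2: "L2_on R u" "L2_on R g1" "L2_on R g2" using u by (auto simp: H1_2_def)
  then have L2m: "L2_on R (\<lambda>z. g1 z + m z * g2 z)" by (intro L2_on_add L2_on_bcont_mult bcont_m)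
  show "L2_on {a<..<b} (avg u)" "L2_on {a<..<b} (avg (\<lambda>z. g1 z + m z * g2 z))"
    using L2 L2m by (auto intro: avg_L2)
  fix \<psi> \<psi>' assume \<psi>: "test_fun1 {a<..<b} \<psi> \<psi>'"
  show "(\<integral>x\<in>{a<..<b}. avg u x * \<psi>' x \<partial>lborel) = - (\<integral>x\<in>{a<..<b}. avg (\<lambda>z. g1 z + m z * g2 z) x * \<psi> x \<partial>lborel)"
    using transported_weak_derivative[OF u \<psi>]
    by (subst (asm) (1 2) avg_integral)
      (intro ext_bcont_integrable ext_integrable L2 L2m bcont_divide_L bcont_fst test_fun1_continuous[OF \<psi>])+
qed

end

section \<open>Functions of the horizontal variable\<close>

lemma test_fun2_eq_0:
  assumes T: "test_fun2 S T Tx Ty" and z: "z \<notin> S"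
  shows "T z = 0" "Tx z = 0" "Ty z = 0"
proof -
  define U where "U = - closure {x. T x \<noteq> 0}"
  have U: "open U" "z \<in> U" unfolding U_def using T z by (auto simp: test_fun2_def)
  have zero: "T y = 0" if "y \<in> U" for y
    using that closure_subset[of "{x. T x \<noteq> 0}"] unfolding U_def by blast
  show "T z = 0" by (rule zero) (rule U)
  have "(T has_derivative (\<lambda>h. Tx z * fst h + Ty z * snd h)) (at z)" using T unfolding test_fun2_def by blast
  then have "((\<lambda>z. 0) has_derivative (\<lambda>h. Tx z * fst h + Ty z * snd h)) (at z)"
    by (rule has_derivative_transform_within_open[OF _ U]) (rule zero)
  then have "(\<lambda>h. Tx z * fst h + Ty z * snd h) = (\<lambda>h. 0)"
    by (rule has_derivative_unique) (rule has_derivative_const)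
  from fun_cong[OF this, of "(1, 0)"] fun_cong[OF this, of "(0, 1)"]
  show "Tx z = 0" "Ty z = 0" by auto
qed

lemma test_fun2_continuous:
  assumes "test_fun2 S T Tx Ty" shows "continuous_on A T" "continuous_on A Tx" "continuous_on A Ty"
proof -
  have "(T has_derivative (\<lambda>h. Tx z * fst h + Ty z * snd h)) (at z within A)" for z
    using assms has_derivative_at_withinI unfolding test_fun2_def by blast
  then show "continuous_on A T" by (auto simp: continuous_on_eq_continuous_within intro: has_derivative_continuous)
  show "continuous_on A Tx" "continuous_on A Ty"
    using assms continuous_on_subset by (auto simp: test_fun2_def)
qed

text \<open>The same compact interval for all x turns the slice integral into an integral over a
  fixed box, the setting of differentiation under the integral sign.\<close>

lemma test_fun2_slice_integral:
  fixes T :: "real \<times> real \<Rightarrow> real"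
  assumes T: "continuous_on UNIV T" and 0: "\<And>x y. y \<notin> {c..d} \<Longrightarrow> T (x, y) = 0"
  shows "(\<integral>y. T (x, y) \<partial>lborel) = integral (cbox c d) (\<lambda>y. T (x, y))"
proof -
  have "continuous_on {c..d} (\<lambda>y. T (x, y))"
    by (rule continuous_on_compose2[OF T]) (auto intro: continuous_intros)
  then have i: "set_integrable lborel {c..d} (\<lambda>y. T (x, y))" by (rule borel_integrable_atLeastAtMost')
  have "(\<integral>y. T (x, y) \<partial>lborel) = (\<integral>y\<in>{c..d}. T (x, y) \<partial>lborel)"
    unfolding set_lebesgue_integral_def
    by (rule Bochner_Integration.integral_cong) (use 0 in \<open>auto simp: indicator_def\<close>)
  also have "\<dots> = integral (cbox c d) (\<lambda>y. T (x, y))"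
    using set_borel_integral_eq_integral(2)[OF i] by simp
  finally show ?thesis .
qed

context thin_domain
begin

lemma R_vertical_bounds: "\<exists>c d. c < d \<and> (\<forall>z\<in>R. c < snd z \<and> snd z < d)"
proof -
  have "bounded (p ` {a..b})" "bounded (q ` {a..b})"
    using p_cont q_cont by (auto intro!: compact_imp_bounded compact_continuous_image)
  then obtain P Q where PQ: "\<And>x. x \<in> {a..b} \<Longrightarrow> \<bar>p x\<bar> \<le> P" "\<And>x. x \<in> {a..b} \<Longrightarrow> \<bar>q x\<bar> \<le> Q"
    unfolding bounded_real by (metis imageI)
  have "- P < snd z \<and> snd z < Q" if "z \<in> R" for z
    using that PQ[of "fst z"] by (cases z) (auto simp: R_def)
  moreover have "- P < Q" using PQ[of a] p_less_q[of a] ab by auto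
  ultimately show ?thesis by blast
qed

text \<open>Integrating out y is dual to extending a function of x constantly in y. Since T vanishes
  outside R, one interval [c, d] contains the relevant part of all slices, so neither the Leibniz
  rule nor the integral of Ty leaves a boundary term.\<close>

lemma test_fun1_slice_integral:
  assumes T: "test_fun2 R T Tx Ty"
  shows "test_fun1 {a<..<b} (\<lambda>x. \<integral>y. T (x, y) \<partial>lborel) (\<lambda>x. \<integral>y. Tx (x, y) \<partial>lborel)"
    and "(\<integral>y. Ty (x, y) \<partial>lborel) = 0"
proof -
  obtain c d where cd: "c < d" "\<forall>z\<in>R. c < snd z \<and> snd z < d" using R_vertical_bounds by blast
  have out: "(x, y) \<notin> R" if "y \<notin> {c<..<d}" for x y using cd(2) that by force
  have z: "T (x, y) = 0" "Tx (x, y) = 0" "Ty (x, y) = 0" if "y \<notin> {c<..<d}" for x y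
    by (rule test_fun2_eq_0[OF T out[OF that]])+
  note cont = test_fun2_continuous[OF T]
  have eqT: "(\<integral>y. T (x, y) \<partial>lborel) = integral (cbox c d) (\<lambda>y. T (x, y))" for x
    by (rule test_fun2_slice_integral[OF cont(1)]) (auto intro: z)
  have eqTx: "(\<integral>y. Tx (x, y) \<partial>lborel) = integral (cbox c d) (\<lambda>y. Tx (x, y))" for x
    by (rule test_fun2_slice_integral[OF cont(2)]) (auto intro: z)
  have dT: "(T has_derivative (\<lambda>h. Tx w * fst h + Ty w * snd h)) (at w)" for w
    using T unfolding test_fun2_def by blast
  have dx: "((\<lambda>x. T (x, y)) has_field_derivative Tx (x, y)) (at x within UNIV)" for x y
  proof -
    have "((\<lambda>x. (x, y)) has_derivative (\<lambda>h. (h, 0))) (at x)"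
      by (intro has_derivative_Pair has_derivative_ident has_derivative_const)
    from has_derivative_compose[OF this dT] show ?thesis by (simp add: has_field_derivative_def)
  qed
  have dy: "((\<lambda>y. T (x, y)) has_field_derivative Ty (x, y)) (at y)" for x y
  proof -
    have "((\<lambda>y. (x, y)) has_derivative (\<lambda>h. (0, h))) (at y)"
      by (intro has_derivative_Pair has_derivative_ident has_derivative_const)
    from has_derivative_compose[OF this dT] show ?thesis by (simp add: has_field_derivative_def)
  qed
  have deriv: "((\<lambda>x. \<integral>y. T (x, y) \<partial>lborel) has_real_derivative (\<integral>y. Tx (x, y) \<partial>lborel)) (at x)" for x
    unfolding eqT eqTx
  proof (rule leibniz_rule_field_derivative[where U=UNIV and fx="\<lambda>x y. Tx (x, y)"])
    show "(\<lambda>y. T (x, y)) integrable_on cbox c d" for x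
      by (rule integrable_continuous, rule continuous_on_compose2[OF cont(1)[of UNIV]]) (auto intro: continuous_intros)
    show "continuous_on (UNIV \<times> cbox c d) (\<lambda>(x, t). Tx (x, t))" using cont(2) by simp
  qed (use dx in auto)
  have cont': "continuous_on UNIV (\<lambda>x. \<integral>y. Tx (x, y) \<partial>lborel)"
    unfolding eqTx by (rule integral_continuous_on_param) (use cont(2) in simp)
  let ?K = "closure {z. T z \<noteq> 0}"
  have K: "compact ?K" "?K \<subseteq> R" using T by (auto simp: test_fun2_def)
  have cK: "compact (fst ` ?K)" by (rule compact_continuous_image[OF continuous_on_fst[OF continuous_on_id] K(1)])
  have "{x. (\<integral>y. T (x, y) \<partial>lborel) \<noteq> 0} \<subseteq> fst ` ?K"
  proof
    fix x assume "x \<in> {x. (\<integral>y. T (x, y) \<partial>lborel) \<noteq> 0}"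
    then have "(\<lambda>y. T (x, y)) \<noteq> (\<lambda>y. 0)" by auto
    then obtain y where "T (x, y) \<noteq> 0" by auto
    then have "(x, y) \<in> ?K" using closure_subset[of "{z. T z \<noteq> 0}"] by auto
    then show "x \<in> fst ` ?K" by force
  qed
  then have sub: "closure {x. (\<integral>y. T (x, y) \<partial>lborel) \<noteq> 0} \<subseteq> fst ` ?K"
    by (intro closure_minimal compact_imp_closed cK)
  have com: "compact (closure {x. (\<integral>y. T (x, y) \<partial>lborel) \<noteq> 0})"
    using bounded_subset[OF compact_imp_bounded[OF cK] sub] by (simp add: compact_eq_bounded_closed)
  have "fst ` ?K \<subseteq> {a<..<b}" using K(2) R_sub by force
  then show "test_fun1 {a<..<b} (\<lambda>x. \<integral>y. T (x, y) \<partial>lborel) (\<lambda>x. \<integral>y. Tx (x, y) \<partial>lborel)"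
    unfolding test_fun1_def using cont' deriv com sub by blast
  have "(\<integral>y. Ty (x, y) \<partial>lborel) = (\<integral>y. indicator {c..d} y *\<^sub>R Ty (x, y) \<partial>lborel)"
  proof (rule Bochner_Integration.integral_cong[OF refl])
    show "Ty (x, y) = indicator {c..d} y *\<^sub>R Ty (x, y)" for y
      using z(3)[of y x] by (cases "y \<in> {c..d}") auto
  qed
  also have "\<dots> = T (x, d) - T (x, c)"
  proof (rule integral_FTC_atLeastAtMost)
    show "continuous_on {c..d} (\<lambda>y. Ty (x, y))"
      by (rule continuous_on_compose2[OF cont(3)[of UNIV]]) (auto intro: continuous_intros)
    show "((\<lambda>y. T (x, y)) has_vector_derivative Ty (x, y)) (at y within {c..d})" for y
      using dy by (auto simp flip: has_real_derivative_iff_has_vector_derivative intro: has_field_derivative_at_within)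
  qed (use cd in simp)
  also have "\<dots> = 0" using z(1)[of d x] z(1)[of c x] by simp
  finally show "(\<integral>y. Ty (x, y) \<partial>lborel) = 0" .
qed

lemma bcont_continuous_bounded_support:
  assumes F: "continuous_on UNIV F" and S: "compact S" "\<And>z. z \<notin> S \<Longrightarrow> F z = 0"
  shows "bcont F"
proof -
  have "bounded (F ` S)" using F S(1) continuous_on_subset by (blast intro: compact_imp_bounded compact_continuous_image)
  then obtain C where C: "\<And>x. x \<in> S \<Longrightarrow> \<bar>F x\<bar> \<le> C" unfolding bounded_real by (metis imageI)
  have "\<bar>F z\<bar> \<le> \<bar>C\<bar>" for z using C[of z] S(2)[of z] by (cases "z \<in> S") auto
  then show ?thesis using F continuous_on_subset unfolding bcont_def by blast
qed

lemma cylinder_Fubini: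
  assumes v: "integrable lborel (ext (\<lambda>z. v (fst z)))" and F: "bcont F" and 0: "\<And>z. z \<notin> R \<Longrightarrow> F z = 0"
  shows "(\<integral>z\<in>R. v (fst z) * F z \<partial>lborel) = (\<integral>x\<in>{a<..<b}. v x * (\<integral>y. F (x, y) \<partial>lborel) \<partial>lborel)"
proof -
  have I: "integrable (lborel \<Otimes>\<^sub>M lborel) (\<lambda>z. ext (\<lambda>z. v (fst z)) z * F z)"
    unfolding lborel_prod by (rule ext_bcont_integrable[OF v F])
  have "(\<integral>z\<in>R. v (fst z) * F z \<partial>lborel) = (\<integral>x. (\<integral>y. ext (\<lambda>z. v (fst z)) (x, y) * F (x, y) \<partial>lborel) \<partial>lborel)"
    using lborel_pair.integral_fst'[OF I] by (simp add: set_integral_ext lborel_prod)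
  also have "\<dots> = (\<integral>x\<in>{a<..<b}. v x * (\<integral>y. F (x, y) \<partial>lborel) \<partial>lborel)"
    unfolding set_lebesgue_integral_def
  proof (rule Bochner_Integration.integral_cong[OF refl])
    fix x
    have "ext (\<lambda>z. v (fst z)) (x, y) * F (x, y) = (indicator {a<..<b} x * v x) * F (x, y)" for y
      using 0[of "(x, y)"] by (cases "(x, y) \<in> R") (auto simp: ext_def R_iff)
    then have "(\<integral>y. ext (\<lambda>z. v (fst z)) (x, y) * F (x, y) \<partial>lborel)
        = (\<integral>y. (indicator {a<..<b} x * v x) * F (x, y) \<partial>lborel)" by (simp only:)
    then show "(\<integral>y. ext (\<lambda>z. v (fst z)) (x, y) * F (x, y) \<partial>lborel)
        = indicator {a<..<b} x *\<^sub>R (v x * (\<integral>y. F (x, y) \<partial>lborel))" by simp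
  qed
  finally show ?thesis .
qed

text \<open>By Fubini, testing the extension with T is testing v with the slice integral of T. A
  vertical derivative of T has slice integral zero, which accounts for the zero in the last
  argument.\<close>

lemma cylinder_H1:
  assumes v: "H1_1 {a<..<b} v v'"
  shows "H1_2 R (\<lambda>z. v (fst z)) (\<lambda>z. v' (fst z)) (\<lambda>z. 0)"
proof -
  have L2: "L2_on {a<..<b} v" "L2_on {a<..<b} v'" using v by (auto simp: H1_1_def)
  note L2R = cylinder_L2(1)[OF L2(1)] cylinder_L2(1)[OF L2(2)]
  show ?thesis
    unfolding H1_2_def
  proof (intro conjI allI impI L2R)
    show "L2_on R (\<lambda>z. 0)" by (simp add: L2_on_def set_borel_measurable_def set_integrable_def)
    fix T Tx Ty assume T: "test_fun2 R T Tx Ty"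
    have K: "compact (closure {z. T z \<noteq> 0})" using T by (simp add: test_fun2_def)
    \<comment> \<open>T is regarded as a test function on its own support, so that
      \<open>test_fun2_eq_0\<close> gives the vanishing of T and its derivatives outside a compact
      set.\<close>
    have ff: "test_fun2 (closure {z. T z \<noteq> 0}) T Tx Ty" using T by (simp add: test_fun2_def)
    have bc: "bcont T" "bcont Tx" "bcont Ty"
      by (rule bcont_continuous_bounded_support[OF test_fun2_continuous(1)[OF T] K], erule test_fun2_eq_0[OF ff],
        rule bcont_continuous_bounded_support[OF test_fun2_continuous(2)[OF T] K], erule test_fun2_eq_0[OF ff],
        rule bcont_continuous_bounded_support[OF test_fun2_continuous(3)[OF T] K], erule test_fun2_eq_0[OF ff])
    note i = ext_integrable[OF L2R(1)] ext_integrable[OF L2R(2)]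
    have fub: "(\<integral>z\<in>R. v (fst z) * Tx z \<partial>lborel) = (\<integral>x\<in>{a<..<b}. v x * (\<integral>y. Tx (x, y) \<partial>lborel) \<partial>lborel)"
      "(\<integral>z\<in>R. v (fst z) * Ty z \<partial>lborel) = (\<integral>x\<in>{a<..<b}. v x * (\<integral>y. Ty (x, y) \<partial>lborel) \<partial>lborel)"
      "(\<integral>z\<in>R. v' (fst z) * T z \<partial>lborel) = (\<integral>x\<in>{a<..<b}. v' x * (\<integral>y. T (x, y) \<partial>lborel) \<partial>lborel)"
      by (rule cylinder_Fubini[OF i(1) bc(2)], erule test_fun2_eq_0[OF T],
        rule cylinder_Fubini[OF i(1) bc(3)], erule test_fun2_eq_0[OF T],
        rule cylinder_Fubini[OF i(2) bc(1)], erule test_fun2_eq_0[OF T])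
    show "(\<integral>z\<in>R. v (fst z) * Tx z \<partial>lborel) = - (\<integral>z\<in>R. v' (fst z) * T z \<partial>lborel)"
      unfolding fub using v test_fun1_slice_integral(1)[OF T] unfolding H1_1_def by blast
    show "(\<integral>z\<in>R. v (fst z) * Ty z \<partial>lborel) = - (\<integral>z\<in>R. 0 * T z \<partial>lborel)"
      unfolding fub test_fun1_slice_integral(2)[OF T] by (simp add: set_lebesgue_integral_def)
  qed
qed

lemma H1_2_diff:
  assumes u: "H1_2 R u u1 u2" and v: "H1_2 R v v1 v2"
  shows "H1_2 R (\<lambda>z. u z - v z) (\<lambda>z. u1 z - v1 z) (\<lambda>z. u2 z - v2 z)"
proof -
  have L2: "L2_on R u" "L2_on R u1" "L2_on R u2" "L2_on R v" "L2_on R v1" "L2_on R v2"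
    using u v by (auto simp: H1_2_def)
  show ?thesis
    unfolding H1_2_def
  proof (intro conjI allI impI L2_on_diff L2)
    fix T Tx Ty assume T: "test_fun2 R T Tx Ty"
    have K: "compact (closure {z. T z \<noteq> 0})" using T by (simp add: test_fun2_def)
    have ff: "test_fun2 (closure {z. T z \<noteq> 0}) T Tx Ty" using T by (simp add: test_fun2_def)
    have bc: "bcont T" "bcont Tx" "bcont Ty"
      by (rule bcont_continuous_bounded_support[OF test_fun2_continuous(1)[OF T] K], erule test_fun2_eq_0[OF ff],
        rule bcont_continuous_bounded_support[OF test_fun2_continuous(2)[OF T] K], erule test_fun2_eq_0[OF ff],
        rule bcont_continuous_bounded_support[OF test_fun2_continuous(3)[OF T] K], erule test_fun2_eq_0[OF ff])
    have d: "(\<integral>z\<in>R. (f z - g z) * F z \<partial>lborel) = (\<integral>z\<in>R. f z * F z \<partial>lborel) - (\<integral>z\<in>R. g z * F z \<partial>lborel)"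
      if "L2_on R f" "L2_on R g" "bcont F" for f g F
    proof -
      have "ext (\<lambda>z. f z - g z) z * F z = ext f z * F z - ext g z * F z" for z
        by (simp add: ext_def algebra_simps)
      then show ?thesis
        unfolding set_integral_ext
        using ext_bcont_integrable[OF ext_integrable[OF that(1)] that(3)] ext_bcont_integrable[OF ext_integrable[OF that(2)] that(3)]
        by simp
    qed
    show "(\<integral>z\<in>R. (u z - v z) * Tx z \<partial>lborel) = - (\<integral>z\<in>R. (u1 z - v1 z) * T z \<partial>lborel)"
      "(\<integral>z\<in>R. (u z - v z) * Ty z \<partial>lborel) = - (\<integral>z\<in>R. (u2 z - v2 z) * T z \<partial>lborel)"
      using u v T unfolding d[OF L2(1) L2(4) bc(2)] d[OF L2(1) L2(4) bc(3)] d[OF L2(2) L2(5) bc(1)] d[OF L2(3) L2(6) bc(1)]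
        H1_2_def by auto
  qed
qed

end

section \<open>The energy estimate\<close>

lemma sq_integrable_abs_integral_le:
  assumes "sq_integrable M f" "sq_integrable M g" "(\<integral>x. (f x)\<^sup>2 \<partial>M) \<le> A" "(\<integral>x. (g x)\<^sup>2 \<partial>M) \<le> B"
  shows "\<bar>\<integral>x. f x * g x \<partial>M\<bar> \<le> sqrt A * sqrt B"
proof -
  have "(\<integral>x. f x * g x \<partial>M)\<^sup>2 \<le> (\<integral>x. (f x)\<^sup>2 \<partial>M) * (\<integral>x. (g x)\<^sup>2 \<partial>M)"
    by (rule sq_integrable_Cauchy_Schwarz[OF assms(1,2)])
  also have "\<dots> \<le> A * B"
    using order_trans[OF _ assms(3), of 0] by (intro mult_mono assms) auto
  finally show ?thesis by (metis real_sqrt_abs real_sqrt_le_mono real_sqrt_mult)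
qed

context thin_domain
begin

definition ip :: "(real \<times> real \<Rightarrow> real) \<Rightarrow> (real \<times> real \<Rightarrow> real) \<Rightarrow> real" where
  "ip u v = (\<integral>z. ext u z * ext v z \<partial>lborel)"

lemma ext_integrable_mult:
  "L2_on R u \<Longrightarrow> L2_on R v \<Longrightarrow> integrable lborel (\<lambda>z. ext u z * ext v z)"
  by (simp add: L2_on_ext sq_integrable_mult)

lemma ip_add_right: "L2_on R u \<Longrightarrow> L2_on R v \<Longrightarrow> L2_on R w \<Longrightarrow> ip u (\<lambda>z. v z + w z) = ip u v + ip u w"
  using ext_integrable_mult[of u v] ext_integrable_mult[of u w]
  by (simp add: ip_def ext_def[of "\<lambda>z. v z + w z"] ext_def[of v] ext_def[of w] distrib_left)

lemma ip_diff_left: "L2_on R u \<Longrightarrow> L2_on R v \<Longrightarrow> L2_on R w \<Longrightarrow> ip (\<lambda>z. u z - v z) w = ip u w - ip v w"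
  using ext_integrable_mult[of u w] ext_integrable_mult[of v w]
  by (simp add: ip_def ext_def[of "\<lambda>z. u z - v z"] ext_def[of v] ext_def[of u] left_diff_distrib right_diff_distrib)

lemma ip_self: "ip u u = (\<integral>z. (ext u z)\<^sup>2 \<partial>lborel)"
  by (simp add: ip_def power2_eq_square)

text \<open>A function of x sees u only through the slice integral L * avg u. This rewrites the
  weighted form of the reduced problem as integrals over R.\<close>

lemma cylinder_ip:
  assumes v: "L2_on {a<..<b} v" and u: "L2_on R u"
  shows "ip (\<lambda>z. v (fst z)) u = (\<integral>x\<in>{a<..<b}. L x * v x * avg u x \<partial>lborel)"
    and "set_integrable lborel {a<..<b} (\<lambda>x. L x * v x * avg u x)"
proof -
  have I: "integrable (lborel \<Otimes>\<^sub>M lborel) (\<lambda>z. ext (\<lambda>z. v (fst z)) z * ext u z)"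
    unfolding lborel_prod by (rule ext_integrable_mult[OF cylinder_L2(1)[OF v] u])
  have eq: "(\<integral>y. ext (\<lambda>z. v (fst z)) (x, y) * ext u (x, y) \<partial>lborel) = indicator {a<..<b} x *\<^sub>R (L x * v x * avg u x)" for x
  proof -
    have "ext (\<lambda>z. v (fst z)) (x, y) * ext u (x, y) = (indicator {a<..<b} x * v x) * ext u (x, y)" for y
      by (cases "(x, y) \<in> R") (auto simp: ext_def R_iff)
    then have "(\<integral>y. ext (\<lambda>z. v (fst z)) (x, y) * ext u (x, y) \<partial>lborel)
        = (\<integral>y. (indicator {a<..<b} x * v x) * ext u (x, y) \<partial>lborel)" by (simp only:)
    then show ?thesis using L_pos[of x] by (cases "x \<in> {a<..<b}") (auto simp: avg_def)
  qed
  show "ip (\<lambda>z. v (fst z)) u = (\<integral>x\<in>{a<..<b}. L x * v x * avg u x \<partial>lborel)"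
    unfolding ip_def set_lebesgue_integral_def eq[symmetric]
    using lborel_pair.integral_fst'[OF I] by (simp add: lborel_prod)
  show "set_integrable lborel {a<..<b} (\<lambda>x. L x * v x * avg u x)"
    unfolding set_integrable_def eq[symmetric] using lborel_pair.integrable_fst'[OF I] by simp
qed

lemma sq_integrable_indicator_sub:
  assumes "L2_on R u" "\<theta> \<in> sets borel" "\<theta> \<subseteq> R"
  shows "sq_integrable lborel (\<lambda>z. indicator \<theta> z * u z)"
proof -
  have u: "sq_integrable lborel (ext u)" using assms by (simp add: L2_on_ext)
  have e: "indicator \<theta> z * u z = indicator \<theta> z * ext u z" for z
    using assms(3) by (auto simp: ext_def indicator_def)
  show ?thesis
    unfolding e by (rule sq_integrable_bounded_mult[OF u, of _ 1])
      (use sq_integrable_measurable[OF u] assms(2) in \<open>auto simp: indicator_def\<close>)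
qed

text \<open>Against functions of x alone, the averaged source and the original source on \<theta>
  act identically; this is what lets the two problems be subtracted.\<close>

lemma cylinder_source:
  assumes f: "L2_on R f" and \<theta>: "\<theta> \<in> sets borel" "\<theta> \<subseteq> R" and v: "L2_on {a<..<b} v"
  shows "(\<integral>x\<in>{a<..<b}. (\<integral>y. indicator \<theta> (x, y) * f (x, y) \<partial>lborel) * v x \<partial>lborel) = (\<integral>z\<in>\<theta>. f z * v (fst z) \<partial>lborel)"
proof -
  have vR: "L2_on R (\<lambda>z. v (fst z))" by (rule cylinder_L2(1)[OF v])
  have "integrable lborel (\<lambda>z. (indicator \<theta> z * f z) * (indicator \<theta> z * v (fst z)))"
    by (rule sq_integrable_mult[OF sq_integrable_indicator_sub[OF f \<theta>] sq_integrable_indicator_sub[OF vR \<theta>]])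
  moreover have "(indicator \<theta> z * f z) * (indicator \<theta> z * v (fst z)) = indicator \<theta> z * (f z * v (fst z))" for z
    by (simp add: indicator_def)
  ultimately have I: "integrable (lborel \<Otimes>\<^sub>M lborel) (\<lambda>z. indicator \<theta> z * (f z * v (fst z)))"
    by (simp add: lborel_prod)
  have "(\<integral>z\<in>\<theta>. f z * v (fst z) \<partial>lborel) = (\<integral>x. (\<integral>y. indicator \<theta> (x, y) * (f (x, y) * v x) \<partial>lborel) \<partial>lborel)"
    using lborel_pair.integral_fst'[OF I] by (simp add: set_lebesgue_integral_def lborel_prod)
  also have "\<dots> = (\<integral>x\<in>{a<..<b}. (\<integral>y. indicator \<theta> (x, y) * f (x, y) \<partial>lborel) * v x \<partial>lborel)"
    unfolding set_lebesgue_integral_def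
  proof (rule Bochner_Integration.integral_cong[OF refl])
    fix x
    have "(\<integral>y. indicator \<theta> (x, y) * (f (x, y) * v x) \<partial>lborel) = (\<integral>y. indicator \<theta> (x, y) * f (x, y) \<partial>lborel) * v x"
      by (simp flip: integral_mult_left_zero add: mult.assoc)
    moreover have "(\<integral>y. indicator \<theta> (x, y) * f (x, y) \<partial>lborel) = 0" if "x \<notin> {a<..<b}"
    proof -
      have "(x, y) \<notin> \<theta>" for y using that \<theta>(2) by (auto simp: R_iff)
      then show ?thesis by simp
    qed
    ultimately show "(\<integral>y. indicator \<theta> (x, y) * (f (x, y) * v x) \<partial>lborel)
        = indicator {a<..<b} x *\<^sub>R ((\<integral>y. indicator \<theta> (x, y) * f (x, y) \<partial>lborel) * v x)"
      by (cases "x \<in> {a<..<b}") auto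
  qed
  finally show ?thesis by simp
qed

text \<open>On each slice v is constant and \<theta> occupies at most the fraction \<tau> / \<mu> of
  the length.\<close>

lemma cylinder_sub_bound:
  assumes \<theta>: "\<theta> \<in> sets borel" "\<theta> \<subseteq> R" and v: "L2_on {a<..<b} v"
    and \<tau>: "\<And>x. a < x \<Longrightarrow> x < b \<Longrightarrow> (\<integral>y. indicator \<theta> (x, y) \<partial>lborel) \<le> \<tau>"
    and \<mu>: "0 < \<mu>" "\<And>x. a < x \<Longrightarrow> x < b \<Longrightarrow> \<mu> \<le> L x"
  shows "(\<integral>z. (indicator \<theta> z * v (fst z))\<^sup>2 \<partial>lborel) \<le> \<tau> / \<mu> * ip (\<lambda>z. v (fst z)) (\<lambda>z. v (fst z))"
proof -
  have vR: "L2_on R (\<lambda>z. v (fst z))" by (rule cylinder_L2(1)[OF v])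
  have I: "integrable (lborel \<Otimes>\<^sub>M lborel) (\<lambda>z. (indicator \<theta> z * v (fst z))\<^sup>2)"
    using sq_integrable_indicator_sub[OF vR \<theta>] by (simp add: lborel_prod sq_integrable_def)
  have J: "integrable (lborel \<Otimes>\<^sub>M lborel) (\<lambda>z. (ext (\<lambda>z. v (fst z)) z)\<^sup>2)"
    using vR by (simp add: lborel_prod L2_on_ext sq_integrable_def)
  have "(\<integral>z. (indicator \<theta> z * v (fst z))\<^sup>2 \<partial>lborel) = (\<integral>x. (\<integral>y. (indicator \<theta> (x, y) * v x)\<^sup>2 \<partial>lborel) \<partial>lborel)"
    using lborel_pair.integral_fst'[OF I] by (simp add: lborel_prod)
  also have "\<dots> \<le> (\<integral>x. \<tau> / \<mu> * (\<integral>y. (ext (\<lambda>z. v (fst z)) (x, y))\<^sup>2 \<partial>lborel) \<partial>lborel)"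
  proof (rule integral_mono)
    show "integrable lborel (\<lambda>x. \<integral>y. (indicator \<theta> (x, y) * v x)\<^sup>2 \<partial>lborel)"
      using lborel_pair.integrable_fst'[OF I] by simp
    show "integrable lborel (\<lambda>x. \<tau> / \<mu> * (\<integral>y. (ext (\<lambda>z. v (fst z)) (x, y))\<^sup>2 \<partial>lborel))"
      using lborel_pair.integrable_fst'[OF J] by simp
    fix x
    show "(\<integral>y. (indicator \<theta> (x, y) * v x)\<^sup>2 \<partial>lborel) \<le> \<tau> / \<mu> * (\<integral>y. (ext (\<lambda>z. v (fst z)) (x, y))\<^sup>2 \<partial>lborel)"
    proof (cases "a < x \<and> x < b")
      case True
      have "(\<lambda>y. (indicator \<theta> (x, y) * v x)\<^sup>2) = (\<lambda>y. indicator \<theta> (x, y) * (v x)\<^sup>2)"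
        "(\<lambda>y. (ext (\<lambda>z. v (fst z)) (x, y))\<^sup>2) = (\<lambda>y. indicator R (x, y) * (v x)\<^sup>2)"
        by (auto simp: fun_eq_iff indicator_def ext_def)
      then have eq: "(\<integral>y. (indicator \<theta> (x, y) * v x)\<^sup>2 \<partial>lborel) = (\<integral>y. indicator \<theta> (x, y) \<partial>lborel) * (v x)\<^sup>2"
        "(\<integral>y. (ext (\<lambda>z. v (fst z)) (x, y))\<^sup>2 \<partial>lborel) = L x * (v x)\<^sup>2"
        using slice_indicator(2)[of x] True by simp_all
      have t: "(\<integral>y. indicator \<theta> (x, y) \<partial>lborel) \<le> \<tau>" using \<tau> True by simp
      have "0 \<le> (\<integral>y. indicator \<theta> (x, y) \<partial>lborel :: real)" by simp
      then have "0 \<le> \<tau>" using t by linarith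
      then have "\<mu> * \<tau> \<le> L x * \<tau>" using \<mu>(2)[of x] True by (intro mult_right_mono) auto
      then have "\<tau> \<le> \<tau> / \<mu> * L x" using \<mu>(1) by (simp add: field_simps)
      then show ?thesis unfolding eq using t
        by (metis mult.assoc mult_right_mono order_trans zero_le_power2)
    next
      case False
      then have "(x, y) \<notin> \<theta>" "(x, y) \<notin> R" for y using \<theta>(2) by (auto simp: R_iff)
      then show ?thesis by (simp add: ext_eq_0)
    qed
  qed
  also have "\<dots> = \<tau> / \<mu> * ip (\<lambda>z. v (fst z)) (\<lambda>z. v (fst z))"
    using lborel_pair.integral_fst'[OF J] by (simp add: lborel_prod ip_self)
  finally show ?thesis .
qed

lemma abs_m_le:
  assumes "z \<in> R" "\<bar>p' (fst z)\<bar> \<le> \<eta>" "\<bar>q' (fst z)\<bar> \<le> \<eta>" shows "\<bar>m z\<bar> \<le> \<eta>"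
proof -
  have s: "0 \<le> s z" "0 \<le> 1 - s z" using assms(1) by (auto simp: R_iff_s)
  have "m z = (1 - s z) * p' (fst z) + s z * q' (fst z)" by (simp add: m_def L'_def algebra_simps)
  also have "\<bar>\<dots>\<bar> \<le> (1 - s z) * \<bar>p' (fst z)\<bar> + s z * \<bar>q' (fst z)\<bar>"
    using s abs_triangle_ineq[of "(1 - s z) * p' (fst z)" "s z * q' (fst z)"] by (simp add: abs_mult)
  also have "\<dots> \<le> (1 - s z) * \<eta> + s z * \<eta>" using s assms by (intro add_mono mult_left_mono) auto
  also have "\<dots> = \<eta>" by (simp add: algebra_simps)
  finally show ?thesis .
qed

lemma set_integral_energy:
  assumes "L2_on R u1" "L2_on R u2" "L2_on R u3" "L2_on R v1" "L2_on R v2" "L2_on R v3"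
  shows "(\<integral>z\<in>R. u1 z * v1 z + u2 z * v2 z + u3 z * v3 z \<partial>lborel) = ip u1 v1 + ip u2 v2 + ip u3 v3"
proof -
  have "(\<integral>z\<in>R. u1 z * v1 z + u2 z * v2 z + u3 z * v3 z \<partial>lborel)
      = (\<integral>z. ext u1 z * ext v1 z + ext u2 z * ext v2 z + ext u3 z * ext v3 z \<partial>lborel)"
    unfolding set_lebesgue_integral_def
    by (intro Bochner_Integration.integral_cong) (auto simp: ext_def indicator_def)
  also have "\<dots> = ip u1 v1 + ip u2 v2 + ip u3 v3"
    unfolding ip_def using ext_integrable_mult[OF assms(1,4)] ext_integrable_mult[OF assms(2,5)] ext_integrable_mult[OF assms(3,6)]
    by simp
  finally show ?thesis .
qed

text \<open>All scales stay symbolic: \<tau> bounds the slices of \<theta>, \<mu> and \<Lambda>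
  enclose the slices of R, \<eta> bounds the boundary slopes. The two summands come from the source
  acting on the deviation and from the slope term. Each of these is linear in the root of the
  vertical energy, which the left-hand side absorbs.\<close>

lemma energy_estimate:
  assumes w: "H1_2 R w gw1 gw2"
    and w_eq: "\<And>\<phi> g1 g2. H1_2 R \<phi> g1 g2 \<Longrightarrow>
       (\<integral>z\<in>R. gw1 z * g1 z + gw2 z * g2 z + w z * \<phi> z \<partial>lborel) = \<kappa> * (\<integral>z\<in>\<theta>. f z * \<phi> z \<partial>lborel)"
    and v: "H1_1 {a<..<b} v v'"
    and v_eq: "\<And>\<phi> \<phi>'. H1_1 {a<..<b} \<phi> \<phi>' \<Longrightarrow>
       (\<integral>x\<in>{a<..<b}. L x * v' x * \<phi>' x + L x * v x * \<phi> x \<partial>lborel)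
        = \<kappa> * (\<integral>x\<in>{a<..<b}. (\<integral>y. indicator \<theta> (x, y) * f (x, y) \<partial>lborel) * \<phi> x \<partial>lborel)"
    and f: "L2_on R f" and \<theta>: "\<theta> \<in> sets borel" "\<theta> \<subseteq> R"
    and \<tau>: "\<And>x. a < x \<Longrightarrow> x < b \<Longrightarrow> (\<integral>y. indicator \<theta> (x, y) \<partial>lborel) \<le> \<tau>"
    and \<Lambda>: "\<And>x. a < x \<Longrightarrow> x < b \<Longrightarrow> L x \<le> \<Lambda>"
    and \<mu>: "0 < \<mu>" "\<And>x. a < x \<Longrightarrow> x < b \<Longrightarrow> \<mu> \<le> L x"
    and \<eta>: "\<And>x. a < x \<Longrightarrow> x < b \<Longrightarrow> \<bar>p' x\<bar> \<le> \<eta>" "\<And>x. a < x \<Longrightarrow> x < b \<Longrightarrow> \<bar>q' x\<bar> \<le> \<eta>"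
    and \<kappa>: "0 \<le> \<kappa>" and F: "(\<integral>z\<in>\<theta>. (f z)\<^sup>2 \<partial>lborel) \<le> F"
  shows "sqrt (\<integral>z\<in>R. (w z - v (fst z))\<^sup>2 + (gw1 z - v' (fst z))\<^sup>2 + (gw2 z)\<^sup>2 \<partial>lborel)
    \<le> \<kappa> * sqrt (F * \<tau> * \<Lambda>) + \<eta> * (\<kappa> * sqrt (F * \<tau> / \<mu>))"
proof -
  define V where "V = (\<lambda>z::real\<times>real. v (fst z))"
  define V' where "V' = (\<lambda>z::real\<times>real. v' (fst z))"
  define \<phi> where "\<phi> = (\<lambda>z. w z - V z)"
  define g1 where "g1 = (\<lambda>z. gw1 z - V' z)"
  define G where "G = ip gw2 gw2"
  define E where "E = ip \<phi> \<phi> + ip g1 g1 + G"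
  \<comment> \<open>The a priori bound for the gradient of the reduced solution, proved as
    \<open>W\<close>.\<close>
  define c where "c = \<kappa> * sqrt (F * \<tau> / \<mu>)"
  have vL2: "L2_on {a<..<b} v" "L2_on {a<..<b} v'" using v by (auto simp: H1_1_def)
  have VH: "H1_2 R V V' (\<lambda>z. 0)" unfolding V_def V'_def by (rule cylinder_H1[OF v])
  have \<phi>H: "H1_2 R \<phi> g1 gw2" using H1_2_diff[OF w VH] by (simp add: \<phi>_def g1_def)
  have L2: "L2_on R w" "L2_on R gw1" "L2_on R gw2" "L2_on R V" "L2_on R V'" "L2_on R \<phi>" "L2_on R g1"
    using w VH \<phi>H by (auto simp: H1_2_def)
  have mg: "L2_on R (\<lambda>z. m z * gw2 z)" by (rule L2_on_bcont_mult[OF L2(3) bcont_m])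
  have g1m: "L2_on R (\<lambda>z. g1 z + m z * gw2 z)" by (rule L2_on_add[OF L2(7) mg])
  \<comment> \<open>One interior point suffices to see that constants bounding nonnegative slice
    quantities are nonnegative.\<close>
  have x0: "a < (a + b) / 2" "(a + b) / 2 < b" using ab by auto
  have F0: "0 \<le> F"
  proof -
    have "0 \<le> (\<integral>z\<in>\<theta>. (f z)\<^sup>2 \<partial>lborel)" by (simp add: set_lebesgue_integral_def integral_nonneg_AE)
    then show ?thesis using F by linarith
  qed
  have \<tau>0: "0 \<le> \<tau>"
  proof -
    have "0 \<le> (\<integral>y. indicator \<theta> ((a + b) / 2, y) \<partial>lborel :: real)" by simp
    then show ?thesis using \<tau>[OF x0] by linarith
  qed
  have \<Lambda>0: "0 \<le> \<Lambda>" using \<Lambda>[OF x0] \<mu>(2)[OF x0] \<mu>(1) by linarith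
  have \<eta>0: "0 \<le> \<eta>" using \<eta>(1)[OF x0] by linarith
  have c0: "0 \<le> c" using F0 \<tau>0 \<mu>(1) \<kappa> by (simp add: c_def)
  have pos: "0 \<le> ip u u" for u by (simp add: ip_self)
  have fsq: "sq_integrable lborel (\<lambda>z. indicator \<theta> z * f z)" by (rule sq_integrable_indicator_sub[OF f \<theta>])
  have fF: "(\<integral>z. (indicator \<theta> z * f z)\<^sup>2 \<partial>lborel) \<le> F"
  proof -
    have "(indicator \<theta> z * f z)\<^sup>2 = indicator \<theta> z *\<^sub>R (f z)\<^sup>2" for z by (simp add: indicator_def)
    then show ?thesis using F by (simp add: set_lebesgue_integral_def)
  qed
  have \<theta>_int: "(\<integral>z\<in>\<theta>. f z * g z \<partial>lborel) = (\<integral>z. (indicator \<theta> z * f z) * (indicator \<theta> z * g z) \<partial>lborel)" for g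
    unfolding set_lebesgue_integral_def by (intro Bochner_Integration.integral_cong) (auto simp: indicator_def)

  have W: "sqrt (ip V' V') \<le> c"
  proof -
    have "avg V x = v x \<and> avg V' x = v' x" if "x \<in> {a<..<b}" for x
      using that slice_indicator(2)[of x] L_pos[of x] by (simp add: avg_def V_def V'_def ext_def)
    then have "(\<integral>x\<in>{a<..<b}. L x * v' x * avg V' x + L x * v x * avg V x \<partial>lborel)
        = (\<integral>x\<in>{a<..<b}. L x * v' x * v' x + L x * v x * v x \<partial>lborel)"
      by (intro set_lebesgue_integral_cong) auto
    moreover have "(\<integral>x\<in>{a<..<b}. L x * v' x * avg V' x + L x * v x * avg V x \<partial>lborel) = ip V' V' + ip V V"
      using cylinder_ip[OF vL2(1) L2(4)] cylinder_ip[OF vL2(2) L2(5)] by (simp add: V_def V'_def)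
    ultimately have "ip V' V' + ip V V = \<kappa> * (\<integral>z\<in>\<theta>. f z * V z \<partial>lborel)"
      using v_eq[OF v] cylinder_source[OF f \<theta> vL2(1)] by (simp add: V_def)
    also have "\<dots> \<le> \<kappa> * (sqrt F * sqrt (\<tau> / \<mu> * ip V V))"
    proof (rule mult_left_mono[OF _ \<kappa>])
      have "\<bar>\<integral>z. (indicator \<theta> z * f z) * (indicator \<theta> z * V z) \<partial>lborel\<bar> \<le> sqrt F * sqrt (\<tau> / \<mu> * ip V V)"
        by (rule sq_integrable_abs_integral_le[OF fsq sq_integrable_indicator_sub[OF L2(4) \<theta>] fF])
          (unfold V_def, rule cylinder_sub_bound[OF \<theta> vL2(1) \<tau> \<mu>])
      then show "(\<integral>z\<in>\<theta>. f z * V z \<partial>lborel) \<le> sqrt F * sqrt (\<tau> / \<mu> * ip V V)" unfolding \<theta>_int by linarith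
    qed
    also have "\<dots> = c * sqrt (ip V V)" by (simp add: c_def real_sqrt_mult real_sqrt_divide)
    finally have 1: "ip V' V' + ip V V \<le> c * sqrt (ip V V)" .
    \<comment> \<open>With t = sqrt (ip V V) the estimate reads ip V' V' \<le> c t - t^2, while c^2
      - c t + t^2 = (c - t)^2 + c t is nonnegative.\<close>
    have "(sqrt (ip V V))\<^sup>2 = ip V V" using pos by simp
    moreover have "0 \<le> (c - sqrt (ip V V))\<^sup>2" "0 \<le> c * sqrt (ip V V)" using c0 pos by auto
    ultimately have "ip V' V' \<le> c\<^sup>2" using 1 by (simp add: power2_diff)
    then have "sqrt (ip V' V') \<le> sqrt (c\<^sup>2)" by (rule real_sqrt_le_mono)
    then show ?thesis using c0 by simp
  qed

  define \<psi> where "\<psi> = avg \<phi>"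
  define \<psi>' where "\<psi>' = avg (\<lambda>z. g1 z + m z * gw2 z)"
  have \<psi>: "H1_1 {a<..<b} \<psi> \<psi>'" unfolding \<psi>_def \<psi>'_def by (rule avg_H1[OF \<phi>H])
  have \<psi>L2: "L2_on {a<..<b} \<psi>" using \<psi> by (simp add: H1_1_def)
  have "(\<integral>x\<in>{a<..<b}. L x * v' x * \<psi>' x + L x * v x * \<psi> x \<partial>lborel) = ip V' (\<lambda>z. g1 z + m z * gw2 z) + ip V \<phi>"
    unfolding \<psi>_def \<psi>'_def V_def V'_def
    using cylinder_ip[OF vL2(1) L2(6)] cylinder_ip[OF vL2(2) g1m] by simp
  \<comment> \<open>The derivative of the averaged test function is the average of g1 + m gw2, so
    the reduced equation yields the wanted pairing of V' with g1 plus one extra pairing with m gw2.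
    The latter is all that survives the subtraction besides the source terms.\<close>
  then have eq2: "ip V' g1 + ip V' (\<lambda>z. m z * gw2 z) + ip V \<phi> = \<kappa> * (\<integral>z\<in>\<theta>. f z * \<psi> (fst z) \<partial>lborel)"
    using v_eq[OF \<psi>] cylinder_source[OF f \<theta> \<psi>L2] ip_add_right[OF L2(5) L2(7) mg] by simp
  have eq1: "ip gw1 g1 + ip gw2 gw2 + ip w \<phi> = \<kappa> * (\<integral>z\<in>\<theta>. f z * \<phi> z \<partial>lborel)"
    using w_eq[OF \<phi>H] set_integral_energy[OF L2(2,3,1) L2(7,3,6)] by simp
  have "ip g1 g1 = ip gw1 g1 - ip V' g1" "ip \<phi> \<phi> = ip w \<phi> - ip V \<phi>"
    using ip_diff_left[OF L2(2,5,7)] ip_diff_left[OF L2(1,4,6)] by (simp_all add: g1_def \<phi>_def)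
  with eq1 eq2 have Eeq: "E = \<kappa> * ((\<integral>z\<in>\<theta>. f z * \<phi> z \<partial>lborel) - (\<integral>z\<in>\<theta>. f z * \<psi> (fst z) \<partial>lborel)) + ip V' (\<lambda>z. m z * gw2 z)"
    by (simp add: E_def G_def right_diff_distrib)
  have \<psi>R: "L2_on R (\<lambda>z. \<psi> (fst z))" by (rule cylinder_L2(1)[OF \<psi>L2])
  have dL2: "L2_on R (\<lambda>z. \<phi> z - \<psi> (fst z))" by (rule L2_on_diff[OF L2(6) \<psi>R])
  have "(\<integral>z\<in>\<theta>. f z * \<phi> z \<partial>lborel) - (\<integral>z\<in>\<theta>. f z * \<psi> (fst z) \<partial>lborel)
      = (\<integral>z. (indicator \<theta> z * f z) * (indicator \<theta> z * (\<phi> z - \<psi> (fst z))) \<partial>lborel)"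
    unfolding \<theta>_int
    using sq_integrable_mult[OF fsq sq_integrable_indicator_sub[OF L2(6) \<theta>]]
      sq_integrable_mult[OF fsq sq_integrable_indicator_sub[OF \<psi>R \<theta>]]
    by (subst Bochner_Integration.integral_diff[symmetric]) (auto simp: right_diff_distrib)
  also have "\<dots> \<le> sqrt F * sqrt (\<tau> * \<Lambda> * G)"
  proof -
    have "(\<integral>z. (indicator \<theta> z * (\<phi> z - \<psi> (fst z)))\<^sup>2 \<partial>lborel) \<le> \<tau> * \<Lambda> * G"
      unfolding \<psi>_def G_def ip_self by (rule deviation_bound[OF \<phi>H \<theta> \<tau> \<Lambda>])
    from sq_integrable_abs_integral_le[OF fsq sq_integrable_indicator_sub[OF dL2 \<theta>] fF this]
    show ?thesis by linarith
  qed
  also have "\<dots> = sqrt (F * \<tau> * \<Lambda>) * sqrt G" by (simp add: real_sqrt_mult)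
  finally have b1: "(\<integral>z\<in>\<theta>. f z * \<phi> z \<partial>lborel) - (\<integral>z\<in>\<theta>. f z * \<psi> (fst z) \<partial>lborel) \<le> sqrt (F * \<tau> * \<Lambda>) * sqrt G" .
  have b2: "ip V' (\<lambda>z. m z * gw2 z) \<le> (\<eta> * c) * sqrt G"
  proof -
    have mz: "(ext (\<lambda>z. m z * gw2 z) z)\<^sup>2 \<le> \<eta>\<^sup>2 * (ext gw2 z)\<^sup>2" for z
    proof (cases "z \<in> R")
      case True
      then have "\<bar>m z\<bar> \<le> \<eta>" using \<eta>[of "fst z"] by (intro abs_m_le) (auto simp: R_iff_s)
      then have "(m z)\<^sup>2 \<le> \<eta>\<^sup>2" using \<eta>0 abs_le_square_iff[of "m z" \<eta>] by simp
      then show ?thesis using True by (simp add: ext_def power_mult_distrib mult_right_mono)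
    qed (simp add: ext_eq_0)
    have "(\<integral>z. (ext (\<lambda>z. m z * gw2 z) z)\<^sup>2 \<partial>lborel) \<le> (\<integral>z. \<eta>\<^sup>2 * (ext gw2 z)\<^sup>2 \<partial>lborel)"
      using mg L2(3) mz unfolding L2_on_ext sq_integrable_def by (intro integral_mono) auto
    also have "\<dots> = \<eta>\<^sup>2 * G" by (simp add: G_def ip_self)
    finally have "\<bar>ip V' (\<lambda>z. m z * gw2 z)\<bar> \<le> sqrt (ip V' V') * sqrt (\<eta>\<^sup>2 * G)"
      unfolding ip_def[of V' "\<lambda>z. m z * gw2 z"]
      by (intro sq_integrable_abs_integral_le) (use L2(5) mg in \<open>auto simp: L2_on_ext ip_self\<close>)
    also have "\<dots> = sqrt (ip V' V') * (\<eta> * sqrt G)" using \<eta>0 by (simp add: real_sqrt_mult)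
    also have "\<dots> \<le> c * (\<eta> * sqrt G)" using W \<eta>0 pos by (intro mult_right_mono) (auto simp: G_def)
    finally show ?thesis by (simp add: ac_simps)
  qed
  define B where "B = \<kappa> * sqrt (F * \<tau> * \<Lambda>) + \<eta> * c"
  have B0: "0 \<le> B" unfolding B_def using \<kappa> F0 \<tau>0 \<Lambda>0 \<eta>0 c0 by simp
  have "E \<le> \<kappa> * (sqrt (F * \<tau> * \<Lambda>) * sqrt G) + (\<eta> * c) * sqrt G"
    unfolding Eeq by (intro add_mono mult_left_mono b1 b2 \<kappa>)
  also have "\<dots> = B * sqrt G" by (simp add: B_def algebra_simps)
  \<comment> \<open>G is one of the three nonnegative summands of E, which closes the estimate: E
    \<le> B sqrt E gives sqrt E \<le> B.\<close>
  also have "\<dots> \<le> B * sqrt E"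
    using pos[of \<phi>] pos[of g1] B0 by (intro mult_left_mono) (auto simp: E_def)
  finally have EB: "E \<le> B * sqrt E" .
  have E0: "0 \<le> E" using pos by (simp add: E_def G_def)
  have "sqrt E \<le> B"
  proof (cases "E = 0")
    case False
    then have "0 < sqrt E" using E0 by simp
    moreover have "sqrt E * sqrt E \<le> B * sqrt E" using EB E0 by simp
    ultimately show ?thesis by (metis mult_right_le_imp_le)
  qed (use B0 in simp)
  moreover have "(\<integral>z\<in>R. (w z - v (fst z))\<^sup>2 + (gw1 z - v' (fst z))\<^sup>2 + (gw2 z)\<^sup>2 \<partial>lborel) = E"
    using set_integral_energy[OF L2(6,7,3) L2(6,7,3)]
    by (simp add: E_def G_def \<phi>_def g1_def V_def V'_def power2_eq_square)
  ultimately show ?thesis by (simp add: B_def c_def)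
qed

end

section \<open>Scaling in \<epsilon> and passage to the limit\<close>

lemma Theta_open:
  assumes k: "continuous_on {a..b} k2" and H: "continuous_on {a..b} H"
  shows "open (Theta a b k2 H \<gamma> \<epsilon>)"
proof -
  let ?I = "{a<..<b} \<times> (UNIV :: real set)"
  have f: "continuous_on ?I (\<lambda>z. F (fst z))" if "continuous_on {a..b} F" for F :: "real \<Rightarrow> real"
    by (rule continuous_on_compose2[OF that]) (auto intro: continuous_intros)
  have 1: "continuous_on ?I (\<lambda>z. snd z - \<epsilon> * (k2 (fst z) - \<epsilon> powr \<gamma> * H (fst z)))"
    by (intro continuous_intros f k H)
  have 2: "continuous_on ?I (\<lambda>z. \<epsilon> * k2 (fst z) - snd z)"
    by (intro continuous_intros f k)
  have "Theta a b k2 H \<gamma> \<epsilon> = ((\<lambda>z. snd z - \<epsilon> * (k2 (fst z) - \<epsilon> powr \<gamma> * H (fst z))) -` {0<..} \<inter> ?I)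
      \<inter> ((\<lambda>z. \<epsilon> * k2 (fst z) - snd z) -` {0<..} \<inter> ?I)"
    by (auto simp: Theta_def)
  moreover have "open ?I" by (simp add: open_Times)
  ultimately show ?thesis
    using 1 2 by (simp add: continuous_on_open_vimage open_Int)
qed

text \<open>A real supremum dominates its members only for a family bounded above; continuity of k'
  on the closed interval supplies the bound.\<close>

lemma abs_le_Sup_scaled:
  fixes a b :: real
  assumes "continuous_on {a..b} k'" "a < x" "x < b" "0 \<le> \<epsilon>"
  shows "\<epsilon> * \<bar>k' x\<bar> \<le> (SUP x\<in>{a<..<b}. \<epsilon> * \<bar>k' x\<bar> :: real)"
proof (rule cSUP_upper)
  have "bounded (k' ` {a..b})" using assms(1) by (auto intro!: compact_imp_bounded compact_continuous_image)
  then obtain C where C: "\<And>x. x \<in> {a..b} \<Longrightarrow> \<bar>k' x\<bar> \<le> C" unfolding bounded_real by (metis imageI)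
  show "bdd_above ((\<lambda>x. \<epsilon> * \<bar>k' x\<bar>) ` {a<..<b})"
    by (rule bdd_aboveI2[of _ _ "\<epsilon> * C"]) (use C assms(4) in \<open>auto intro!: mult_left_mono\<close>)
qed (use assms in auto)

text \<open>The energy bound for one \<epsilon>, divided by sqrt \<epsilon>. The constants on the
  right are uniform in \<epsilon>, so convergence rests on the factors \<epsilon> and \<eta>
  alone.\<close>

lemma rescaled_estimate:
  fixes a b \<gamma> \<epsilon> c :: real
  assumes ab: "a < b" and \<epsilon>: "0 < \<epsilon>" "\<epsilon> < 1"
    and k1: "continuous_on {a..b} k1'" "\<And>x. x \<in> {a..b} \<Longrightarrow> (k1 has_real_derivative k1' x) (at x within {a..b})"
    and k2: "continuous_on {a..b} k2'" "\<And>x. x \<in> {a..b} \<Longrightarrow> (k2 has_real_derivative k2' x) (at x within {a..b})"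
    and C1: "0 < C11" "\<And>x. x \<in> {a..b} \<Longrightarrow> C11 \<le> k1 x \<and> k1 x \<le> C12"
    and C2: "0 < C21" "\<And>x. x \<in> {a..b} \<Longrightarrow> C21 \<le> k2 x \<and> k2 x \<le> C22"
    and H: "continuous_on {a..b} H" "\<And>x. x \<in> {a..b} \<Longrightarrow> 0 \<le> H x \<and> H x \<le> H1" "\<epsilon> powr \<gamma> * H1 \<le> C11"
    and f: "L2_on (Rdom a b k1 k2 \<epsilon>) f"
    and F: "\<epsilon> powr (-\<gamma>) * (rL2 \<epsilon> (Theta a b k2 H \<gamma> \<epsilon>) f)\<^sup>2 \<le> c"
    and sol: "solves_P (Rdom a b k1 k2 \<epsilon>) (Theta a b k2 H \<gamma> \<epsilon>) \<gamma> \<epsilon> f w gw1 gw2"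
    and solhat: "solves_Phat a b (\<lambda>x. k1 x + k2 x) \<gamma> \<epsilon> (fhat k1 k2 (Theta a b k2 H \<gamma> \<epsilon>) f \<epsilon>) wh wh'"
    and \<eta>: "\<And>x. a < x \<Longrightarrow> x < b \<Longrightarrow> \<epsilon> * \<bar>k1' x\<bar> \<le> \<eta>" "\<And>x. a < x \<Longrightarrow> x < b \<Longrightarrow> \<epsilon> * \<bar>k2' x\<bar> \<le> \<eta>"
  shows "rH1 \<epsilon> (Rdom a b k1 k2 \<epsilon>) (\<lambda>z. w z - wh (fst z)) (\<lambda>z. gw1 z - wh' (fst z)) gw2
    \<le> \<epsilon> * sqrt (c * H1 * (C12 + C22)) + \<eta> * sqrt (c * H1 / (C11 + C21))"
proof -
  let ?\<theta> = "Theta a b k2 H \<gamma> \<epsilon>"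
  interpret thin_domain a b "\<lambda>x. - (\<epsilon> * k1 x)" "\<lambda>x. \<epsilon> * k2 x" "\<lambda>x. - (\<epsilon> * k1' x)" "\<lambda>x. \<epsilon> * k2' x"
  proof
    show "((\<lambda>x. - (\<epsilon> * k1 x)) has_real_derivative - (\<epsilon> * k1' x)) (at x within {a..b})" if "x \<in> {a..b}" for x
      by (rule DERIV_minus[OF DERIV_cmult[OF k1(2)[OF that]]])
    show "((\<lambda>x. \<epsilon> * k2 x) has_real_derivative \<epsilon> * k2' x) (at x within {a..b})" if "x \<in> {a..b}" for x
      by (rule DERIV_cmult[OF k2(2)[OF that]])
    show "- (\<epsilon> * k1 x) < \<epsilon> * k2 x" if "x \<in> {a..b}" for x
    proof -
      have "0 < \<epsilon> * k1 x" "0 < \<epsilon> * k2 x" using C1(1) C1(2)[OF that] C2(1) C2(2)[OF that] \<epsilon> by auto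
      then show ?thesis by simp
    qed
  qed (use ab k1 k2 in \<open>auto intro!: continuous_intros\<close>)
  have R: "Rdom a b k1 k2 \<epsilon> = R" by (simp add: Rdom_def R_def)
  have Leq: "L x = \<epsilon> * (k1 x + k2 x)" for x by (simp add: L_def algebra_simps)
  have k2c: "continuous_on {a..b} k2" by (rule DERIV_continuous_on) (rule k2(2))
  have \<theta>m: "?\<theta> \<in> sets borel" using Theta_open[OF k2c H(1)] by simp
  \<comment> \<open>The strip must not protrude below the lower boundary, since f is square
    integrable only on the domain. Its relative depth \<epsilon>^\<gamma> H is at most C11 \<le> k1,
    and k2 is positive.\<close>
  have low: "- (\<epsilon> * k1 x) \<le> \<epsilon> * (k2 x - \<epsilon> powr \<gamma> * H x)" if "x \<in> {a..b}" for x
  proof -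
    have "\<epsilon> powr \<gamma> * H x \<le> \<epsilon> powr \<gamma> * H1" using H(2)[OF that] by (intro mult_left_mono) auto
    then have "0 \<le> k1 x + (k2 x - \<epsilon> powr \<gamma> * H x)"
      using H(3) C1(2)[OF that] C2(1) C2(2)[OF that] by linarith
    then have "0 \<le> \<epsilon> * (k1 x + (k2 x - \<epsilon> powr \<gamma> * H x))" using \<epsilon> by simp
    then show ?thesis by (simp add: algebra_simps)
  qed
  have \<theta>R: "?\<theta> \<subseteq> R"
  proof
    fix z assume z: "z \<in> ?\<theta>"
    obtain x y where [simp]: "z = (x, y)" by (cases z)
    have "a < x" "x < b" using z by (auto simp: Theta_def)
    then show "z \<in> R" using z low[of x] by (auto simp: Theta_def R_def)
  qed
  have "H1 \<ge> 0" using H(2)[of a] ab by auto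
  define \<tau> where "\<tau> = \<epsilon> * (\<epsilon> powr \<gamma> * H1)"
  have \<tau>: "(\<integral>y. indicator ?\<theta> (x, y) \<partial>lborel) \<le> \<tau>" if x: "a < x" "x < b" for x
  proof -
    have h: "0 \<le> H x" "H x \<le> H1" using H(2)[of x] x by auto
    have "indicator ?\<theta> (x, y) = (indicator {\<epsilon> * (k2 x - \<epsilon> powr \<gamma> * H x)<..<\<epsilon> * k2 x} y :: real)" for y
      using x by (simp add: Theta_def indicator_def)
    then have "(\<integral>y. indicator ?\<theta> (x, y) \<partial>lborel) = measure lborel {\<epsilon> * (k2 x - \<epsilon> powr \<gamma> * H x)<..<\<epsilon> * k2 x}"
      by simp
    also have "\<dots> = \<epsilon> * (\<epsilon> powr \<gamma> * H x)"
      using h \<epsilon> by (subst measure_lborel_Ioo) (auto simp: algebra_simps)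
    also have "\<dots> \<le> \<tau>" unfolding \<tau>_def using h \<epsilon> by (intro mult_left_mono) auto
    finally show ?thesis .
  qed
  define \<kappa> where "\<kappa> = \<epsilon> powr (- \<gamma>)"
  have w: "H1_2 R w gw1 gw2" and w_eq: "\<And>\<phi> g1 g2. H1_2 R \<phi> g1 g2 \<Longrightarrow>
       (\<integral>z\<in>R. gw1 z * g1 z + gw2 z * g2 z + w z * \<phi> z \<partial>lborel) = \<kappa> * (\<integral>z\<in>?\<theta>. f z * \<phi> z \<partial>lborel)"
    using sol unfolding solves_P_def R \<kappa>_def by blast+
  have v: "H1_1 {a<..<b} wh wh'" using solhat by (simp add: solves_Phat_def)
  have v_eq: "(\<integral>x\<in>{a<..<b}. L x * wh' x * \<phi>' x + L x * wh x * \<phi> x \<partial>lborel)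
        = \<kappa> * (\<integral>x\<in>{a<..<b}. (\<integral>y. indicator ?\<theta> (x, y) * f (x, y) \<partial>lborel) * \<phi> x \<partial>lborel)"
    if \<phi>: "H1_1 {a<..<b} \<phi> \<phi>'" for \<phi> \<phi>'
  proof -
    let ?K = "\<lambda>x. k1 x + k2 x"
    have eq: "(\<integral>x\<in>{a<..<b}. ?K x * wh' x * \<phi>' x + ?K x * wh x * \<phi> x \<partial>lborel)
          = \<kappa> * (\<integral>x\<in>{a<..<b}. ?K x * fhat k1 k2 ?\<theta> f \<epsilon> x * \<phi> x \<partial>lborel)"
      using solhat \<phi> unfolding solves_Phat_def \<kappa>_def by blast
    \<comment> \<open>Multiplication by \<epsilon> turns the weight K into the slice length L, and
      \<epsilon> K cancels the normalisation in \<open>fhat\<close>.\<close>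
    have "(\<integral>x\<in>{a<..<b}. L x * wh' x * \<phi>' x + L x * wh x * \<phi> x \<partial>lborel)
        = (\<integral>x\<in>{a<..<b}. \<epsilon> * (?K x * wh' x * \<phi>' x + ?K x * wh x * \<phi> x) \<partial>lborel)"
      by (intro set_lebesgue_integral_cong) (auto simp: Leq algebra_simps)
    also have "\<dots> = \<epsilon> * (\<integral>x\<in>{a<..<b}. ?K x * wh' x * \<phi>' x + ?K x * wh x * \<phi> x \<partial>lborel)"
      by (rule set_integral_mult_right)
    also have "\<dots> = \<kappa> * (\<epsilon> * (\<integral>x\<in>{a<..<b}. ?K x * fhat k1 k2 ?\<theta> f \<epsilon> x * \<phi> x \<partial>lborel))"
      unfolding eq by simp
    also have "\<epsilon> * (\<integral>x\<in>{a<..<b}. ?K x * fhat k1 k2 ?\<theta> f \<epsilon> x * \<phi> x \<partial>lborel)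
        = (\<integral>x\<in>{a<..<b}. \<epsilon> * (?K x * fhat k1 k2 ?\<theta> f \<epsilon> x * \<phi> x) \<partial>lborel)"
      by (rule set_integral_mult_right[symmetric])
    also have "\<dots> = (\<integral>x\<in>{a<..<b}. (\<integral>y. indicator ?\<theta> (x, y) * f (x, y) \<partial>lborel) * \<phi> x \<partial>lborel)"
    proof (rule set_lebesgue_integral_cong)
      show "\<forall>x. x \<in> {a<..<b} \<longrightarrow> \<epsilon> * (?K x * fhat k1 k2 ?\<theta> f \<epsilon> x * \<phi> x)
          = (\<integral>y. indicator ?\<theta> (x, y) * f (x, y) \<partial>lborel) * \<phi> x"
      proof (intro allI impI)
        fix x assume "x \<in> {a<..<b}"
        then have x: "a < x" "x < b" by auto
        have "(x, y) \<in> ?\<theta> \<Longrightarrow> y \<in> {- (\<epsilon> * k1 x)<..<\<epsilon> * k2 x}" for y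
          using \<theta>R by (auto simp: R_def)
        then have "(\<integral>y\<in>{- (\<epsilon> * k1 x)<..<\<epsilon> * k2 x}. indicator ?\<theta> (x, y) * f (x, y) \<partial>lborel)
            = (\<integral>y. indicator ?\<theta> (x, y) * f (x, y) \<partial>lborel)"
          unfolding set_lebesgue_integral_def
          by (intro Bochner_Integration.integral_cong) (auto simp: indicator_def)
        then have fh: "fhat k1 k2 ?\<theta> f \<epsilon> x = (\<integral>y. indicator ?\<theta> (x, y) * f (x, y) \<partial>lborel) / (\<epsilon> * ?K x)"
          by (simp add: fhat_def)
        have "\<epsilon> * ?K x \<noteq> 0" using L_pos[of x] x unfolding Leq by auto
        then show "\<epsilon> * (?K x * fhat k1 k2 ?\<theta> f \<epsilon> x * \<phi> x)
          = (\<integral>y. indicator ?\<theta> (x, y) * f (x, y) \<partial>lborel) * \<phi> x"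
          unfolding fh by simp
      qed
    qed simp
    finally show ?thesis .
  qed
  define F0 where "F0 = (\<integral>z\<in>?\<theta>. (f z)\<^sup>2 \<partial>lborel)"
  have F0nn: "0 \<le> F0" by (simp add: F0_def set_lebesgue_integral_def integral_nonneg_AE)
  have half: "(\<epsilon> powr (-1/2))\<^sup>2 = \<epsilon> powr (-1)"
    using \<epsilon> by (simp add: power2_eq_square flip: powr_add)
  \<comment> \<open>The squared rescaled norm contributes \<epsilon>^(-1) besides the
    \<epsilon>^(-\<gamma>) in (F); this is the origin of the exponent 1 + \<gamma>.\<close>
  have Fc: "F0 \<le> c * \<epsilon> powr (1 + \<gamma>)"
  proof -
    have "(rL2 \<epsilon> ?\<theta> f)\<^sup>2 = \<epsilon> powr (-1) * F0"
      by (simp only: rL2_def power_mult_distrib half F0_def[symmetric] real_sqrt_pow2[OF F0nn])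
    moreover have "\<epsilon> powr (-\<gamma>) * \<epsilon> powr (-1) = \<epsilon> powr (- (1 + \<gamma>))"
      by (subst powr_add[symmetric]) (simp add: algebra_simps)
    ultimately have "\<epsilon> powr (- (1 + \<gamma>)) * F0 \<le> c"
      using F by (simp only: mult.assoc[symmetric])
    then have "\<epsilon> powr (1 + \<gamma>) * (\<epsilon> powr (- (1 + \<gamma>)) * F0) \<le> \<epsilon> powr (1 + \<gamma>) * c"
      by (intro mult_left_mono) auto
    moreover have "\<epsilon> powr (1 + \<gamma>) * (\<epsilon> powr (- (1 + \<gamma>)) * F0) = F0"
      using \<epsilon> by (simp add: mult.assoc[symmetric] flip: powr_add)
    ultimately show ?thesis by (simp only: mult.commute[of c])
  qed
  have \<Lambda>: "L x \<le> \<epsilon> * (C12 + C22)" if "a < x" "x < b" for x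
    unfolding Leq using C1(2)[of x] C2(2)[of x] that \<epsilon> by (intro mult_left_mono add_mono) auto
  have \<mu>: "\<epsilon> * (C11 + C21) \<le> L x" if "a < x" "x < b" for x
    unfolding Leq using C1(2)[of x] C2(2)[of x] that \<epsilon> by (intro mult_left_mono add_mono) auto
  have \<mu>0: "0 < \<epsilon> * (C11 + C21)" using C1(1) C2(1) \<epsilon> by simp
  have \<eta>': "\<bar>- (\<epsilon> * k1' x)\<bar> \<le> \<eta>" "\<bar>\<epsilon> * k2' x\<bar> \<le> \<eta>" if "a < x" "x < b" for x
    using \<eta>[OF that] \<epsilon> by (simp_all add: abs_mult)
  \<comment> \<open>The common scale of \<tau> and of the source bound. In the products under the
    roots it occurs squared, and the prefactor \<kappa> reduces it to
    \<open>\<kappa> * e = \<epsilon>\<close>.\<close>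
  define e where "e = \<epsilon> powr (1 + \<gamma>)"
  have e0: "0 < e" using \<epsilon> by (simp add: e_def)
  have \<tau>e: "\<tau> = e * H1" using \<epsilon> by (simp add: \<tau>_def e_def powr_add)
  have \<kappa>e: "\<kappa> * e = \<epsilon>" using \<epsilon> by (simp add: \<kappa>_def e_def flip: powr_add)
  have f': "L2_on R f" using f by (simp add: R)
  have Fc': "(\<integral>z\<in>?\<theta>. (f z)\<^sup>2 \<partial>lborel) \<le> c * e" using Fc by (simp add: F0_def e_def)
  have "sqrt (\<integral>z\<in>R. (w z - wh (fst z))\<^sup>2 + (gw1 z - wh' (fst z))\<^sup>2 + (gw2 z)\<^sup>2 \<partial>lborel)
    \<le> \<kappa> * sqrt (c * e * \<tau> * (\<epsilon> * (C12 + C22))) + \<eta> * (\<kappa> * sqrt (c * e * \<tau> / (\<epsilon> * (C11 + C21))))"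
    by (rule energy_estimate[OF w w_eq v v_eq f' \<theta>m \<theta>R \<tau> \<Lambda> \<mu>0 \<mu> \<eta>' _ Fc']) (simp_all add: \<kappa>_def)
  also have "c * e * \<tau> * (\<epsilon> * (C12 + C22)) = e\<^sup>2 * \<epsilon> * (c * H1 * (C12 + C22))"
    by (simp add: \<tau>e power2_eq_square)
  also have "\<kappa> * sqrt (e\<^sup>2 * \<epsilon> * (c * H1 * (C12 + C22))) = sqrt \<epsilon> * (\<epsilon> * sqrt (c * H1 * (C12 + C22)))"
    using e0 by (simp add: real_sqrt_mult flip: \<kappa>e)
  also have "c * e * \<tau> / (\<epsilon> * (C11 + C21)) = e\<^sup>2 * (1 / \<epsilon>) * (c * H1 / (C11 + C21))"
    by (simp add: \<tau>e power2_eq_square)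
  also have "\<kappa> * sqrt (e\<^sup>2 * (1 / \<epsilon>) * (c * H1 / (C11 + C21))) = sqrt \<epsilon> * sqrt (c * H1 / (C11 + C21))"
  proof -
    have "\<kappa> * sqrt (e\<^sup>2 * (1 / \<epsilon>) * (c * H1 / (C11 + C21))) = \<kappa> * e * sqrt (1 / \<epsilon>) * sqrt (c * H1 / (C11 + C21))"
      using e0 by (simp only: real_sqrt_mult real_sqrt_abs abs_of_pos mult.assoc)
    also have "\<kappa> * e * sqrt (1 / \<epsilon>) = sqrt \<epsilon>"
      unfolding \<kappa>e using \<epsilon> by (simp add: real_sqrt_divide real_div_sqrt)
    finally show ?thesis .
  qed
  finally have *: "sqrt (\<integral>z\<in>R. (w z - wh (fst z))\<^sup>2 + (gw1 z - wh' (fst z))\<^sup>2 + (gw2 z)\<^sup>2 \<partial>lborel)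
     \<le> sqrt \<epsilon> * (\<epsilon> * sqrt (c * H1 * (C12 + C22)) + \<eta> * sqrt (c * H1 / (C11 + C21)))"
    by (simp add: algebra_simps)
  have "\<epsilon> powr (-1/2) * sqrt \<epsilon> = 1"
    using \<epsilon> by (simp add: powr_half_sqrt[symmetric] flip: powr_add)
  moreover have "rH1 \<epsilon> (Rdom a b k1 k2 \<epsilon>) (\<lambda>z. w z - wh (fst z)) (\<lambda>z. gw1 z - wh' (fst z)) gw2
     \<le> \<epsilon> powr (-1/2) * (sqrt \<epsilon> * (\<epsilon> * sqrt (c * H1 * (C12 + C22)) + \<eta> * sqrt (c * H1 / (C11 + C21))))"
    unfolding rH1_def R by (rule mult_left_mono[OF *]) simp
  ultimately show ?thesis by (simp add: mult.assoc[symmetric])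
qed

theorem theorem3p1:
  fixes a b \<gamma> C11 C12 C21 C22 H0 H1 c :: real
    and k1 k2 k1' k2' H H' :: "real \<Rightarrow> real \<Rightarrow> real"
    and f w gw1 gw2 :: "real \<Rightarrow> real \<times> real \<Rightarrow> real"
    and wh wh' :: "real \<Rightarrow> real \<Rightarrow> real"
  assumes ab: "a < b" and gamma: "\<gamma> > 0"
    and k1_C1: "\<forall>\<epsilon>\<in>{0<..<1}. continuous_on {a..b} (k1' \<epsilon>) \<and>
                 (\<forall>x\<in>{a..b}. (k1 \<epsilon> has_real_derivative k1' \<epsilon> x) (at x within {a..b}))"
    and k2_C1: "\<forall>\<epsilon>\<in>{0<..<1}. continuous_on {a..b} (k2' \<epsilon>) \<and>
                 (\<forall>x\<in>{a..b}. (k2 \<epsilon> has_real_derivative k2' \<epsilon> x) (at x within {a..b}))"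
    and H1_k1: "((\<lambda>\<epsilon>. SUP x\<in>{a<..<b}. \<epsilon> * \<bar>k1' \<epsilon> x\<bar>) \<longlongrightarrow> 0) (at_right 0)"
    and H1_k2: "((\<lambda>\<epsilon>. SUP x\<in>{a<..<b}. \<epsilon> * \<bar>k2' \<epsilon> x\<bar>) \<longlongrightarrow> 0) (at_right 0)"
    and H2_k1: "0 < C11" "C11 \<le> C12" "\<forall>\<epsilon>\<in>{0<..<1}. \<forall>x\<in>{a..b}. C11 \<le> k1 \<epsilon> x \<and> k1 \<epsilon> x \<le> C12"
    and H2_k2: "0 < C21" "C21 \<le> C22" "\<forall>\<epsilon>\<in>{0<..<1}. \<forall>x\<in>{a..b}. C21 \<le> k2 \<epsilon> x \<and> k2 \<epsilon> x \<le> C22"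
    and H_C1: "\<forall>\<epsilon>\<in>{0<..<1}. continuous_on {a..b} (H' \<epsilon>) \<and>
                 (\<forall>x\<in>{a..b}. (H \<epsilon> has_real_derivative H' \<epsilon> x) (at x within {a..b}))"
    and H_bds: "0 \<le> H0" "H0 \<le> H1" "\<forall>\<epsilon>\<in>{0<..<1}. \<forall>x\<in>{a..b}. H0 \<le> H \<epsilon> x \<and> H \<epsilon> x \<le> H1"
    and f_L2: "\<forall>\<epsilon>\<in>{0<..<1}. L2_on (Rdom a b (k1 \<epsilon>) (k2 \<epsilon>) \<epsilon>) (f \<epsilon>)"
    and F: "\<forall>\<epsilon>\<in>{0<..<1}. \<epsilon> powr (-\<gamma>) * (rL2 \<epsilon> (Theta a b (k2 \<epsilon>) (H \<epsilon>) \<gamma> \<epsilon>) (f \<epsilon>))\<^sup>2 \<le> c"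
    and sol: "\<forall>\<^sub>F \<epsilon> in at_right 0.
               solves_P (Rdom a b (k1 \<epsilon>) (k2 \<epsilon>) \<epsilon>) (Theta a b (k2 \<epsilon>) (H \<epsilon>) \<gamma> \<epsilon>) \<gamma> \<epsilon>
                        (f \<epsilon>) (w \<epsilon>) (gw1 \<epsilon>) (gw2 \<epsilon>)"
    and solhat: "\<forall>\<^sub>F \<epsilon> in at_right 0.
               solves_Phat a b (\<lambda>x. k1 \<epsilon> x + k2 \<epsilon> x) \<gamma> \<epsilon>
                  (fhat (k1 \<epsilon>) (k2 \<epsilon>) (Theta a b (k2 \<epsilon>) (H \<epsilon>) \<gamma> \<epsilon>) (f \<epsilon>) \<epsilon>)
                  (wh \<epsilon>) (wh' \<epsilon>)"
  shows "((\<lambda>\<epsilon>. rH1 \<epsilon> (Rdom a b (k1 \<epsilon>) (k2 \<epsilon>) \<epsilon>)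
                 (\<lambda>z. w \<epsilon> z - wh \<epsilon> (fst z))
                 (\<lambda>z. gw1 \<epsilon> z - wh' \<epsilon> (fst z))
                 (gw2 \<epsilon>)) \<longlongrightarrow> 0) (at_right 0)"
proof (rule tendsto_sandwich)
  let ?S1 = "\<lambda>\<epsilon>. SUP x\<in>{a<..<b}. \<epsilon> * \<bar>k1' \<epsilon> x\<bar>"
  let ?S2 = "\<lambda>\<epsilon>. SUP x\<in>{a<..<b}. \<epsilon> * \<bar>k2' \<epsilon> x\<bar>"
  \<comment> \<open>A single \<eta> has to serve both boundaries: the sum of the absolute values of
    the two suprema dominates each slope and still tends to zero.\<close>
  let ?B = "\<lambda>\<epsilon>. \<epsilon> * sqrt (c * H1 * (C12 + C22)) + (\<bar>?S1 \<epsilon>\<bar> + \<bar>?S2 \<epsilon>\<bar>) * sqrt (c * H1 / (C11 + C21))"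
  show "\<forall>\<^sub>F \<epsilon> in at_right 0. 0 \<le> rH1 \<epsilon> (Rdom a b (k1 \<epsilon>) (k2 \<epsilon>) \<epsilon>)
      (\<lambda>z. w \<epsilon> z - wh \<epsilon> (fst z)) (\<lambda>z. gw1 \<epsilon> z - wh' \<epsilon> (fst z)) (gw2 \<epsilon>)"
    by (intro always_eventually) (simp add: rH1_def set_lebesgue_integral_def integral_nonneg_AE)
  \<comment> \<open>The value \<open>0 powr \<gamma>\<close> is 0, so the limit lies below C11 and
    the strip is eventually contained in the domain.\<close>
  have "((\<lambda>\<epsilon>. \<epsilon> powr \<gamma> * H1) \<longlongrightarrow> 0 powr \<gamma> * H1) (at_right 0)"
    using gamma by (intro tendsto_intros tendsto_powr') (auto simp: eventually_at_filter)
  then have small: "\<forall>\<^sub>F \<epsilon> in at_right 0. \<epsilon> powr \<gamma> * H1 < C11"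
    using H2_k1(1) by (intro order_tendstoD) auto
  have unit: "\<forall>\<^sub>F \<epsilon> in at_right 0. \<epsilon> \<in> {0<..<1::real}"
    by (rule eventually_at_rightI[of 0 1]) auto
  show "\<forall>\<^sub>F \<epsilon> in at_right 0. rH1 \<epsilon> (Rdom a b (k1 \<epsilon>) (k2 \<epsilon>) \<epsilon>)
      (\<lambda>z. w \<epsilon> z - wh \<epsilon> (fst z)) (\<lambda>z. gw1 \<epsilon> z - wh' \<epsilon> (fst z)) (gw2 \<epsilon>) \<le> ?B \<epsilon>"
    using sol solhat small unit
  proof eventually_elim
    case (elim \<epsilon>)
    note \<epsilon> = elim(4)
    have Hc: "continuous_on {a..b} (H \<epsilon>)"
      by (rule DERIV_continuous_on) (use H_C1 \<epsilon> in blast)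
    show ?case
    proof (rule rescaled_estimate[OF ab, where k1'="k1' \<epsilon>" and k2'="k2' \<epsilon>"])
      show "\<epsilon> * \<bar>k1' \<epsilon> x\<bar> \<le> \<bar>?S1 \<epsilon>\<bar> + \<bar>?S2 \<epsilon>\<bar>" if "a < x" "x < b" for x
        using abs_le_Sup_scaled[of a b "k1' \<epsilon>" x \<epsilon>] k1_C1 \<epsilon> that by fastforce
      show "\<epsilon> * \<bar>k2' \<epsilon> x\<bar> \<le> \<bar>?S1 \<epsilon>\<bar> + \<bar>?S2 \<epsilon>\<bar>" if "a < x" "x < b" for x
        using abs_le_Sup_scaled[of a b "k2' \<epsilon>" x \<epsilon>] k2_C1 \<epsilon> that by fastforce
      show "0 \<le> H \<epsilon> x \<and> H \<epsilon> x \<le> H1" if "x \<in> {a..b}" for x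
      proof -
        have "H0 \<le> H \<epsilon> x \<and> H \<epsilon> x \<le> H1" using H_bds(3) \<epsilon> that by blast
        then show ?thesis using H_bds(1) by linarith
      qed
    qed (use elim \<epsilon> k1_C1 k2_C1 H2_k1 H2_k2 Hc f_L2 F in auto)
  qed
  have "(?B \<longlongrightarrow> 0 * sqrt (c * H1 * (C12 + C22)) + (\<bar>0\<bar> + \<bar>0\<bar>) * sqrt (c * H1 / (C11 + C21))) (at_right 0)"
    by (intro tendsto_intros H1_k1 H1_k2)
  then show "(?B \<longlongrightarrow> 0) (at_right 0)" by simp
qed (rule tendsto_const)

end
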